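(* Let $n\ge 0$, let $C_0,\ldots,C_n\in\mathcal{P}(\mathbb{R}^d)$ be polyhedral cones and let $T_0,\ldots,T_n\in \mathrm{GL}_d$. Then for $Q_0,\ldots,Q_n\in O(d)$ independent and uniformly at random, $$\mathbb{E}\bigg[ v_0\bigg( \bigcap_{i=0}^n T_iQ_i C_i \bigg)\bigg] = \sum_{j=0}^{nd} v_j(C_0\times\cdots\times C_n),\qquad \mathbb{E}\bigg[ v_d\bigg( \sum_{i=0}^n T_iQ_i C_i \bigg)\bigg] = \sum_{j=0}^{nd} v_{d+j}(C_0\times\cdots\times C_n),$$ where $\sum_{i=0}^n T_iQ_iC_i$ is the Minkowski sum.
   Context: A polyhedral cone in $\mathbb{R}^d$ is a set of the form $\{x\in\mathbb{R}^d : Ax\le 0\}$ for some real matrix $A$ with $d$ columns; $\mathcal{P}(\mathbb{R}^d)$ is the set of polyhedral cones in $\mathbb{R}^d$. A face of $C\in\mathcal{P}(\mathbb{R}^d)$ is a subset of the form $F=\{x\in C: \langle x,z\rangle=0\}$, where $z\in\mathbb{R}^d$ satisfies $\langle x,z\rangle\le 0$ for all $x\in C$ (in particular $C$ itself is a face). $\mathcal{L}_k(C)$ is the (finite) set of linear spans of faces of $C$ whose span has dimension $k$. The polar cone is $C^\circ=\{z: \langle x,z\rangle\le 0 \text{ for all } x\in C\}$. For a linear subspace $L$, $\gamma_L$ denotes the standard Gaussian measure on $L$ (the Dirac measure at the origin if $\dim L=0$). For $C\in\mathcal{P}(\mathbb{R}^d)$ and $0\le k\le d$, the $k$th conic intrinsic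 volume is $$v_k(C)=\sum_{L\in\mathcal{L}_k(C)}\gamma_L(C\cap L)\,\gamma_{L^\perp}(C^\circ\cap L^\perp).$$ The product $C_0\times\cdots\times C_n$ is a polyhedral cone in $\mathbb{R}^{(n+1)d}$. "Uniformly at random" in the orthogonal group $O(d)$ means distributed according to the normalized Haar measure. *)

theory Defs
  imports "HOL-Probability.Probability"
begin

text \<open>The finite set \<open>A\<close> is the set of rows of the matrix in \<open>{x. A x \<le> 0}\<close>; for \<open>A = {}\<close>
  the cone is the whole space, which is also the cone of a zero matrix.\<close>

definition polyhedral_cone :: "'a::euclidean_space set \<Rightarrow> bool" where
  "polyhedral_cone C \<longleftrightarrow> (\<exists>A. finite A \<and> C = {x. \<forall>a\<in>A. a \<bullet> x \<le> 0})"

definition cone_face :: "'a::euclidean_space set \<Rightarrow> 'a set \<Rightarrow> bool" where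
  "cone_face C F \<longleftrightarrow> (\<exists>z. (\<forall>x\<in>C. x \<bullet> z \<le> 0) \<and> F = {x\<in>C. x \<bullet> z = 0})"

definition face_spans :: "nat \<Rightarrow> 'a::euclidean_space set \<Rightarrow> 'a set set" where
  "face_spans k C = {L. dim L = k \<and> (\<exists>F. cone_face C F \<and> L = span F)}"

definition polar :: "'a::euclidean_space set \<Rightarrow> 'a set" where
  "polar C = {z. \<forall>x\<in>C. x \<bullet> z \<le> 0}"

definition orthonormal_basis :: "'a::euclidean_space set \<Rightarrow> 'a set \<Rightarrow> bool" where
  "orthonormal_basis B L \<longleftrightarrow> pairwise orthogonal B \<and> (\<forall>b\<in>B. norm b = 1) \<and> span B = L"

lemma ex_orthonormal_basis:
  assumes "subspace L"
  shows "\<exists>B. orthonormal_basis B L"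
  using orthonormal_basis_subspace[OF assms] unfolding orthonormal_basis_def by metis

text \<open>The standard Gaussian measure on a subspace \<open>L\<close>, as a measure on the Borel sets of the
  ambient space: the law of \<open>\<Sum>b\<in>B. g b *\<^sub>R b\<close> where \<open>B\<close> is an orthonormal basis of \<open>L\<close> and
  the \<open>g b\<close> are independent standard normal variables. By rotation invariance it does not
  depend on the basis chosen; for \<open>L = {0}\<close> the basis is empty and the law is the Dirac
  measure at \<open>0\<close>.\<close>

definition gaussian_on :: "'a::euclidean_space set \<Rightarrow> 'a measure" where
  "gaussian_on L =
     (let B = (SOME B. orthonormal_basis B L)
      in distr (\<Pi>\<^sub>M b\<in>B. std_normal_distribution) borel (\<lambda>g. \<Sum>b\<in>B. g b *\<^sub>R b))"

definition conic_intrinsic_volume :: "nat \<Rightarrow> 'a::euclidean_space set \<Rightarrow> real" where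
  "conic_intrinsic_volume k C =
     (\<Sum>L\<in>face_spans k C.
        measure (gaussian_on L) (C \<inter> L) *
        measure (gaussian_on (L\<^sup>\<bottom>)) (polar C \<inter> L\<^sup>\<bottom>))"

text \<open>The product of a family of sets in \<open>\<real>\<^sup>d\<close> indexed by a finite type \<open>'m\<close>, realised in the
  Euclidean space \<open>(real^'d)^'m\<close> of dimension \<open>CARD('m) * CARD('d)\<close>.\<close>

definition cone_product :: "('m::finite \<Rightarrow> (real^'d) set) \<Rightarrow> (real^'d^'m) set" where
  "cone_product C = {x. \<forall>i. x $ i \<in> C i}"

definition orthogonal_borel :: "(real^'d^'d) measure" where
  "orthogonal_borel = restrict_space borel {Q. orthogonal_matrix Q}"

text \<open>\<open>\<mu>\<close> is the normalized Haar measure of the orthogonal group, that is, the left-invariant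
  Borel probability measure on it.\<close>

definition is_orthogonal_haar :: "(real^'d^'d) measure \<Rightarrow> bool" where
  "is_orthogonal_haar \<mu> \<longleftrightarrow>
     prob_space \<mu> \<and> sets \<mu> = sets orthogonal_borel \<and>
     (\<forall>R. orthogonal_matrix R \<longrightarrow> distr \<mu> orthogonal_borel (\<lambda>Q. R ** Q) = \<mu>)"

end

theory Submission
  imports Defs
begin

text \<open>
  Write \<open>A x = \<Sum>i. T i *v (Q i *v x $ i)\<close> for the random linear map \<open>block_map T q\<close> and \<open>K\<close>
  for the product cone. For a closed cone the top intrinsic volume is the Gaussian measure
  of the cone and the lowest one is the Gaussian measure of its polar. The Minkowski sum is
  \<open>A ` K\<close>, and the polar of the intersection is a set of the same kind, built from the
  polars of the cones and the inverse transposes of the matrices. Both formulas therefore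
  concern the probability that a Gaussian vector \<open>y\<close> lies in \<open>A ` K\<close>.

  To compute it, choose a second Gaussian vector \<open>w\<close> and consider the point of the fibre
  \<open>{x\<in>K. A x = y}\<close> for which the rotated point is closest to \<open>w\<close>. The optimality conditions
  (\<open>fibre_closest_point\<close>) say that this point is the projection to \<open>L\<close> of some
  \<open>z \<in> biconic L K (polar K)\<close>, where \<open>L\<close> is the span of a face of \<open>K\<close>, and that \<open>z\<close> solves a
  square linear system with right hand side \<open>(y, w)\<close> (\<open>solves\<close>). For almost every \<open>(y, w)\<close>
  the subspace \<open>L\<close> is determined by \<open>(y, w)\<close>, so the indicator of the event \<open>y \<in> A ` K\<close> is a
  sum over the face spans \<open>L\<close>. If \<open>dim L < d\<close>, the system is almost never solvable. If
  \<open>dim L \<ge> d\<close>, then \<open>A\<close> almost surely maps \<open>L\<close> onto the whole space (\<open>AE_image_UNIV\<close>) and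
  the solution \<open>z\<close> is unique.

  The remaining point is that \<open>z\<close> lies in \<open>biconic L K (polar K)\<close> with probability
  \<open>measure (gaussian_on L) (K \<inter> L) * measure (gaussian_on (L\<^sup>\<bottom>)) (polar K \<inter> L\<^sup>\<bottom>)\<close>, the
  contribution of \<open>L\<close> to the intrinsic volumes. As \<open>K\<close> is a product, \<open>L\<close> is a product of
  subspaces \<open>V i\<close>, and the right invariance of Haar measure makes the law of \<open>z\<close> invariant
  under all block orthogonal maps that preserve \<open>L\<close>. These act transitively on the vectors
  whose components in the subspaces \<open>V i\<close> and in their complements have prescribed norms, so
  after normalising the components the law of \<open>z\<close> is that of a normalised Gaussian vector
  (\<open>emeasure_solves\<close>). This law does not involve the matrices \<open>T i\<close>. The two laws are
  compared by a lemma of Christensen: two probability measures that are concentrated on the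
  same set coincide if each of them gives equal mass to balls of equal radius with centres
  in this set (\<open>prob_measure_eqI_uniform\<close>). The same argument gives the invariance of
  Lebesgue measure under linear isometries, hence that of the Gaussian measure.
\<close>

section \<open>Polyhedral cones and their polars\<close>

lemma zero_in_polar: "0 \<in> polar S"
  by (simp add: polar_def)

lemma polar_inner_le: "z \<in> polar S \<Longrightarrow> x \<in> S \<Longrightarrow> x \<bullet> z \<le> 0"
  by (simp add: polar_def)

lemma closed_polar: "closed (polar S)"
proof -
  have "polar S = (\<Inter>x\<in>S. {z. x \<bullet> z \<le> 0})"
    by (auto simp: polar_def)
  then show ?thesis
    by (auto intro!: closed_INT closed_halfspace_le)
qed

lemma convex_cone_polar: "convex_cone (polar S)"
  unfolding convex_cone_iff polar_def by (auto simp: inner_right_distrib add_nonpos_nonpos mult_nonneg_nonpos)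

lemma polar_convex_cone_hull: "polar (convex_cone hull S) = polar S"
proof
  show "polar (convex_cone hull S) \<subseteq> polar S"
    unfolding polar_def using hull_subset by fastforce
  show "polar S \<subseteq> polar (convex_cone hull S)"
  proof
    fix z assume z: "z \<in> polar S"
    have "convex_cone hull S \<subseteq> {x. z \<bullet> x \<le> 0}"
      using z by (intro hull_minimal convex_cone_halfspace_le) (auto simp: polar_def inner_commute)
    then show "z \<in> polar (convex_cone hull S)"
      by (auto simp: polar_def inner_commute)
  qed
qed

text \<open>Separating a point from \<open>K\<close> by a hyperplane produces a vector \<open>a\<close> in the polar, because a
  linear functional that is bounded below on a cone is nonnegative on it.\<close>

lemma polar_polar:
  fixes K :: "'a::euclidean_space set"
  assumes "closed K" "convex_cone K"
  shows "polar (polar K) = K"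
proof
  show "K \<subseteq> polar (polar K)"
    by (auto simp: polar_def inner_commute)
  show "polar (polar K) \<subseteq> K"
  proof
    fix x assume x: "x \<in> polar (polar K)"
    show "x \<in> K"
    proof (rule ccontr)
      assume "x \<notin> K"
      then obtain a b where ab: "a \<bullet> x < b" "\<forall>y\<in>K. b < a \<bullet> y"
        using separating_hyperplane_closed_point[of K x] assms
        by (auto simp: convex_cone_def)
      have "0 \<in> K" using assms(2) by (rule convex_cone_contains_0)
      then have "b < 0" using ab(2) by force
      have "0 \<le> a \<bullet> y" if "y \<in> K" for y
      proof (rule ccontr)
        assume "\<not> 0 \<le> a \<bullet> y"
        then have neg: "a \<bullet> y < 0" by simp
        have "(b / (a \<bullet> y)) *\<^sub>R y \<in> K"
          using assms(2) that neg \<open>b < 0\<close> by (intro convex_cone_scaleR) (auto simp: divide_nonpos_neg)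
        then have "b < a \<bullet> ((b / (a \<bullet> y)) *\<^sub>R y)" using ab(2) by blast
        then show False using neg by simp
      qed
      then have "- a \<in> polar K" by (auto simp: polar_def inner_commute)
      then have "- a \<bullet> x \<le> 0" using x by (rule polar_inner_le[rotated])
      then show False using ab(1) \<open>b < 0\<close> by simp
    qed
  qed
qed

lemma polyhedral_cone_iff_polar: "polyhedral_cone C \<longleftrightarrow> (\<exists>A. finite A \<and> C = polar A)"
  by (simp add: polyhedral_cone_def polar_def)

lemma polyhedral_cone_closed: "polyhedral_cone C \<Longrightarrow> closed C"
  by (auto simp: polyhedral_cone_iff_polar closed_polar)

lemma polyhedral_cone_convex_cone: "polyhedral_cone C \<Longrightarrow> convex_cone C"
  by (auto simp: polyhedral_cone_iff_polar convex_cone_polar)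

lemma polyhedral_cone_polar_polar: "polyhedral_cone C \<Longrightarrow> polar (polar C) = C"
  by (simp add: polar_polar polyhedral_cone_closed polyhedral_cone_convex_cone)

text \<open>The hull is a polyhedron and so an intersection of half-spaces \<open>a \<bullet> x \<le> b\<close>; on a cone each
  of them may be replaced by its homogeneous version \<open>a \<bullet> x \<le> 0\<close>.\<close>

lemma polyhedral_cone_convex_cone_hull:
  fixes S :: "'a::euclidean_space set"
  assumes "finite S"
  shows "polyhedral_cone (convex_cone hull S)" (is "polyhedral_cone ?K")
proof -
  have K: "convex_cone ?K" by (rule convex_cone_convex_cone_hull)
  from polyhedron_convex_cone_hull[OF assms] obtain F where F: "finite F" "?K = \<Inter> F"
      "\<forall>h\<in>F. \<exists>a b. a \<noteq> 0 \<and> h = {x. a \<bullet> x \<le> b}"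
    unfolding polyhedron_def by auto
  then obtain a b where ab: "\<And>h. h \<in> F \<Longrightarrow> h = {x. a h \<bullet> x \<le> b h}"
    by metis
  have b0: "0 \<le> b h" if "h \<in> F" for h
  proof -
    have "0 \<in> h" using that F(2) convex_cone_contains_0[OF K] by auto
    then show ?thesis using ab[OF that] by (metis inner_zero_right mem_Collect_eq)
  qed
  have neg: "a h \<bullet> x \<le> 0" if h: "h \<in> F" and x: "x \<in> ?K" for h x
  proof (rule ccontr)
    assume "\<not> a h \<bullet> x \<le> 0"
    then have pos: "a h \<bullet> x > 0" by simp
    have "((b h + 1) / (a h \<bullet> x)) *\<^sub>R x \<in> ?K"
      using K x pos b0[OF h] by (intro convex_cone_scaleR) auto
    then have "((b h + 1) / (a h \<bullet> x)) *\<^sub>R x \<in> h" using F(2) h by blast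
    then have "a h \<bullet> (((b h + 1) / (a h \<bullet> x)) *\<^sub>R x) \<le> b h" using ab[OF h] by blast
    then show False using pos by simp
  qed
  have "?K = polar (a ` F)"
  proof
    show "?K \<subseteq> polar (a ` F)" using neg by (auto simp: polar_def)
    have "x \<in> h" if "x \<in> polar (a ` F)" "h \<in> F" for x h
    proof -
      have "a h \<bullet> x \<le> 0" using that by (auto simp: polar_def)
      then have "a h \<bullet> x \<le> b h" using b0[OF that(2)] by linarith
      then show ?thesis using ab[OF that(2)] by blast
    qed
    then show "polar (a ` F) \<subseteq> ?K" using F(2) by auto
  qed
  then show ?thesis using F(1) by (auto simp: polyhedral_cone_iff_polar)
qed

lemma polar_of_finite:
  fixes A :: "'a::euclidean_space set"
  assumes "finite A"
  shows "polar (polar A) = convex_cone hull A"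
  using polar_polar[OF closed_convex_cone_hull[OF assms] convex_cone_convex_cone_hull]
  by (simp add: polar_convex_cone_hull)

lemma polyhedral_cone_polar:
  fixes C :: "'a::euclidean_space set"
  shows "polyhedral_cone C \<Longrightarrow> polyhedral_cone (polar C)"
  by (metis polar_of_finite polyhedral_cone_convex_cone_hull polyhedral_cone_iff_polar)

text \<open>The Minkowski-Weyl theorem. A polyhedral cone is generated by finitely many vectors because
  its polar is, being the polar of a finite set, again polyhedral.\<close>

lemma polyhedral_cone_iff_finitely_generated:
  fixes C :: "'a::euclidean_space set"
  shows "polyhedral_cone C \<longleftrightarrow> (\<exists>S. finite S \<and> C = convex_cone hull S)"
proof
  assume C: "polyhedral_cone C"
  from polyhedral_cone_polar[OF C] obtain A where A: "finite A" "polar C = polar A"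
    by (auto simp: polyhedral_cone_iff_polar)
  then have "C = convex_cone hull A"
    using polar_of_finite[OF A(1)] polyhedral_cone_polar_polar[OF C] by simp
  with A(1) show "\<exists>S. finite S \<and> C = convex_cone hull S" by blast
qed (auto intro: polyhedral_cone_convex_cone_hull)

lemma polyhedral_cone_linear_image:
  fixes f :: "'a::euclidean_space \<Rightarrow> 'b::euclidean_space"
  assumes "linear f" "polyhedral_cone C"
  shows "polyhedral_cone (f ` C)"
  using assms by (metis convex_cone_hull_linear_image finite_imageI polyhedral_cone_iff_finitely_generated)

lemma polyhedral_cone_sum:
  fixes C D :: "'a::euclidean_space set"
  assumes "polyhedral_cone C" "polyhedral_cone D"
  shows "polyhedral_cone {x + y | x y. x \<in> C \<and> y \<in> D}"
proof -
  from assms obtain S T where "finite S" "C = convex_cone hull S" "finite T" "D = convex_cone hull T"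
    by (auto simp: polyhedral_cone_iff_finitely_generated)
  moreover from this have "{x + y | x y. x \<in> C \<and> y \<in> D} = convex_cone hull (S \<union> T)"
    by (auto simp: convex_cone_hull_Un)
  ultimately show ?thesis
    by (auto simp: polyhedral_cone_iff_finitely_generated intro: finite_UnI)
qed

lemma polyhedral_cone_Int:
  assumes "polyhedral_cone C" "polyhedral_cone D"
  shows "polyhedral_cone (C \<inter> D)"
proof -
  from assms obtain A B where "finite A" "C = polar A" "finite B" "D = polar B"
    by (auto simp: polyhedral_cone_iff_polar)
  then have "finite (A \<union> B)" "C \<inter> D = polar (A \<union> B)" by (auto simp: polar_def)
  then show ?thesis unfolding polyhedral_cone_iff_polar by blast
qed

lemma mem_orthogonal_comp: "x \<in> L\<^sup>\<bottom> \<longleftrightarrow> (\<forall>y\<in>L. y \<bullet> x = 0)"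
  by (simp add: orthogonal_comp_def orthogonal_def)

lemma orthogonal_comp_span: "(span S)\<^sup>\<bottom> = S\<^sup>\<bottom>"
proof
  show "(span S)\<^sup>\<bottom> \<subseteq> S\<^sup>\<bottom>" by (intro orthogonal_comp_anti_mono span_superset)
  show "S\<^sup>\<bottom> \<subseteq> (span S)\<^sup>\<bottom>"
  proof
    fix x assume "x \<in> S\<^sup>\<bottom>"
    then have "\<And>y. y \<in> S \<Longrightarrow> orthogonal x y"
      by (simp add: orthogonal_comp_def orthogonal_commute)
    then have "orthogonal x y" if "y \<in> span S" for y
      using that orthogonal_to_span by blast
    then show "x \<in> (span S)\<^sup>\<bottom>"
      by (simp add: orthogonal_comp_def orthogonal_commute)
  qed
qed

lemma polar_subspace:
  assumes "subspace L"
  shows "polar L = L\<^sup>\<bottom>"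
proof -
  have "y \<bullet> z = 0" if "\<forall>x\<in>L. x \<bullet> z \<le> 0" "y \<in> L" for y z
  proof -
    have "- y \<in> L" using assms that(2) by (rule subspace_neg)
    then have "- y \<bullet> z \<le> 0" using that(1) by blast
    then show ?thesis using that by force
  qed
  then show ?thesis by (auto simp: polar_def mem_orthogonal_comp)
qed

lemma polyhedral_cone_subspace:
  fixes L :: "'a::euclidean_space set"
  assumes "subspace L"
  shows "polyhedral_cone L"
proof -
  obtain B where B: "finite B" "span B = L\<^sup>\<bottom>"
    using basis_exists[of "L\<^sup>\<bottom>"] subspace_orthogonal_comp[of L]
    by (metis dim_span independent_imp_finite span_eq_iff span_subspace)
  have "L = polar (L\<^sup>\<bottom>)"
    using polar_subspace[OF subspace_orthogonal_comp, of L] orthogonal_comp_self[OF assms] by simp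
  also have "\<dots> = polar (B \<union> uminus ` B)"
  proof -
    have "x \<in> (span B)\<^sup>\<bottom>" if x: "\<forall>a\<in>B \<union> uminus ` B. a \<bullet> x \<le> 0" for x
    proof -
      have "a \<bullet> x = 0" if "a \<in> B" for a
      proof -
        have "a \<bullet> x \<le> 0" "- a \<bullet> x \<le> 0" using x that by blast+
        then show ?thesis by simp
      qed
      then show ?thesis by (simp add: orthogonal_comp_span mem_orthogonal_comp)
    qed
    moreover have "a \<bullet> x \<le> 0" if x: "x \<in> (span B)\<^sup>\<bottom>" and a: "a \<in> B \<union> uminus ` B" for x a
    proof -
      have "a \<in> span B" using a by (auto intro: span_base span_neg)
      then show ?thesis using x by (auto simp: mem_orthogonal_comp)
    qed
    ultimately have "(span B)\<^sup>\<bottom> = polar (B \<union> uminus ` B)"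
      unfolding polar_def set_eq_iff mem_Collect_eq by blast
    then show ?thesis using B(2) polar_subspace[OF subspace_orthogonal_comp, of L] by simp
  qed
  finally show ?thesis using B(1)
    unfolding polyhedral_cone_iff_polar by (intro exI[of _ "B \<union> uminus ` B"]) simp
qed

text \<open>The face is the minimal one containing \<open>x\<close>: it consists of the points of \<open>C\<close> that satisfy
  with equality all constraints active at \<open>x\<close>. A small step from \<open>x\<close> in direction \<open>- y\<close>
  stays in \<open>C\<close> for every \<open>y\<close> in the face, and this forces \<open>n\<close> to be orthogonal to \<open>y\<close>.\<close>

lemma polyhedral_cone_complementary_face:
  fixes C :: "'a::euclidean_space set"
  assumes "polyhedral_cone C" "x \<in> C" "n \<in> polar C" "x \<bullet> n = 0"
  obtains F where "cone_face C F" "x \<in> F" "n \<in> (span F)\<^sup>\<bottom>"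
proof -
  obtain A where A: "finite A" "C = polar A"
    using assms(1) by (auto simp: polyhedral_cone_iff_polar)
  define B where "B = {a\<in>A. a \<bullet> x = 0}"
  define F where "F = {y\<in>C. y \<bullet> sum id B = 0}"
  have fB: "finite B" using A(1) by (simp add: B_def)
  have le: "y \<bullet> a \<le> 0" if "y \<in> C" "a \<in> A" for y a
    using that A(2) by (auto simp: polar_def inner_commute)
  have leB: "y \<bullet> a \<le> 0" if "y \<in> C" "a \<in> B" for y a
    using le that by (simp add: B_def)
  have "cone_face C F"
    unfolding cone_face_def F_def
    by (rule exI[of _ "sum id B"]) (auto simp: inner_sum_right intro!: sum_nonpos leB)
  moreover have "x \<in> F"
    using assms(2) by (auto simp: F_def B_def inner_sum_right inner_commute intro!: sum.neutral)
  moreover have "n \<in> (span F)\<^sup>\<bottom>"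
  proof -
    have "y \<bullet> n = 0" if y: "y \<in> F" for y
    proof (rule antisym)
      have yC: "y \<in> C" using y by (simp add: F_def)
      show "y \<bullet> n \<le> 0" using assms(3) yC by (rule polar_inner_le)
      have act: "y \<bullet> a = 0" if "a \<in> B" for a
      proof -
        have "(\<Sum>a\<in>B. - (y \<bullet> a)) = 0"
          using y by (simp add: F_def inner_sum_right sum_negf)
        then have "\<forall>a\<in>B. - (y \<bullet> a) = 0"
          by (subst (asm) sum_nonneg_eq_0_iff[OF fB]) (use leB yC in auto)
        then show ?thesis using that by simp
      qed
      have "\<forall>a\<in>A. \<forall>\<^sub>F e in at_right (0::real). a \<bullet> (x - e *\<^sub>R y) \<le> 0"
      proof
        fix a assume a: "a \<in> A"
        show "\<forall>\<^sub>F e in at_right (0::real). a \<bullet> (x - e *\<^sub>R y) \<le> 0"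
        proof (cases "a \<in> B")
          case True
          then show ?thesis using act by (simp add: B_def inner_diff_right inner_commute)
        next
          case False
          then have "a \<bullet> x < 0" using a le[OF assms(2) a] by (auto simp: B_def inner_commute)
          moreover have "((\<lambda>e. a \<bullet> (x - e *\<^sub>R y)) \<longlongrightarrow> a \<bullet> (x - 0 *\<^sub>R y)) (at_right 0)"
            by (intro tendsto_intros)
          ultimately have "\<forall>\<^sub>F e in at_right (0::real). a \<bullet> (x - e *\<^sub>R y) < 0"
            by (intro order_tendstoD(2)) auto
          then show ?thesis by (rule eventually_mono) simp
        qed
      qed
      then have "\<forall>\<^sub>F e in at_right (0::real). \<forall>a\<in>A. a \<bullet> (x - e *\<^sub>R y) \<le> 0"
        by (rule eventually_ball_finite[OF A(1)])
      moreover have "\<forall>\<^sub>F e in at_right (0::real). 0 < e"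
        by (rule eventually_at_right_less)
      ultimately have "\<forall>\<^sub>F e in at_right (0::real). 0 < e \<and> (\<forall>a\<in>A. a \<bullet> (x - e *\<^sub>R y) \<le> 0)"
        by eventually_elim auto
      then obtain e where e: "0 < e" "\<forall>a\<in>A. a \<bullet> (x - e *\<^sub>R y) \<le> 0"
        using eventually_happens[of _ "at_right (0::real)"] by auto
      then have "x - e *\<^sub>R y \<in> C" using A(2) by (simp add: polar_def)
      then have "(x - e *\<^sub>R y) \<bullet> n \<le> 0" using assms(3) by (rule polar_inner_le[rotated])
      then show "0 \<le> y \<bullet> n" using e(1) assms(4) by (simp add: inner_diff_left zero_le_mult_iff)
    qed
    then show ?thesis by (simp add: orthogonal_comp_span mem_orthogonal_comp)
  qed
  ultimately show ?thesis using that by blast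
qed

lemma subset_sums_left: "(0::'a::monoid_add) \<in> T \<Longrightarrow> S \<subseteq> {x + y | x y. x \<in> S \<and> y \<in> T}"
  by (metis (mono_tags, lifting) add.right_neutral mem_Collect_eq subsetI)

lemma subset_sums_right: "(0::'a::monoid_add) \<in> S \<Longrightarrow> T \<subseteq> {x + y | x y. x \<in> S \<and> y \<in> T}"
  by (metis (mono_tags, lifting) add.left_neutral mem_Collect_eq subsetI)

text \<open>First-order optimality for the point \<open>x\<close> of the fibre \<open>{x\<in>C. A x = y}\<close> closest to \<open>w\<close>. The
  vector \<open>w - x\<close> is normal to the fibre, and since \<open>C\<close> is polyhedral, a normal vector of the
  fibre is a sum of a normal vector of \<open>C\<close> and a vector orthogonal to the kernel of \<open>A\<close>: the
  set of these sums is a closed cone, and its polar consists of feasible directions.\<close>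

lemma fibre_closest_point:
  fixes C :: "'a::euclidean_space set" and A :: "'a \<Rightarrow> 'b::euclidean_space"
  assumes C: "polyhedral_cone C" and A: "linear A" and y: "y \<in> A ` C"
  obtains x n where "x \<in> C" "n \<in> polar C" "x \<bullet> n = 0" "A x = y" "x + n - w \<in> (A -` {0})\<^sup>\<bottom>"
proof -
  define L where "L = A -` {0}"
  have L: "subspace L" unfolding L_def using A by (intro linear_subspace_vimage) (auto simp: subspace_0)
  define P where "P = C \<inter> A -` {y}"
  have cc: "convex_cone C" using C by (rule polyhedral_cone_convex_cone)
  have contA: "continuous_on UNIV A" using A by (simp add: linear_continuous_on linear_conv_bounded_linear)
  have "closed (A -` {y})" using contA by (simp add: closed_vimage)
  then have P: "closed P" "P \<noteq> {}"
    using C y by (auto simp: P_def polyhedral_cone_closed)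
  have "convex (A -` {y})" using A by (simp add: convex_linear_vimage)
  then have cP: "convex P" using cc by (auto simp: P_def convex_cone_def intro: convex_Int)
  define x where "x = closest_point P w"
  have xP: "x \<in> P" using P by (simp add: x_def closest_point_in_set)
  then have x: "x \<in> C" "A x = y" by (auto simp: P_def)
  have opt: "(w - x) \<bullet> (x' - x) \<le> 0" if "x' \<in> P" for x'
    using closest_point_dot[OF cP P(1) that, of w] by (simp add: x_def)
  have sx: "subspace (span {x})" by simp
  define N where "N = polar C \<inter> (span {x})\<^sup>\<bottom>"
  define K where "K = {a + b | a b. a \<in> N \<and> b \<in> L\<^sup>\<bottom>}"
  have pN: "polyhedral_cone N"
    unfolding N_def using C
    by (simp add: polyhedral_cone_Int polyhedral_cone_polar polyhedral_cone_subspace subspace_orthogonal_comp)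
  have pK: "polyhedral_cone K"
    unfolding K_def using pN
    by (simp add: polyhedral_cone_sum polyhedral_cone_subspace subspace_orthogonal_comp)
  define M where "M = {a + b | a b. a \<in> C \<and> b \<in> span {x}}"
  have pM: "polyhedral_cone M"
    unfolding M_def using C sx by (intro polyhedral_cone_sum) (auto intro: polyhedral_cone_subspace)
  have polM: "polar M = N"
  proof
    have "z \<in> polar C" if "z \<in> polar M" for z
    proof -
      have "C \<subseteq> M" unfolding M_def by (rule subset_sums_left) (rule span_zero)
      then show ?thesis using that by (auto simp: polar_def)
    qed
    moreover have "z \<in> polar (span {x})" if "z \<in> polar M" for z
    proof -
      have "span {x} \<subseteq> M" unfolding M_def using convex_cone_contains_0[OF cc] by (rule subset_sums_right)
      then show ?thesis using that by (auto simp: polar_def)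
    qed
    ultimately show "polar M \<subseteq> N" by (auto simp: N_def polar_subspace[OF sx])
    show "N \<subseteq> polar M"
    proof
      fix z assume "z \<in> N"
      then have "\<forall>a\<in>C. a \<bullet> z \<le> 0" "\<forall>b\<in>span {x}. b \<bullet> z = 0"
        by (auto simp: N_def polar_def mem_orthogonal_comp)
      then show "z \<in> polar M" by (auto simp: M_def polar_def inner_left_distrib)
    qed
  qed
  have "w - x \<in> polar (polar K)"
    unfolding polar_def mem_Collect_eq
  proof
    fix h assume h: "h \<in> {z. \<forall>x\<in>K. x \<bullet> z \<le> 0}"
    then have h': "\<And>k. k \<in> K \<Longrightarrow> k \<bullet> h \<le> 0" by simp
    have "h \<in> polar N"
    proof -
      have "N \<subseteq> K" unfolding K_def using subspace_0[OF subspace_orthogonal_comp] by (rule subset_sums_left)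
      then show ?thesis using h' by (auto simp: polar_def)
    qed
    then have hM: "h \<in> M" using polM polyhedral_cone_polar_polar[OF pM] by simp
    have "h \<in> polar (L\<^sup>\<bottom>)"
    proof -
      have "0 \<in> N" using polyhedral_cone_convex_cone[OF pN] by (rule convex_cone_contains_0)
      then have "L\<^sup>\<bottom> \<subseteq> K" unfolding K_def by (rule subset_sums_right)
      then show ?thesis using h' by (auto simp: polar_def)
    qed
    then have hL: "h \<in> L"
      by (simp add: polar_subspace[OF subspace_orthogonal_comp] orthogonal_comp_self[OF L])
    from hM obtain c t where c: "c \<in> C" "h = c + t *\<^sub>R x"
      unfolding M_def by (auto simp: span_singleton)
    define e where "e = 1 / (1 + \<bar>t\<bar>)"
    have e: "0 < e" by (simp add: e_def add_pos_nonneg)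
    have "e * \<bar>t\<bar> \<le> 1" by (simp add: e_def)
    moreover have "- (e * \<bar>t\<bar>) \<le> e * t"
      using e mult_left_mono[of "- \<bar>t\<bar>" t e] by simp
    ultimately have et: "0 \<le> 1 + e * t" by linarith
    have "x + e *\<^sub>R h = e *\<^sub>R c + (1 + e * t) *\<^sub>R x"
      by (simp add: c(2) scaleR_add_right scaleR_add_left)
    moreover have "\<dots> \<in> C"
      using e et c(1) x(1) cc by (intro convex_cone_add convex_cone_scaleR) auto
    moreover have "A (x + e *\<^sub>R h) = y"
      using hL x(2) A by (simp add: L_def linear_add linear_cmul)
    ultimately have "x + e *\<^sub>R h \<in> P" by (simp add: P_def)
    from opt[OF this] have "e * ((w - x) \<bullet> h) \<le> 0" by simp
    then show "h \<bullet> (w - x) \<le> 0" using e by (simp add: mult_le_0_iff inner_commute)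
  qed
  then have "w - x \<in> K" using polyhedral_cone_polar_polar[OF pK] by simp
  then obtain n b where nb: "n \<in> N" "b \<in> L\<^sup>\<bottom>" "w - x = n + b" unfolding K_def by auto
  show thesis
  proof
    show "x \<in> C" "A x = y" by fact+
    show "n \<in> polar C" using nb(1) by (simp add: N_def)
    show "x \<bullet> n = 0" using nb(1) by (auto simp: N_def mem_orthogonal_comp span_base)
    have "x + n - w = n - (w - x)" by simp
    also have "\<dots> = - b" by (simp only: nb(3)) simp
    finally have "x + n - w = - b" .
    then show "x + n - w \<in> (A -` {0})\<^sup>\<bottom>"
      using nb(2) subspace_orthogonal_comp[of L] by (simp add: L_def subspace_neg)
  qed
qed

lemma finite_face_spans:
  fixes C :: "'a::euclidean_space set"
  assumes "polyhedral_cone C"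
  shows "finite {span F | F. cone_face C F}"
proof -
  obtain A where A: "finite A" "C = polar A"
    using assms by (auto simp: polyhedral_cone_iff_polar)
  have "polyhedron C"
    using assms by (metis polyhedral_cone_iff_finitely_generated polyhedron_convex_cone_hull)
  then have fin: "finite {F. F face_of C}" by (rule finite_polyhedron_faces)
  have "F face_of C" if "cone_face C F" for F
  proof -
    from that obtain z where z: "\<forall>x\<in>C. x \<bullet> z \<le> 0" "F = {x\<in>C. x \<bullet> z = 0}"
      by (auto simp: cone_face_def)
    have "C \<inter> {x. z \<bullet> x = 0} face_of C"
      using z(1) polyhedral_cone_convex_cone[OF assms]
      by (intro face_of_Int_supporting_hyperplane_le) (auto simp: inner_commute convex_cone_def)
    then show ?thesis using z(2) by (simp add: inner_commute Collect_conj_eq)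
  qed
  then have "{span F | F. cone_face C F} \<subseteq> span ` {F. F face_of C}" by auto
  then show ?thesis using fin finite_surj by blast
qed

section \<open>Borel measures determined by the masses of balls\<close>

text \<open>Christensen's argument. By openness of \<open>U\<close>, the quotient \<open>\<nu> (U \<inter> ball x \<epsilon>) / h \<epsilon>\<close> is \<open>1\<close> for
  each \<open>x \<in> X \<inter> U\<close> and all small \<open>\<epsilon>\<close>. Fatou's lemma bounds \<open>\<mu> U\<close> by the limit inferior of
  the \<open>\<mu>\<close>-integrals of this quotient. By Fubini's theorem and the symmetry of the relation
  \<open>dist x y < \<epsilon>\<close> these integrals equal \<open>\<nu> U\<close>.\<close>

lemma emeasure_le_of_equal_balls:
  fixes \<mu> \<nu> :: "'a::euclidean_space measure"
  assumes \<mu>: "sigma_finite_measure \<mu>" "sets \<mu> = sets borel" "AE x in \<mu>. x \<in> X"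
    and \<nu>: "sigma_finite_measure \<nu>" "sets \<nu> = sets borel" "AE x in \<nu>. x \<in> X"
    and balls: "\<And>x \<epsilon>. x \<in> X \<Longrightarrow> 0 < \<epsilon> \<Longrightarrow> emeasure \<mu> (ball x \<epsilon>) = h \<epsilon>"
      "\<And>x \<epsilon>. x \<in> X \<Longrightarrow> 0 < \<epsilon> \<Longrightarrow> emeasure \<nu> (ball x \<epsilon>) = h \<epsilon>"
    and h: "\<And>\<epsilon>. 0 < \<epsilon> \<Longrightarrow> 0 < h \<epsilon>" "\<And>\<epsilon>. h \<epsilon> < \<infinity>"
    and U: "open U"
  shows "emeasure \<mu> U \<le> emeasure \<nu> U"
proof -
  interpret M: sigma_finite_measure \<mu> by fact
  interpret N: sigma_finite_measure \<nu> by fact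
  interpret P: pair_sigma_finite \<mu> \<nu> ..
  note [measurable_cong] = \<mu>(2) \<nu>(2)
  have [measurable]: "U \<in> sets borel" using U by simp
  define e where "e n = inverse (real (Suc n))" for n
  have e: "0 < e n" for n by (simp add: e_def)
  have e0: "e \<longlonglongrightarrow> 0" unfolding e_def by (rule LIMSEQ_inverse_real_of_nat)
  define k where "k n x y = (indicator U y * indicator {z. dist x z < e n} y / h (e n) :: ennreal)" for n x y
  have k_meas: "(\<lambda>(x, y). k n x y) \<in> borel_measurable (\<mu> \<Otimes>\<^sub>M \<nu>)" for n
  proof -
    have "(\<lambda>p. indicator U (snd p) * indicator {q. dist (fst q) (snd q) < e n} p / h (e n))
        \<in> borel_measurable (\<mu> \<Otimes>\<^sub>M \<nu>)"
      by measurable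
    also have "(\<lambda>p. indicator U (snd p) * indicator {q. dist (fst q) (snd q) < e n} p / h (e n)) =
        (\<lambda>(x, y). k n x y)"
      by (auto simp: k_def fun_eq_iff split: split_indicator)
    finally show ?thesis .
  qed
  have k_meas2: "(\<lambda>x. \<integral>\<^sup>+y. k n x y \<partial>\<nu>) \<in> borel_measurable \<mu>" for n
    using N.borel_measurable_nn_integral_fst[OF k_meas[of n]] by simp
  have int_y: "(\<integral>\<^sup>+y. k n x y \<partial>\<nu>) = emeasure \<nu> (U \<inter> ball x (e n)) / h (e n)" for n x
  proof -
    have "(\<integral>\<^sup>+y. k n x y \<partial>\<nu>) = (\<integral>\<^sup>+y. indicator (U \<inter> ball x (e n)) y / h (e n) \<partial>\<nu>)"
      by (intro nn_integral_cong) (auto simp: k_def split: split_indicator)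
    also have "\<dots> = emeasure \<nu> (U \<inter> ball x (e n)) / h (e n)"
    proof (subst nn_integral_divide)
      show "indicator (U \<inter> ball x (e n)) \<in> borel_measurable \<nu>"
        by (rule borel_measurable_indicator) (simp add: \<nu>(2))
    qed (simp add: \<nu>(2))
    finally show ?thesis .
  qed
  have int_x: "(\<integral>\<^sup>+x. k n x y \<partial>\<mu>) = indicator U y" if "y \<in> X" for n y
  proof -
    have "(\<integral>\<^sup>+x. k n x y \<partial>\<mu>) = (\<integral>\<^sup>+x. (indicator U y / h (e n)) * indicator (ball y (e n)) x \<partial>\<mu>)"
      by (intro nn_integral_cong) (auto simp: k_def dist_commute split: split_indicator)
    also have "\<dots> = indicator U y / h (e n) * h (e n)"
      by (subst nn_integral_cmult_indicator) (auto simp: \<mu>(2) balls(1)[OF that e])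
    also have "\<dots> = indicator U y"
      using h(1)[OF e, of n] h(2)[of "e n"] by (simp add: ennreal_divide_times ennreal_mult_divide_eq less_top[symmetric])
    finally show ?thesis .
  qed
  have "emeasure \<mu> U = (\<integral>\<^sup>+x. indicator U x \<partial>\<mu>)"
    by (simp add: \<mu>(2))
  also have "\<dots> \<le> (\<integral>\<^sup>+x. liminf (\<lambda>n. \<integral>\<^sup>+y. k n x y \<partial>\<nu>) \<partial>\<mu>)"
  proof (rule nn_integral_mono_AE)
    show "AE x in \<mu>. indicator U x \<le> liminf (\<lambda>n. \<integral>\<^sup>+y. k n x y \<partial>\<nu>)"
      using \<mu>(3)
    proof eventually_elim
      fix x assume x: "x \<in> X"
      show "indicator U x \<le> liminf (\<lambda>n. \<integral>\<^sup>+y. k n x y \<partial>\<nu>)"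
      proof (cases "x \<in> U")
        case True
        then obtain r where r: "0 < r" "ball x r \<subseteq> U" using U open_contains_ball by blast
        have "\<forall>\<^sub>F n in sequentially. e n < r" using e0 r(1) by (rule order_tendstoD)
        then have "\<forall>\<^sub>F n in sequentially. 1 \<le> (\<integral>\<^sup>+y. k n x y \<partial>\<nu>)"
        proof eventually_elim
          fix n assume "e n < r"
          then have "U \<inter> ball x (e n) = ball x (e n)" using r(2) by (auto simp: subset_eq)
          then show "1 \<le> (\<integral>\<^sup>+y. k n x y \<partial>\<nu>)"
            using h(1)[OF e, of n] h(2)[of "e n"] balls(2)[OF x e, of n] unfolding int_y
            by (simp add: ennreal_divide_self)
        qed
        then show ?thesis using True by (simp add: Liminf_bounded)
      qed simp
    qed
  qed
  also have "\<dots> \<le> liminf (\<lambda>n. \<integral>\<^sup>+x. \<integral>\<^sup>+y. k n x y \<partial>\<nu> \<partial>\<mu>)"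
    using k_meas2 by (rule nn_integral_liminf)
  also have "\<dots> = liminf (\<lambda>n. emeasure \<nu> U)"
  proof -
    have "(\<integral>\<^sup>+x. \<integral>\<^sup>+y. k n x y \<partial>\<nu> \<partial>\<mu>) = emeasure \<nu> U" for n
    proof -
      have "(\<integral>\<^sup>+x. \<integral>\<^sup>+y. k n x y \<partial>\<nu> \<partial>\<mu>) = (\<integral>\<^sup>+y. \<integral>\<^sup>+x. k n x y \<partial>\<mu> \<partial>\<nu>)"
        using P.Fubini[OF k_meas[of n]] by simp
      also have "\<dots> = (\<integral>\<^sup>+y. indicator U y \<partial>\<nu>)"
        using \<nu>(3) by (intro nn_integral_cong_AE) (auto elim!: eventually_mono simp: int_x)
      finally show ?thesis by (simp add: \<nu>(2))
    qed
    then show ?thesis by simp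
  qed
  finally show ?thesis by (simp add: Liminf_const)
qed

lemma borel_measure_eqI_equal_balls:
  fixes \<mu> \<nu> :: "'a::euclidean_space measure"
  assumes \<mu>: "sigma_finite_measure \<mu>" "sets \<mu> = sets borel" "AE x in \<mu>. x \<in> X"
    and \<nu>: "sigma_finite_measure \<nu>" "sets \<nu> = sets borel" "AE x in \<nu>. x \<in> X"
    and balls: "\<And>x \<epsilon>. x \<in> X \<Longrightarrow> 0 < \<epsilon> \<Longrightarrow> emeasure \<mu> (ball x \<epsilon>) = h \<epsilon>"
      "\<And>x \<epsilon>. x \<in> X \<Longrightarrow> 0 < \<epsilon> \<Longrightarrow> emeasure \<nu> (ball x \<epsilon>) = h \<epsilon>"
    and h: "\<And>\<epsilon>. 0 < \<epsilon> \<Longrightarrow> 0 < h \<epsilon>" "\<And>\<epsilon>. h \<epsilon> < \<infinity>"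
    and fin: "\<And>r. emeasure \<mu> (ball 0 r) < \<infinity>"
  shows "\<mu> = \<nu>"
proof (rule measure_eqI_generator_eq[where E="{S. open S}" and \<Omega>=UNIV and A="\<lambda>n. ball 0 (real n)"])
  show "emeasure \<mu> X = emeasure \<nu> X" if "X \<in> {S. open S}" for X
    using that emeasure_le_of_equal_balls[OF \<mu> \<nu> balls h] emeasure_le_of_equal_balls[OF \<nu> \<mu> balls(2,1) h]
    by (auto intro: antisym)
  show "Int_stable {S. open S}" by (auto simp: Int_stable_def)
  show "sets \<mu> = sigma_sets UNIV {S. open S}" "sets \<nu> = sigma_sets UNIV {S. open S}"
    using \<mu>(2) \<nu>(2) by (simp_all add: borel_def)
  show "(\<Union>n. ball 0 (real n)) = UNIV"
    by (auto simp: dist_norm intro: reals_Archimedean2)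
  show "emeasure \<mu> (ball 0 (real n)) \<noteq> \<infinity>" for n using fin[of n] by simp
qed auto

text \<open>Computing the product measure of the relation \<open>dist x y < \<epsilon>\<close> in both orders shows that the
  two measures give the same mass to balls of equal radius, which reduces the claim to the
  previous lemma.\<close>

lemma prob_measure_eqI_uniform:
  fixes \<mu> \<nu> :: "'a::euclidean_space measure"
  assumes \<mu>: "prob_space \<mu>" "sets \<mu> = sets borel" "AE x in \<mu>. x \<in> X"
    and \<nu>: "prob_space \<nu>" "sets \<nu> = sets borel" "AE x in \<nu>. x \<in> X"
    and balls: "\<And>x y \<epsilon>. x \<in> X \<Longrightarrow> y \<in> X \<Longrightarrow> emeasure \<mu> (ball x \<epsilon>) = emeasure \<mu> (ball y \<epsilon>)"
      "\<And>x y \<epsilon>. x \<in> X \<Longrightarrow> y \<in> X \<Longrightarrow> emeasure \<nu> (ball x \<epsilon>) = emeasure \<nu> (ball y \<epsilon>)"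
  shows "\<mu> = \<nu>"
proof -
  interpret M: prob_space \<mu> by fact
  interpret N: prob_space \<nu> by fact
  interpret P: pair_sigma_finite \<mu> \<nu> ..
  note [measurable_cong] = \<mu>(2) \<nu>(2)
  have "X \<noteq> {}" using \<mu>(3) by (auto simp: M.AE_False)
  then obtain x0 where x0: "x0 \<in> X" by auto
  define h where "h \<epsilon> = emeasure \<mu> (ball x0 \<epsilon>)" for \<epsilon>
  \<comment> \<open>Countably many balls centred in \<open>X\<close> cover \<open>X\<close>, so their common measure is positive.\<close>
  have pos: "0 < h \<epsilon>" if "0 < \<epsilon>" for \<epsilon>
  proof (rule ccontr)
    assume "\<not> 0 < h \<epsilon>"
    then have null: "emeasure \<mu> (ball x \<epsilon>) = 0" if "x \<in> X" for x
      using balls(1)[OF that x0, of \<epsilon>] by (simp add: h_def)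
    have "\<And>S. S \<in> (\<lambda>x. ball x \<epsilon>) ` X \<Longrightarrow> open S" by auto
    then obtain F where F: "F \<subseteq> (\<lambda>x. ball x \<epsilon>) ` X" "countable F" "\<Union>F = \<Union>((\<lambda>x. ball x \<epsilon>) ` X)"
      using Lindelof by metis
    have "\<Union>F \<in> null_sets \<mu>"
    proof -
      have "(\<Union>S\<in>F. S) \<in> null_sets \<mu>"
        using F null by (intro null_sets_UN') (auto simp: null_sets_def \<mu>(2) dest!: subsetD)
      then show ?thesis by simp
    qed
    then have "AE x in \<mu>. x \<notin> \<Union>F" by (rule AE_not_in)
    then have "AE x in \<mu>. False" using \<mu>(3)
      by eventually_elim (use F(3) that in auto)
    then show False by (simp add: M.AE_False)
  qed
  have hN: "emeasure \<nu> (ball y \<epsilon>) = h \<epsilon>" if y: "y \<in> X" for y \<epsilon>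
  proof -
    have m: "(\<lambda>(x, y). indicator (ball y \<epsilon>) x :: ennreal) \<in> borel_measurable (\<mu> \<Otimes>\<^sub>M \<nu>)"
    proof -
      have "(indicator {q. dist (fst q) (snd q) < \<epsilon>} :: _ \<Rightarrow> ennreal) \<in> borel_measurable (\<mu> \<Otimes>\<^sub>M \<nu>)"
        by measurable
      also have "(indicator {q. dist (fst q) (snd q) < \<epsilon>} :: _ \<Rightarrow> ennreal) = (\<lambda>(x, y). indicator (ball y \<epsilon>) x)"
        by (auto simp: fun_eq_iff dist_commute split: split_indicator)
      finally show ?thesis .
    qed
    have "h \<epsilon> = (\<integral>\<^sup>+y. h \<epsilon> \<partial>\<nu>)" by (simp add: N.emeasure_space_1)
    also have "\<dots> = (\<integral>\<^sup>+y. emeasure \<mu> (ball y \<epsilon>) \<partial>\<nu>)"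
      using \<nu>(3) by (intro nn_integral_cong_AE) (auto elim!: eventually_mono simp: h_def intro: balls(1)[OF x0])
    also have "\<dots> = (\<integral>\<^sup>+y. \<integral>\<^sup>+x. indicator (ball y \<epsilon>) x \<partial>\<mu> \<partial>\<nu>)"
      by (simp add: \<mu>(2))
    also have "\<dots> = (\<integral>\<^sup>+x. \<integral>\<^sup>+y. indicator (ball y \<epsilon>) x \<partial>\<nu> \<partial>\<mu>)"
      using P.Fubini[OF m] by simp
    also have "\<dots> = (\<integral>\<^sup>+x. \<integral>\<^sup>+y. indicator (ball x \<epsilon>) y \<partial>\<nu> \<partial>\<mu>)"
      by (intro nn_integral_cong) (auto simp: dist_commute split: split_indicator)
    also have "\<dots> = (\<integral>\<^sup>+x. emeasure \<nu> (ball x \<epsilon>) \<partial>\<mu>)"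
      by (simp add: \<nu>(2))
    also have "\<dots> = (\<integral>\<^sup>+x. emeasure \<nu> (ball y \<epsilon>) \<partial>\<mu>)"
      using \<mu>(3) by (intro nn_integral_cong_AE) (auto elim!: eventually_mono intro: balls(2)[OF _ y])
    also have "\<dots> = emeasure \<nu> (ball y \<epsilon>)" by (simp add: M.emeasure_space_1)
    finally show ?thesis by simp
  qed
  show ?thesis
  proof (rule borel_measure_eqI_equal_balls[where X=X and h=h])
    show "emeasure \<mu> (ball x \<epsilon>) = h \<epsilon>" if "x \<in> X" for x \<epsilon>
      unfolding h_def using that x0 by (rule balls(1))
    show "h \<epsilon> < \<infinity>" for \<epsilon> by (simp add: h_def M.emeasure_finite less_top[symmetric])
    show "emeasure \<mu> (ball 0 r) < \<infinity>" for r by (simp add: M.emeasure_finite less_top[symmetric])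
  qed (use assms hN pos M.sigma_finite_measure_axioms N.sigma_finite_measure_axioms in auto)
qed

text \<open>Isometries map balls to balls of the same radius, and these have the same Lebesgue measure.\<close>

lemma distr_lborel_orthogonal_transformation:
  fixes f :: "'a::euclidean_space \<Rightarrow> 'a"
  assumes f: "orthogonal_transformation f"
  shows "distr lborel borel f = lborel"
proof -
  have cont: "continuous_on UNIV f"
    using f by (simp add: orthogonal_transformation_def linear_continuous_on linear_conv_bounded_linear)
  then have [measurable]: "f \<in> borel_measurable borel" by (rule borel_measurable_continuous_onI)
  have ball: "emeasure (distr lborel borel f) (ball x r) = emeasure lborel (ball (0::'a) r)" if "0 \<le> r" for x :: 'a and r
  proof -
    have "f -` ball x r = ball (inv f x) r"
    proof -
      have "f ` ball (inv f x) r = ball x r"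
        using f by (simp add: image_orthogonal_transformation_ball orthogonal_transformation_surj surj_f_inv_f)
      then show ?thesis
        using orthogonal_transformation_inj[OF f] by (metis inj_vimage_image_eq)
    qed
    then show ?thesis using that by (simp add: emeasure_distr emeasure_ball)
  qed
  have fin: "emeasure (distr lborel borel f) (ball x r) < \<infinity>" for x :: 'a and r
  proof (cases "0 \<le> r")
    case True then show ?thesis by (simp add: ball emeasure_ball)
  qed (simp add: ball_empty)
  have sf: "sigma_finite_measure (distr lborel borel f)"
  proof
    have "\<Union>(range (\<lambda>n. ball (0::'a) (real n))) = UNIV"
      by (auto simp: dist_norm intro: reals_Archimedean2)
    moreover have "\<forall>a\<in>range (\<lambda>n. ball (0::'a) (real n)). emeasure (distr lborel borel f) a \<noteq> \<infinity>"
      using fin by (auto simp: less_top)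
    ultimately show "\<exists>A. countable A \<and> A \<subseteq> sets (distr lborel borel f) \<and>
        \<Union>A = space (distr lborel borel f) \<and> (\<forall>a\<in>A. emeasure (distr lborel borel f) a \<noteq> \<infinity>)"
      by (intro exI[of _ "range (\<lambda>n. ball (0::'a) (real n))"]) auto
  qed
  show ?thesis
  proof (rule borel_measure_eqI_equal_balls[where X=UNIV and h="\<lambda>r. emeasure lborel (ball (0::'a) \<bar>r\<bar>)"])
    show "0 < emeasure lborel (ball (0::'a) \<bar>r\<bar>)" if "0 < r" for r :: real
      using that by (simp add: emeasure_ball unit_ball_vol_pos)
    show "emeasure lborel (ball (0::'a) \<bar>r\<bar>) < \<infinity>" for r :: real
      by (simp add: emeasure_ball)
    show "emeasure lborel (ball x r) = emeasure lborel (ball (0::'a) \<bar>r\<bar>)" if "0 < r" for x :: 'a and r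
      using that by (simp add: emeasure_ball)
  qed (use sf fin ball sigma_finite_lborel in auto)
qed

section \<open>The standard Gaussian measure\<close>

definition orth_proj :: "'a::euclidean_space set \<Rightarrow> 'a \<Rightarrow> 'a" where
  "orth_proj L x = (THE p. p \<in> L \<and> x - p \<in> L\<^sup>\<bottom>)"

lemma orth_proj_eqI:
  assumes "subspace L" "p \<in> L" "x - p \<in> L\<^sup>\<bottom>"
  shows "orth_proj L x = p"
  unfolding orth_proj_def
proof (rule the_equality)
  fix q assume q: "q \<in> L \<and> x - q \<in> L\<^sup>\<bottom>"
  have "q - p \<in> L" using q assms by (simp add: subspace_diff)
  moreover have "q - p = (x - p) - (x - q)" by simp
  then have "q - p \<in> L\<^sup>\<bottom>" using q assms by (metis subspace_diff subspace_orthogonal_comp)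
  ultimately have "q - p \<in> L \<inter> L\<^sup>\<bottom>" by blast
  then show "q = p" by (simp add: orthogonal_Int_0[OF assms(1)])
qed (use assms in auto)

lemma orth_proj:
  assumes "subspace L"
  shows orth_proj_in: "orth_proj L x \<in> L" and orth_proj_diff: "x - orth_proj L x \<in> L\<^sup>\<bottom>"
proof -
  have "x \<in> L + L\<^sup>\<bottom>" using subspace_sum_orthogonal_comp[OF assms] by simp
  then obtain p q where pq: "x = p + q" "p \<in> L" "q \<in> L\<^sup>\<bottom>" by (elim set_plus_elim)
  then have "orth_proj L x = p" using assms by (intro orth_proj_eqI) auto
  then show "orth_proj L x \<in> L" "x - orth_proj L x \<in> L\<^sup>\<bottom>" using pq by auto
qed

lemma linear_orth_proj:
  assumes "subspace L"
  shows "linear (orth_proj L)"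
proof (rule linearI)
  show "orth_proj L (x + y) = orth_proj L x + orth_proj L y" for x y
  proof (rule orth_proj_eqI[OF assms])
    show "orth_proj L x + orth_proj L y \<in> L" using assms by (simp add: orth_proj_in subspace_add)
    have "x + y - (orth_proj L x + orth_proj L y) = (x - orth_proj L x) + (y - orth_proj L y)" by simp
    also have "\<dots> \<in> L\<^sup>\<bottom>" using assms by (intro subspace_add subspace_orthogonal_comp orth_proj_diff)
    finally show "x + y - (orth_proj L x + orth_proj L y) \<in> L\<^sup>\<bottom>" .
  qed
  show "orth_proj L (c *\<^sub>R x) = c *\<^sub>R orth_proj L x" for c x
  proof (rule orth_proj_eqI[OF assms])
    show "c *\<^sub>R orth_proj L x \<in> L" using assms by (simp add: orth_proj_in subspace_scale)
    have "c *\<^sub>R x - c *\<^sub>R orth_proj L x = c *\<^sub>R (x - orth_proj L x)" by (simp add: scaleR_diff_right)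
    also have "\<dots> \<in> L\<^sup>\<bottom>" using assms by (intro subspace_scale subspace_orthogonal_comp orth_proj_diff)
    finally show "c *\<^sub>R x - c *\<^sub>R orth_proj L x \<in> L\<^sup>\<bottom>" .
  qed
qed

lemma continuous_on_linear:
  fixes f :: "'a::euclidean_space \<Rightarrow> 'b::real_normed_vector"
  shows "linear f \<Longrightarrow> continuous_on S f"
  by (simp add: linear_continuous_on linear_conv_bounded_linear)

lemma borel_measurable_linear:
  fixes f :: "'a::euclidean_space \<Rightarrow> 'b::real_normed_vector"
  shows "linear f \<Longrightarrow> f \<in> borel_measurable borel"
  by (intro borel_measurable_continuous_onI continuous_on_linear)

lemma orth_proj_measurable: "subspace L \<Longrightarrow> orth_proj L \<in> borel_measurable borel"
  by (intro borel_measurable_linear linear_orth_proj)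

lemma orth_proj_orthogonal_comp:
  assumes "subspace L"
  shows "orth_proj (L\<^sup>\<bottom>) x = x - orth_proj L x"
  using assms
  by (intro orth_proj_eqI) (auto simp: subspace_orthogonal_comp orth_proj orthogonal_comp_self)

text \<open>The density is what shows rotation invariance; that \<open>gauss\<close> is the measure
  \<open>gaussian_on UNIV\<close> is the content of \<open>gauss_eq_distr_orthonormal_basis\<close>.\<close>

definition gauss :: "'a::euclidean_space measure" where
  "gauss = density lborel (\<lambda>x. ennreal (\<Prod>b\<in>Basis. std_normal_density (x \<bullet> b)))"

lemma sets_gauss [simp, measurable_cong]: "sets gauss = sets borel"
  and space_gauss [simp]: "space gauss = UNIV"
  by (simp_all add: gauss_def)

lemma product_std_normal: "product_sigma_finite (\<lambda>_. std_normal_distribution)"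
proof -
  interpret prob_space std_normal_distribution by (rule prob_space_normal_density) simp
  show ?thesis by standard
qed

lemma prob_space_std_normal: "prob_space std_normal_distribution"
  by (rule prob_space_normal_density) simp

lemma PiM_std_normal_density:
  assumes "finite B"
  shows "(\<Pi>\<^sub>M b\<in>B. std_normal_distribution) =
    density (\<Pi>\<^sub>M b\<in>B. lborel) (\<lambda>g. ennreal (\<Prod>b\<in>B. std_normal_density (g b)))" (is "_ = ?D")
proof -
  interpret N: product_sigma_finite "\<lambda>_. std_normal_distribution" by (rule product_std_normal)
  interpret L: product_sigma_finite "\<lambda>_. lborel :: real measure" by standard
  have "?D = (\<Pi>\<^sub>M b\<in>B. std_normal_distribution)"
  proof (rule N.PiM_eqI[OF assms])
    show "sets ?D = sets (\<Pi>\<^sub>M b\<in>B. std_normal_distribution)"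
      by (simp cong: sets_PiM_cong)
    fix A :: "'a \<Rightarrow> real set"
    assume "\<And>i. i \<in> B \<Longrightarrow> A i \<in> sets std_normal_distribution"
    then have A[measurable]: "\<And>i. i \<in> B \<Longrightarrow> A i \<in> sets borel" by simp
    have "emeasure ?D (Pi\<^sub>E B A) =
        (\<integral>\<^sup>+g. ennreal (\<Prod>b\<in>B. std_normal_density (g b)) * indicator (Pi\<^sub>E B A) g \<partial>(\<Pi>\<^sub>M b\<in>B. lborel))"
      using A assms by (intro emeasure_density) (auto intro!: sets_PiM_I_finite)
    also have "\<dots> = (\<integral>\<^sup>+g. (\<Prod>b\<in>B. ennreal (std_normal_density (g b)) * indicator (A b) (g b)) \<partial>(\<Pi>\<^sub>M b\<in>B. lborel))"
    proof (intro nn_integral_cong)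
      fix g :: "'a \<Rightarrow> real" assume "g \<in> space (\<Pi>\<^sub>M b\<in>B. lborel)"
      then have g: "g \<in> extensional B" by (auto simp: space_PiM PiE_def)
      have "indicator (Pi\<^sub>E B A) g = (\<Prod>b\<in>B. indicator (A b) (g b) :: ennreal)"
        using assms g by (auto simp: indicator_def PiE_def Pi_def prod_zero_iff)
      then show "ennreal (\<Prod>b\<in>B. std_normal_density (g b)) * indicator (Pi\<^sub>E B A) g =
          (\<Prod>b\<in>B. ennreal (std_normal_density (g b)) * indicator (A b) (g b))"
        by (simp add: prod.distrib prod_ennreal)
    qed
    also have "\<dots> = (\<Prod>b\<in>B. \<integral>\<^sup>+x. ennreal (std_normal_density x) * indicator (A b) x \<partial>lborel)"
      using assms by (subst L.product_nn_integral_prod) auto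
    also have "\<dots> = (\<Prod>b\<in>B. emeasure std_normal_distribution (A b))"
      by (intro prod.cong refl) (simp add: emeasure_density)
    finally show "emeasure ?D (Pi\<^sub>E B A) = (\<Prod>b\<in>B. emeasure std_normal_distribution (A b))" .
  qed
  then show ?thesis by simp
qed

lemma gauss_eq_distr_Basis:
  "(gauss :: 'a::euclidean_space measure) =
    distr (\<Pi>\<^sub>M b\<in>Basis. std_normal_distribution) borel (\<lambda>g. \<Sum>b\<in>Basis. g b *\<^sub>R b)"
proof -
  have m: "(\<lambda>g. \<Sum>b\<in>Basis. g b *\<^sub>R b :: 'a) \<in> borel_measurable (\<Pi>\<^sub>M b\<in>Basis. (lborel::real measure))"
    by measurable
  have "(gauss :: 'a measure) = density (distr (\<Pi>\<^sub>M b\<in>Basis. lborel) borel (\<lambda>g. \<Sum>b\<in>Basis. g b *\<^sub>R b))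
      (\<lambda>x. ennreal (\<Prod>b\<in>Basis. std_normal_density (x \<bullet> b)))"
    unfolding gauss_def by (subst lborel_eq) simp
  also have "\<dots> = distr (density (\<Pi>\<^sub>M b\<in>Basis. lborel)
      (\<lambda>g. ennreal (\<Prod>b\<in>Basis. std_normal_density ((\<Sum>c\<in>Basis. g c *\<^sub>R c :: 'a) \<bullet> b)))) borel (\<lambda>g. \<Sum>b\<in>Basis. g b *\<^sub>R b)"
    by (subst density_distr) (use m in auto)
  also have "(\<lambda>g. ennreal (\<Prod>b\<in>Basis. std_normal_density ((\<Sum>c\<in>Basis. g c *\<^sub>R c :: 'a) \<bullet> b))) =
      (\<lambda>g. ennreal (\<Prod>b\<in>Basis. std_normal_density (g (b::'a))))"
    by (simp cong: prod.cong)
  finally show ?thesis by (simp add: PiM_std_normal_density)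
qed

lemma prob_space_gauss: "prob_space (gauss :: 'a::euclidean_space measure)"
proof -
  interpret prob_space "\<Pi>\<^sub>M b\<in>(Basis::'a set). std_normal_distribution"
    by (intro prob_space_PiM prob_space_std_normal)
  show ?thesis unfolding gauss_eq_distr_Basis by (intro prob_space_distr) measurable
qed

text \<open>Both the density, a function of the norm, and Lebesgue measure are invariant.\<close>

lemma distr_gauss_orthogonal_transformation:
  fixes f :: "'a::euclidean_space \<Rightarrow> 'a"
  assumes f: "orthogonal_transformation f"
  shows "distr gauss borel f = gauss"
proof -
  define g :: "'a \<Rightarrow> ennreal" where "g x = ennreal (\<Prod>b\<in>Basis. std_normal_density (x \<bullet> b))" for x
  have g: "g x = ennreal ((1 / sqrt (2 * pi)) ^ DIM('a) * exp (- (norm x)\<^sup>2 / 2))" for x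
  proof -
    have "(\<Prod>b\<in>Basis. std_normal_density (x \<bullet> b)) = (1 / sqrt (2 * pi)) ^ DIM('a) * exp (\<Sum>b\<in>Basis. - (x \<bullet> b)\<^sup>2 / 2)"
      by (simp add: std_normal_density_def prod.distrib exp_sum prod_dividef power_divide)
    also have "(\<Sum>b\<in>Basis. - (x \<bullet> b)\<^sup>2 / 2) = - (norm x)\<^sup>2 / 2"
      by (simp add: norm_eq_sqrt_inner euclidean_inner[of x x] power2_eq_square sum_negf sum_divide_distrib sum_nonneg)
    finally show ?thesis by (simp add: g_def)
  qed
  have [measurable]: "f \<in> borel_measurable borel"
    using f by (intro borel_measurable_linear) (simp add: orthogonal_transformation_def)
  have [measurable]: "g \<in> borel_measurable borel" unfolding g_def by measurable
  have gf: "g (f x) = g x" for x by (simp add: g orthogonal_transformation_norm[OF f])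
  have gg: "gauss = density lborel g" unfolding gauss_def g_def ..
  have "distr gauss borel f = distr (density lborel (\<lambda>x. g (f x))) borel f"
    by (simp add: gg gf)
  also have "\<dots> = density (distr lborel borel f) g"
    by (subst density_distr) auto
  also have "\<dots> = gauss"
    by (simp add: distr_lborel_orthogonal_transformation[OF f] gg)
  finally show ?thesis .
qed

lemma orthonormal_basis_inner:
  assumes "orthonormal_basis B L" "b \<in> B" "c \<in> B"
  shows "b \<bullet> c = (if b = c then 1 else 0)"
  using assms by (auto simp: orthonormal_basis_def pairwise_def orthogonal_def norm_eq_1)

lemma orthonormal_basis_independent:
  assumes "orthonormal_basis B L"
  shows "independent B" "finite B"
proof -
  have "0 \<notin> B" using assms by (auto simp: orthonormal_basis_def)
  then show "independent B"
    using assms by (simp add: orthonormal_basis_def pairwise_orthogonal_independent)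
  then show "finite B" by (rule independent_imp_finite)
qed

text \<open>An isometry carries the standard basis to \<open>B\<close>, and the Gaussian measure is invariant under
  it.\<close>

lemma gauss_eq_distr_orthonormal_basis:
  fixes B :: "'a::euclidean_space set"
  assumes B: "orthonormal_basis B UNIV"
  shows "distr (\<Pi>\<^sub>M b\<in>B. std_normal_distribution) borel (\<lambda>g. \<Sum>b\<in>B. g b *\<^sub>R b) = gauss"
proof -
  note ind = orthonormal_basis_independent[OF B]
  have "card B = DIM('a)"
    using ind(1) B by (metis dim_UNIV dim_eq_card_independent dim_span orthonormal_basis_def)
  then obtain p where p: "bij_betw p (Basis :: 'a set) B"
    using ind(2) by (metis finite_Basis finite_same_card_bij)
  have pB: "p b \<in> B" if "b \<in> Basis" for b using p that by (auto simp: bij_betw_def)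
  have inj: "inj_on p Basis" using p by (auto simp: bij_betw_def)
  define f where "f x = (\<Sum>b\<in>Basis. (x \<bullet> b) *\<^sub>R p b)" for x :: 'a
  have lin: "linear f" unfolding f_def
    by (rule linearI) (simp_all add: inner_add_left scaleR_add_left sum.distrib scaleR_sum_right)
  have f: "orthogonal_transformation f"
    unfolding orthogonal_transformation_def
  proof (intro conjI allI lin)
    fix v w :: 'a
    have "f v \<bullet> f w = (\<Sum>b\<in>Basis. \<Sum>c\<in>Basis. (v \<bullet> b) * (w \<bullet> c) * (p b \<bullet> p c))"
      by (simp add: f_def inner_sum_left inner_sum_right sum_distrib_left mult_ac)
        (rule sum.swap)
    also have "\<dots> = (\<Sum>b\<in>Basis. \<Sum>c\<in>Basis. if b = c then (v \<bullet> b) * (w \<bullet> c) else 0)"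
      using pB inj by (intro sum.cong refl) (auto simp: orthonormal_basis_inner[OF B] inj_on_eq_iff)
    also have "\<dots> = v \<bullet> w" by (simp add: euclidean_inner[of v w])
    finally show "f v \<bullet> f w = v \<bullet> w" .
  qed
  have [measurable]: "f \<in> borel_measurable borel" using lin by (rule borel_measurable_linear)
  have re: "distr (\<Pi>\<^sub>M b\<in>B. std_normal_distribution) (\<Pi>\<^sub>M b\<in>Basis. std_normal_distribution)
      (\<lambda>\<omega>. \<lambda>n\<in>Basis. \<omega> (p n)) = (\<Pi>\<^sub>M b\<in>Basis. std_normal_distribution)"
    using distr_PiM_reindex[of B "\<lambda>_. std_normal_distribution" p "Basis :: 'a set"]
    using inj pB prob_space_std_normal by auto
  have m1: "(\<lambda>\<omega>. \<lambda>n\<in>Basis. \<omega> (p n)) \<in> (\<Pi>\<^sub>M b\<in>B. std_normal_distribution) \<rightarrow>\<^sub>M (\<Pi>\<^sub>M b\<in>(Basis::'a set). std_normal_distribution)"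
    using pB by (intro measurable_restrict measurable_component_singleton) auto
  have m2: "(\<lambda>g. \<Sum>b\<in>Basis. g b *\<^sub>R b) \<in> (\<Pi>\<^sub>M b\<in>(Basis::'a set). std_normal_distribution) \<rightarrow>\<^sub>M borel"
    by measurable
  have "gauss = distr gauss borel f" using distr_gauss_orthogonal_transformation[OF f] by simp
  also have "\<dots> = distr (distr (\<Pi>\<^sub>M b\<in>Basis. std_normal_distribution) borel (\<lambda>g. \<Sum>b\<in>Basis. g b *\<^sub>R b)) borel f"
    by (simp add: gauss_eq_distr_Basis)
  also have "\<dots> = distr (\<Pi>\<^sub>M b\<in>Basis. std_normal_distribution) borel (f \<circ> (\<lambda>g. \<Sum>b\<in>Basis. g b *\<^sub>R b))"
    using m2 by (intro distr_distr) auto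
  also have "\<dots> = distr (\<Pi>\<^sub>M b\<in>B. std_normal_distribution) borel
      ((f \<circ> (\<lambda>g. \<Sum>b\<in>Basis. g b *\<^sub>R b)) \<circ> (\<lambda>\<omega>. \<lambda>n\<in>Basis. \<omega> (p n)))"
    by (subst re[symmetric], rule distr_distr) (use m1 m2 in auto)
  also have "(f \<circ> (\<lambda>g. \<Sum>b\<in>Basis. g b *\<^sub>R b)) \<circ> (\<lambda>\<omega>. \<lambda>n\<in>Basis. \<omega> (p n)) = (\<lambda>g. \<Sum>b\<in>B. g b *\<^sub>R b)"
  proof
    fix g
    have "f (\<Sum>b\<in>Basis. g (p b) *\<^sub>R b) = (\<Sum>b\<in>Basis. g (p b) *\<^sub>R p b)"
      unfolding f_def by (intro sum.cong refl) simp
    also have "\<dots> = (\<Sum>b\<in>B. g b *\<^sub>R b)"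
      by (rule sum.reindex_bij_betw[OF p])
    finally show "((f \<circ> (\<lambda>g. \<Sum>b\<in>Basis. g b *\<^sub>R b)) \<circ> (\<lambda>\<omega>. \<lambda>n\<in>Basis. \<omega> (p n))) g = (\<Sum>b\<in>B. g b *\<^sub>R b)"
      by (simp cong: sum.cong)
  qed
  finally show ?thesis ..
qed

text \<open>If \<open>L\<close> is the span of a face \<open>F\<close> of a polyhedral cone \<open>C\<close>, then \<open>biconic L C (polar C)\<close> is
  the sum of \<open>F\<close> and of its normal cone, that is, the closure of the set of points whose
  projection to \<open>C\<close> lies in the relative interior of \<open>F\<close>.\<close>

definition biconic :: "'a::euclidean_space set \<Rightarrow> 'a set \<Rightarrow> 'a set \<Rightarrow> 'a set" where
  "biconic L X Y = {z. orth_proj L z \<in> X \<and> z - orth_proj L z \<in> Y}"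

text \<open>Orthonormal bases of \<open>L\<close> and of its complement together form an orthonormal basis of the
  space, so the two components of a standard Gaussian vector are independent.\<close>

lemma gaussian_on_mult:
  fixes L :: "'a::euclidean_space set"
  assumes L: "subspace L" and X: "X \<in> sets borel" and Y: "Y \<in> sets borel"
  shows "measure (gaussian_on L) (X \<inter> L) * measure (gaussian_on (L\<^sup>\<bottom>)) (Y \<inter> L\<^sup>\<bottom>) =
    measure gauss (biconic L X Y)"
proof -
  note Lp = subspace_orthogonal_comp[of L]
  define B where "B = (SOME B. orthonormal_basis B L)"
  define B' where "B' = (SOME B. orthonormal_basis B (L\<^sup>\<bottom>))"
  have B: "orthonormal_basis B L" unfolding B_def by (rule someI_ex) (rule ex_orthonormal_basis[OF L])
  have B': "orthonormal_basis B' (L\<^sup>\<bottom>)" unfolding B'_def by (rule someI_ex) (rule ex_orthonormal_basis[OF Lp])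
  note fin = orthonormal_basis_independent(2)[OF B] orthonormal_basis_independent(2)[OF B']
  have BL: "b \<in> L" if "b \<in> B" for b using B that by (auto simp: orthonormal_basis_def span_base)
  have BL': "b \<in> L\<^sup>\<bottom>" if "b \<in> B'" for b using B' that by (auto simp: orthonormal_basis_def span_base)
  have disj: "B \<inter> B' = {}"
  proof -
    have "b = 0" if "b \<in> B" "b \<in> B'" for b
    proof -
      have "b \<in> L \<inter> L\<^sup>\<bottom>" using BL[OF that(1)] BL'[OF that(2)] by blast
      then show ?thesis by (simp add: orthogonal_Int_0[OF L])
    qed
    moreover have "0 \<notin> B" using B by (auto simp: orthonormal_basis_def)
    ultimately show ?thesis by blast
  qed
  have BB: "orthonormal_basis (B \<union> B') UNIV"
    unfolding orthonormal_basis_def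
  proof (intro conjI)
    have "orthogonal b c \<and> orthogonal c b" if "b \<in> B" "c \<in> B'" for b c
      using BL[OF that(1)] BL'[OF that(2)] by (auto simp: mem_orthogonal_comp orthogonal_def inner_commute)
    then show "pairwise orthogonal (B \<union> B')"
      using B B' unfolding orthonormal_basis_def pairwise_def by blast
    show "\<forall>b\<in>B \<union> B'. norm b = 1" using B B' by (auto simp: orthonormal_basis_def)
    have "x \<in> span (B \<union> B')" for x
    proof -
      have "orth_proj L x \<in> span (B \<union> B')"
        using orth_proj_in[OF L, of x] B span_mono[of B "B \<union> B'"] by (auto simp: orthonormal_basis_def)
      moreover have "x - orth_proj L x \<in> span (B \<union> B')"
        using orth_proj_diff[OF L, of x] B' span_mono[of B' "B \<union> B'"] by (auto simp: orthonormal_basis_def)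
      ultimately have "orth_proj L x + (x - orth_proj L x) \<in> span (B \<union> B')" by (rule span_add)
      then show ?thesis by simp
    qed
    then show "span (B \<union> B') = UNIV" by auto
  qed
  let ?N = "\<lambda>_. std_normal_distribution"
  interpret N: product_sigma_finite ?N by (rule product_std_normal)
  interpret P: prob_space "Pi\<^sub>M B ?N" by (intro prob_space_PiM prob_space_std_normal)
  interpret P': prob_space "Pi\<^sub>M B' ?N" by (intro prob_space_PiM prob_space_std_normal)
  let ?s = "\<lambda>B g. (\<Sum>b\<in>B. g b *\<^sub>R b) :: 'a"
  have s_meas[measurable]: "?s B \<in> Pi\<^sub>M B ?N \<rightarrow>\<^sub>M borel" for B :: "'a set" by measurable
  have sL: "?s B g \<in> L" for g using BL by (intro subspace_sum[OF L]) (auto intro: subspace_scale[OF L])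
  have sL': "?s B' g \<in> L\<^sup>\<bottom>" for g using BL' by (intro subspace_sum[OF Lp]) (auto intro: subspace_scale[OF Lp])
  have sp: "space (Pi\<^sub>M B ?N) = extensional B" for B :: "'a set" by (auto simp: space_PiM PiE_def)
  have Lc: "L \<in> sets borel" "L\<^sup>\<bottom> \<in> sets borel" using closed_subspace[OF L] closed_subspace[OF Lp] by auto
  define E where "E = ?s B -` X \<inter> space (Pi\<^sub>M B ?N)"
  define E' where "E' = ?s B' -` Y \<inter> space (Pi\<^sub>M B' ?N)"
  have E: "E \<in> sets (Pi\<^sub>M B ?N)" "E' \<in> sets (Pi\<^sub>M B' ?N)"
    unfolding E_def E'_def using X Y s_meas by (auto intro: measurable_sets)
  have "measure (gaussian_on L) (X \<inter> L) = measure (Pi\<^sub>M B ?N) E"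
    unfolding gaussian_on_def Let_def B_def[symmetric] E_def
    using X Lc sL by (subst measure_distr) (auto intro: arg_cong[where f="measure (Pi\<^sub>M B ?N)"])
  moreover have "measure (gaussian_on (L\<^sup>\<bottom>)) (Y \<inter> L\<^sup>\<bottom>) = measure (Pi\<^sub>M B' ?N) E'"
    unfolding gaussian_on_def Let_def B'_def[symmetric] E'_def
    using Y Lc sL' by (subst measure_distr) (auto intro: arg_cong[where f="measure (Pi\<^sub>M B' ?N)"])
  moreover have "measure gauss (biconic L X Y) = measure (Pi\<^sub>M B ?N) E * measure (Pi\<^sub>M B' ?N) E'"
  proof -
    have bi: "biconic L X Y \<in> sets borel"
    proof -
      have [measurable]: "orth_proj L \<in> borel_measurable borel" by (rule orth_proj_measurable[OF L])
      note [measurable] = X Y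
      have "Measurable.pred borel (\<lambda>z. orth_proj L z \<in> X \<and> z - orth_proj L z \<in> Y)" by measurable
      then show ?thesis unfolding biconic_def by (simp add: pred_def)
    qed
    have mm: "merge B B' \<in> Pi\<^sub>M B ?N \<Otimes>\<^sub>M Pi\<^sub>M B' ?N \<rightarrow>\<^sub>M Pi\<^sub>M (B \<union> B') ?N" by (rule measurable_merge)
    have "gauss = distr (distr (Pi\<^sub>M B ?N \<Otimes>\<^sub>M Pi\<^sub>M B' ?N) (Pi\<^sub>M (B \<union> B') ?N) (merge B B')) borel (?s (B \<union> B'))"
      unfolding N.distr_merge[OF disj fin] by (rule gauss_eq_distr_orthonormal_basis[OF BB, symmetric])
    also have "\<dots> = distr (Pi\<^sub>M B ?N \<Otimes>\<^sub>M Pi\<^sub>M B' ?N) borel (?s (B \<union> B') \<circ> merge B B')"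
      by (rule distr_distr) (use mm in auto)
    finally have ge: "gauss = distr (Pi\<^sub>M B ?N \<Otimes>\<^sub>M Pi\<^sub>M B' ?N) borel (?s (B \<union> B') \<circ> merge B B')" .
    have mc: "?s (B \<union> B') \<circ> merge B B' \<in> Pi\<^sub>M B ?N \<Otimes>\<^sub>M Pi\<^sub>M B' ?N \<rightarrow>\<^sub>M borel"
      by (rule measurable_comp[OF mm]) (rule s_meas)
    have "emeasure gauss (biconic L X Y) = emeasure (Pi\<^sub>M B ?N \<Otimes>\<^sub>M Pi\<^sub>M B' ?N)
        ((?s (B \<union> B') \<circ> merge B B') -` biconic L X Y \<inter> space (Pi\<^sub>M B ?N \<Otimes>\<^sub>M Pi\<^sub>M B' ?N))"
      by (subst ge) (rule emeasure_distr[OF mc bi])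
    also have "(?s (B \<union> B') \<circ> merge B B') -` biconic L X Y \<inter> space (Pi\<^sub>M B ?N \<Otimes>\<^sub>M Pi\<^sub>M B' ?N) = E \<times> E'"
    proof -
      have "?s (B \<union> B') (merge B B' (g, g')) = ?s B g + ?s B' g'" for g g'
      proof -
        have "?s (B \<union> B') (merge B B' (g, g')) = ?s B (merge B B' (g, g')) + ?s B' (merge B B' (g, g'))"
          using fin disj by (rule sum.union_disjoint)
        also have "\<dots> = ?s B g + ?s B' g'"
          using disj by (intro arg_cong2[where f="(+)"] sum.cong) (auto simp: merge_def)
        finally show ?thesis .
      qed
      moreover have "orth_proj L (?s B g + ?s B' g') = ?s B g" for g g'
        using sL sL' by (intro orth_proj_eqI[OF L]) auto
      ultimately show ?thesis
        by (auto simp: biconic_def E_def E'_def space_pair_measure)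
    qed
    also have "emeasure (Pi\<^sub>M B ?N \<Otimes>\<^sub>M Pi\<^sub>M B' ?N) (E \<times> E') = emeasure (Pi\<^sub>M B ?N) E * emeasure (Pi\<^sub>M B' ?N) E'"
      using E by (rule P'.emeasure_pair_measure_Times)
    finally show ?thesis by (simp add: measure_def enn2real_mult)
  qed
  ultimately show ?thesis by simp
qed

lemma gauss_proper_subspace_null:
  fixes W :: "'a::euclidean_space set"
  assumes "subspace W" "W \<noteq> UNIV"
  shows "W \<in> null_sets gauss"
proof -
  have "dim W < DIM('a)" using assms by (metis dim_eq_full dim_subset_UNIV le_neq_implies_less span_eq_iff)
  then have "negligible W" by (rule negligible_lowdim)
  moreover have "W \<in> sets borel" using closed_subspace[OF assms(1)] by simp
  ultimately have "W \<in> null_sets lborel"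
    by (simp add: negligible_iff_null_sets null_sets_completion_iff)
  then have "AE x in lborel. x \<notin> W" by (rule AE_not_in)
  then have "AE x in gauss. x \<notin> W" unfolding gauss_def by (subst AE_density) (auto elim: eventually_mono)
  then show ?thesis using \<open>W \<in> sets borel\<close> by (simp add: AE_iff_null_sets)
qed

lemma gauss_pair_proper_subspace_null:
  fixes W :: "('a::euclidean_space \<times> 'b::euclidean_space) set"
  assumes "subspace W" "W \<noteq> UNIV"
  shows "AE p in gauss \<Otimes>\<^sub>M gauss. p \<notin> W"
proof -
  interpret G: prob_space "gauss :: 'b measure" by (rule prob_space_gauss)
  have "dim W < DIM('a \<times> 'b)" using assms by (metis dim_eq_full dim_subset_UNIV le_neq_implies_less span_eq_iff)
  then have "negligible W" by (rule negligible_lowdim)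
  moreover have "W \<in> sets borel" using closed_subspace[OF assms(1)] by simp
  ultimately have "W \<in> null_sets lborel"
    by (simp add: negligible_iff_null_sets null_sets_completion_iff)
  then have ae: "AE x in lborel \<Otimes>\<^sub>M lborel. x \<notin> W" unfolding lborel_prod by (rule AE_not_in)
  define f :: "'a \<Rightarrow> ennreal" where "f x = ennreal (\<Prod>b\<in>Basis. std_normal_density (x \<bullet> b))" for x
  define g :: "'b \<Rightarrow> ennreal" where "g x = ennreal (\<Prod>b\<in>Basis. std_normal_density (x \<bullet> b))" for x
  have fg: "(gauss :: 'a measure) = density lborel f" "(gauss :: 'b measure) = density lborel g"
    unfolding gauss_def f_def g_def by (rule refl)+
  have [measurable]: "f \<in> borel_measurable borel" "g \<in> borel_measurable borel"
    unfolding f_def g_def by measurable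
  have eq: "(gauss :: 'a measure) \<Otimes>\<^sub>M (gauss :: 'b measure) = density (lborel \<Otimes>\<^sub>M lborel) (\<lambda>(x, y). f x * g y)"
    unfolding fg by (rule pair_measure_density)
      (use G.sigma_finite_measure_axioms fg(2) sigma_finite_lborel in auto)
  show ?thesis
    unfolding eq by (subst AE_density) (use ae in \<open>auto elim: eventually_mono\<close>)
qed

section \<open>Block orthogonal matrices\<close>

text \<open>The reflection in the hyperplane orthogonal to \<open>a - b\<close>. It moves vectors only in the
  direction \<open>a - b \<in> U\<close>.\<close>

lemma householder:
  fixes U :: "(real^'d) set"
  assumes U: "subspace U" and a: "a \<in> U" and b: "b \<in> U" and ab: "norm a = norm b"
  obtains R :: "real^'d^'d" where "orthogonal_matrix R" "R *v a = b"
    "\<And>x. x \<in> U\<^sup>\<bottom> \<Longrightarrow> R *v x = x" "\<And>x. x \<in> U \<Longrightarrow> R *v x \<in> U"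
proof -
  define h where "h = a - b"
  define f where "f x = x - (2 * (h \<bullet> x) / (h \<bullet> h)) *\<^sub>R h" for x
  have hU: "h \<in> U" using U a b by (simp add: h_def subspace_diff)
  have lin: "linear f"
    unfolding f_def
    by (rule linearI) (simp_all add: inner_add_right algebra_simps add_divide_distrib)
  have "orthogonal_transformation f"
    unfolding orthogonal_transformation_def
  proof (intro conjI allI lin)
    fix v w
    show "f v \<bullet> f w = v \<bullet> w"
    proof (cases "h = 0")
      case False
      then have "h \<bullet> h \<noteq> 0" by simp
      then show ?thesis
        by (simp add: f_def inner_diff_left inner_diff_right inner_commute[of v h] inner_commute[of w h])
    qed (simp add: f_def)
  qed
  then have orth: "orthogonal_matrix (matrix f)"
    by (simp add: orthogonal_transformation_matrix)
  have mv: "matrix f *v x = f x" for x using fun_cong[OF matrix_vector_mul(2)[OF lin], of x] by simp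
  show thesis
  proof
    show "orthogonal_matrix (matrix f)" by fact
    show "matrix f *v a = b"
    proof (cases "h = 0")
      case False
      have "a \<bullet> a = b \<bullet> b" using ab by (simp add: norm_eq)
      then have "2 * (h \<bullet> a) = h \<bullet> h"
        by (simp add: h_def inner_diff_left inner_diff_right inner_commute)
      then have "f a = a - h" using False by (simp add: f_def)
      then show ?thesis by (simp add: mv h_def)
    qed (simp add: mv f_def h_def)
    show "matrix f *v x = x" if "x \<in> U\<^sup>\<bottom>" for x
      using that hU by (simp add: mv f_def mem_orthogonal_comp)
    show "matrix f *v x \<in> U" if "x \<in> U" for x
      using that hU U by (simp add: mv f_def subspace_diff subspace_scale)
  qed
qed

definition block_apply :: "real^'d^'d^'m \<Rightarrow> real^'d^'m \<Rightarrow> real^'d^'m" where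
  "block_apply q x = (\<chi> i. q $ i *v x $ i)"

definition block_mult :: "real^'d^'d^'m \<Rightarrow> real^'d^'d^'m \<Rightarrow> real^'d^'d^'m" where
  "block_mult q r = (\<chi> i. q $ i ** r $ i)"

definition block_orthogonal :: "real^'d^'d^'m \<Rightarrow> bool" where
  "block_orthogonal q \<longleftrightarrow> (\<forall>i. orthogonal_matrix (q $ i))"

definition block_sum :: "('m::finite \<Rightarrow> real^'d^'d) \<Rightarrow> real^'d^'m \<Rightarrow> real^'d" where
  "block_sum T x = (\<Sum>i\<in>UNIV. T i *v x $ i)"

abbreviation block_map :: "('m::finite \<Rightarrow> real^'d^'d) \<Rightarrow> real^'d^'d^'m \<Rightarrow> real^'d^'m \<Rightarrow> real^'d" where
  "block_map T q \<equiv> \<lambda>x. block_sum T (block_apply q x)"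

lemma block_apply_nth [simp]: "block_apply q x $ i = q $ i *v x $ i"
  by (simp add: block_apply_def)

lemma block_apply_mult: "block_apply (block_mult q r) x = block_apply q (block_apply r x)"
  by (simp add: block_apply_def block_mult_def vec_eq_iff matrix_vector_mul_assoc)

lemma linear_block_apply: "linear (block_apply q)"
  by (rule linearI)
    (simp_all add: vec_eq_iff matrix_vector_right_distrib matrix_vector_mult_scaleR)

lemma linear_block_sum: "linear (block_sum T)"
  by (rule linearI)
    (simp_all add: block_sum_def matrix_vector_right_distrib matrix_vector_mult_scaleR
      sum.distrib scaleR_sum_right)

lemma block_orthogonal_transformation:
  assumes "block_orthogonal q"
  shows "orthogonal_transformation (block_apply q)"
proof -
  have "orthogonal_transformation ((*v) (q $ i))" for i
    using assms by (simp add: block_orthogonal_def orthogonal_transformation_matrix)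
  then have "(q $ i *v a) \<bullet> (q $ i *v b) = a \<bullet> b" for i a b
    by (simp add: orthogonal_transformation_def)
  then show ?thesis
    by (simp add: orthogonal_transformation_def linear_block_apply inner_vec_def)
qed

lemma block_apply_surj: "block_orthogonal q \<Longrightarrow> \<exists>x. block_apply q x = y"
  using orthogonal_transformation_surj[OF block_orthogonal_transformation] by (metis surjD)

lemma block_apply_inner: "block_orthogonal q \<Longrightarrow> block_apply q x \<bullet> block_apply q y = x \<bullet> y"
  using block_orthogonal_transformation by (auto simp: orthogonal_transformation_def)

lemma continuous_block_apply:
  "continuous_on S (\<lambda>x. f x) \<Longrightarrow> continuous_on S (\<lambda>x. g x) \<Longrightarrow> continuous_on S (\<lambda>x. block_apply (f x) (g x))"
  unfolding block_apply_def matrix_vector_mult_def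
  by (intro continuous_intros) auto

lemma continuous_block_mult:
  "continuous_on S (\<lambda>x. f x) \<Longrightarrow> continuous_on S (\<lambda>x. g x) \<Longrightarrow> continuous_on S (\<lambda>x. block_mult (f x) (g x))"
  unfolding block_mult_def matrix_matrix_mult_def
  by (intro continuous_intros) auto

lemma continuous_block_sum:
  "continuous_on S f \<Longrightarrow> continuous_on S (\<lambda>x. block_sum T (f x))"
  unfolding block_sum_def matrix_vector_mult_def
  by (intro continuous_intros) auto

lemma subspace_cone_product:
  assumes "\<And>i. subspace (V i)"
  shows "subspace (cone_product V)"
  using assms by (simp add: cone_product_def subspace_def)

text \<open>Cut down to a ball in the first factor, the set has a closed projection, because the factor
  has become compact.\<close>

lemma borel_projection_closed:
  fixes G :: "('a::euclidean_space \<times> 'b::euclidean_space) set"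
  assumes "closed G"
  shows "{y. \<exists>x. (x, y) \<in> G} \<in> sets borel"
proof -
  have "{y. \<exists>x. (x, y) \<in> G} = (\<Union>n. {y. \<exists>x. x \<in> cball 0 (real n) \<and> (x, y) \<in> G})"
    (is "?P = ?Q")
  proof (intro set_eqI iffI)
    fix y assume "y \<in> ?P"
    then obtain x where "(x, y) \<in> G" by blast
    moreover obtain n where "norm x \<le> real n" using real_arch_simple by blast
    ultimately show "y \<in> ?Q" by (auto simp: mem_cball_0)
  qed auto
  moreover have "closed {y. \<exists>x. x \<in> cball 0 (real n) \<and> (x, y) \<in> G}" for n
    by (rule closed_compact_projection) (use assms in auto)
  ultimately show ?thesis by auto
qed

section \<open>The linear system attached to a subspace\<close>

text \<open>Write \<open>x = orth_proj L z\<close> and \<open>n = z - x\<close>. Together with \<open>x \<in> C\<close> and \<open>n \<in> polar C\<close>, these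
  equations are sufficient for \<open>x\<close> to be the point of the fibre of \<open>block_map T q\<close> over \<open>y\<close>
  in \<open>C\<close> for which \<open>block_apply q x\<close> is closest to \<open>w\<close>. The system is linear in \<open>(y, w, z)\<close>;
  if \<open>block_sum T\<close> is onto, there are as many equations as unknowns, since only the
  component of \<open>w\<close> in the kernel of \<open>block_sum T\<close> matters.\<close>

definition solves where
  "solves T L q y w z \<longleftrightarrow> block_sum T (block_apply q (orth_proj L z)) = y \<and>
     block_apply q z - w \<in> (block_sum T -` {0})\<^sup>\<bottom>"

abbreviation solves_at where
  "solves_at T L \<omega> \<equiv> solves T L (fst \<omega>) (fst (snd \<omega>)) (snd (snd \<omega>))"

lemma subspace_kernel: "linear f \<Longrightarrow> subspace (f -` {0})"
  by (intro linear_subspace_vimage) (auto simp: subspace_0)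

lemma linear_block_map: "linear (block_map T q)"
  using linear_compose[OF linear_block_apply linear_block_sum] by (simp add: o_def)

lemma solves_diff:
  assumes L: "subspace L" and "solves T L q y w z" "solves T L q y' w' z'"
  shows "solves T L q (y - y') (w - w') (z - z')"
proof -
  have "block_apply q (z - z') - (w - w') = (block_apply q z - w) - (block_apply q z' - w')"
    by (simp add: linear_diff[OF linear_block_apply])
  also have "\<dots> \<in> (block_sum T -` {0})\<^sup>\<bottom>"
    using assms by - (rule subspace_diff[OF subspace_orthogonal_comp]; simp add: solves_def)
  finally show ?thesis
    using assms by (simp add: solves_def linear_diff[OF linear_orth_proj[OF L]] linear_diff[OF linear_block_map])
qed

lemma solves_add:
  assumes L: "subspace L" and "solves T L q y w z" "solves T L q y' w' z'"
  shows "solves T L q (y + y') (w + w') (z + z')"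
proof -
  have "block_apply q (z + z') - (w + w') = (block_apply q z - w) + (block_apply q z' - w')"
    by (simp add: linear_add[OF linear_block_apply])
  also have "\<dots> \<in> (block_sum T -` {0})\<^sup>\<bottom>"
    using assms by - (rule subspace_add[OF subspace_orthogonal_comp]; simp add: solves_def)
  finally show ?thesis
    using assms by (simp add: solves_def linear_add[OF linear_orth_proj[OF L]] linear_add[OF linear_block_map])
qed

lemma solves_scale:
  assumes L: "subspace L" and "solves T L q y w z"
  shows "solves T L q (c *\<^sub>R y) (c *\<^sub>R w) (c *\<^sub>R z)"
proof -
  have "block_apply q (c *\<^sub>R z) - c *\<^sub>R w = c *\<^sub>R (block_apply q z - w)"
    by (simp add: linear_cmul[OF linear_block_apply] scaleR_diff_right)
  also have "\<dots> \<in> (block_sum T -` {0})\<^sup>\<bottom>"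
    using assms by - (rule subspace_scale[OF subspace_orthogonal_comp]; simp add: solves_def)
  finally show ?thesis
    using assms by (simp add: solves_def linear_cmul[OF linear_orth_proj[OF L]] linear_cmul[OF linear_block_map])
qed

lemma solves_0: "subspace L \<Longrightarrow> solves T L q 0 0 0"
  by (simp add: solves_def linear_0[OF linear_orth_proj] linear_0[OF linear_block_sum]
      linear_0[OF linear_block_apply] subspace_0[OF subspace_orthogonal_comp])

text \<open>The difference of the two projections is orthogonal to \<open>z - z'\<close>: rotated by \<open>q\<close>, the one
  lies in the kernel of \<open>block_sum T\<close> and the other in its complement. As the inner products
  of \<open>C\<close> with \<open>polar C\<close> are nonpositive, the squared norm of the difference of the
  projections is at most \<open>0\<close>.\<close>

lemma solves_monotone:
  assumes q: "block_orthogonal q" and L: "subspace L" and L': "subspace L'"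
    and z: "z \<in> biconic L C (polar C)" "solves T L q y w z"
    and z': "z' \<in> biconic L' C (polar C)" "solves T L' q y w z'"
  shows "orth_proj L z = orth_proj L' z'"
proof -
  define x x' n n' where "x = orth_proj L z" and "x' = orth_proj L' z'" and "n = z - x" and "n' = z' - x'"
  have mem: "x \<in> C" "n \<in> polar C" "x' \<in> C" "n' \<in> polar C"
    using z z' by (auto simp: biconic_def x_def x'_def n_def n'_def)
  have orth: "x \<bullet> n = 0" "x' \<bullet> n' = 0"
    using orth_proj[OF L, of z] orth_proj[OF L', of z']
    by (auto simp: mem_orthogonal_comp x_def x'_def n_def n'_def)
  have le: "x \<bullet> n' \<le> 0" "x' \<bullet> n \<le> 0" using mem by (auto intro: polar_inner_le)
  have ker: "block_apply q (x - x') \<in> block_sum T -` {0}"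
    using z z' by (simp add: solves_def x_def x'_def linear_diff[OF linear_block_map])
  have "block_apply q (z - z') = (block_apply q z - w) - (block_apply q z' - w)"
    by (simp add: linear_diff[OF linear_block_apply])
  also have "\<dots> \<in> (block_sum T -` {0})\<^sup>\<bottom>"
    using z z' by - (rule subspace_diff[OF subspace_orthogonal_comp]; simp add: solves_def)
  finally have "block_apply q (x - x') \<bullet> block_apply q (z - z') = 0"
    using ker by (simp add: mem_orthogonal_comp)
  then have "(x - x') \<bullet> (z - z') = 0" by (simp add: block_apply_inner[OF q])
  moreover have "z - z' = (x - x') + (n - n')" by (simp add: n_def n'_def)
  ultimately have "(x - x') \<bullet> (x - x') = - ((x - x') \<bullet> (n - n'))"
    by (simp add: inner_add_right)
  also have "\<dots> = x \<bullet> n' + x' \<bullet> n"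
    using orth by (simp add: inner_diff_left inner_diff_right)
  also have "\<dots> \<le> 0" using le by simp
  finally have "x - x' = 0" by (metis inner_eq_zero_iff inner_ge_zero order_antisym)
  then show ?thesis by (simp add: x_def x'_def)
qed

lemma solves_unique:
  assumes q: "block_orthogonal q" and L: "subspace L"
    and gen: "block_map T q ` L = UNIV"
    and z: "solves T L q y w z" "solves T L q y w z'"
  shows "z = z'"
proof -
  define u where "u = z - z'"
  define x where "x = orth_proj L u"
  have u: "solves T L q 0 0 u" using solves_diff[OF L z] by (simp add: u_def)
  have x: "x \<in> L" "u - x \<in> L\<^sup>\<bottom>" using orth_proj[OF L] by (auto simp: x_def)
  have ker: "block_apply q h \<bullet> block_apply q u = 0" if "block_sum T (block_apply q h) = 0" for h
    using u that by (simp add: solves_def mem_orthogonal_comp)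
  have "block_sum T (block_apply q x) = 0" using u by (simp add: solves_def x_def)
  then have "x \<bullet> u = 0" using ker[of x] by (simp add: block_apply_inner[OF q])
  moreover have "x \<bullet> (u - x) = 0" using x by (simp add: mem_orthogonal_comp)
  ultimately have "x = 0" by (simp add: inner_diff_right)
  then have uL: "u \<in> L\<^sup>\<bottom>" using x by simp
  obtain v where v: "v \<in> L" "block_sum T (block_apply q u) = block_sum T (block_apply q v)"
    using gen by (metis (mono_tags, lifting) UNIV_I imageE)
  then have "block_sum T (block_apply q (u - v)) = 0"
    by (simp add: linear_diff[OF linear_block_map])
  then have "(u - v) \<bullet> u = 0" using ker[of "u - v"] by (simp add: block_apply_inner[OF q])
  moreover have "v \<bullet> u = 0" using v uL by (simp add: mem_orthogonal_comp)
  ultimately have "u = 0" by (simp add: inner_diff_left)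
  then show ?thesis by (simp add: u_def)
qed

text \<open>Pulled back along the isometry \<open>block_apply q\<close>, the system is the optimality condition of
  \<open>fibre_closest_point\<close>.\<close>

lemma fibre_closest_point_block:
  assumes q: "block_orthogonal q" and C: "polyhedral_cone C"
    and y: "y \<in> block_map T q ` C"
  obtains x n where "x \<in> C" "n \<in> polar C" "x \<bullet> n = 0"
    "block_sum T (block_apply q x) = y" "block_apply q (x + n) - w \<in> (block_sum T -` {0})\<^sup>\<bottom>"
proof -
  obtain v where v: "block_apply q v = w" using block_apply_surj[OF q] by blast
  obtain x n where xn: "x \<in> C" "n \<in> polar C" "x \<bullet> n = 0" "block_sum T (block_apply q x) = y"
      "x + n - v \<in> (block_map T q -` {0})\<^sup>\<bottom>"
    using fibre_closest_point[OF C linear_block_map y] by blast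
  have "h \<bullet> (block_apply q (x + n) - w) = 0" if "block_sum T h = 0" for h
  proof -
    obtain g where g: "block_apply q g = h" using block_apply_surj[OF q] by blast
    have "h \<bullet> (block_apply q (x + n) - w) = block_apply q g \<bullet> block_apply q (x + n - v)"
      by (simp add: g v linear_diff[OF linear_block_apply])
    also have "\<dots> = g \<bullet> (x + n - v)" by (rule block_apply_inner[OF q])
    also have "\<dots> = 0" using xn(5) that g by (simp add: mem_orthogonal_comp)
    finally show ?thesis .
  qed
  then have "block_apply q (x + n) - w \<in> (block_sum T -` {0})\<^sup>\<bottom>"
    by (simp add: mem_orthogonal_comp)
  then show thesis using xn that by blast
qed

lemma solves_biconic_exists:
  assumes q: "block_orthogonal q" and C: "polyhedral_cone C"
    and y: "y \<in> block_map T q ` C"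
    and LL: "\<And>L. L \<in> LL \<Longrightarrow> subspace L"
    and comp: "\<And>x n. x \<in> C \<Longrightarrow> n \<in> polar C \<Longrightarrow> x \<bullet> n = 0 \<Longrightarrow> \<exists>L\<in>LL. x \<in> L \<and> n \<in> L\<^sup>\<bottom>"
  obtains L z where "L \<in> LL" "z \<in> biconic L C (polar C)" "solves T L q y w z"
proof -
  obtain x n where xn: "x \<in> C" "n \<in> polar C" "x \<bullet> n = 0" "block_sum T (block_apply q x) = y"
      "block_apply q (x + n) - w \<in> (block_sum T -` {0})\<^sup>\<bottom>"
    using fibre_closest_point_block[OF q C y] by blast
  from comp[OF xn(1-3)] obtain L where L: "L \<in> LL" "x \<in> L" "n \<in> L\<^sup>\<bottom>" by blast
  have "orth_proj L (x + n) = x" using L LL by (intro orth_proj_eqI) auto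
  then show thesis using that[of L "x + n"] L xn by (simp add: biconic_def solves_def)
qed

lemma solves_exists:
  assumes q: "block_orthogonal q" and L: "subspace L"
    and gen: "block_map T q ` L = UNIV"
  shows "\<exists>z. solves T L q y w z"
proof -
  have "y \<in> block_map T q ` L" using gen by simp
  then obtain x n where xn: "x \<in> L" "n \<in> L\<^sup>\<bottom>" "block_sum T (block_apply q x) = y"
      "block_apply q (x + n) - w \<in> (block_sum T -` {0})\<^sup>\<bottom>"
    using fibre_closest_point_block[OF q polyhedral_cone_subspace[OF L]]
    by (metis polar_subspace[OF L])
  have "orth_proj L (x + n) = x" using L xn by (intro orth_proj_eqI) auto
  then show ?thesis using xn by (intro exI[of _ "x + n"]) (simp add: solves_def)
qed

text \<open>The solvable right hand sides \<open>(y, w)\<close> form a subspace. It is proper: if \<open>L\<close> is not mapped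
  onto the whole space, then some \<open>y\<close> is not attained, and otherwise the right hand side
  belonging to a point outside \<open>W\<close> has no second solution in \<open>W\<close>.\<close>

lemma solves_null:
  assumes q: "block_orthogonal q" and L: "subspace L" and W: "subspace W"
    and alt: "block_map T q ` L \<noteq> UNIV \<or> W \<noteq> UNIV"
  shows "AE p in gauss \<Otimes>\<^sub>M gauss. \<not> (\<exists>z\<in>W. solves T L q (fst p) (snd p) z)"
proof -
  define G where "G = {p. \<exists>z\<in>W. solves T L q (fst p) (snd p) z}"
  have "subspace G"
  proof (rule subspaceI)
    show "0 \<in> G" unfolding G_def
      using solves_0[OF L] subspace_0[OF W] by force
    show "x + y \<in> G"
      if "x \<in> G" "y \<in> G" for x y
    proof -
      from that obtain z z' where "z \<in> W" "solves T L q (fst x) (snd x) z" "z' \<in> W" "solves T L q (fst y) (snd y) z'"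
        unfolding G_def by blast
      then have "z + z' \<in> W" "solves T L q (fst (x + y)) (snd (x + y)) (z + z')"
        using W L by (auto intro: subspace_add solves_add)
      then show ?thesis unfolding G_def by blast
    qed
    show "c *\<^sub>R x \<in> G"
      if "x \<in> G" for c x
    proof -
      from that obtain z where "z \<in> W" "solves T L q (fst x) (snd x) z"
        unfolding G_def by blast
      then have "c *\<^sub>R z \<in> W" "solves T L q (fst (c *\<^sub>R x)) (snd (c *\<^sub>R x)) (c *\<^sub>R z)"
        using W L by (auto intro: subspace_scale solves_scale)
      then show ?thesis unfolding G_def by blast
    qed
  qed
  moreover have "G \<noteq> UNIV"
  proof (cases "block_map T q ` L = UNIV")
    case False
    then obtain y where "y \<notin> block_map T q ` L" by blast
    then have "(y, 0) \<notin> G" using orth_proj_in[OF L] by (auto simp: G_def solves_def)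
    then show ?thesis by blast
  next
    case True
    with alt obtain z where z: "z \<notin> W" by blast
    define p where "p = (block_sum T (block_apply q (orth_proj L z)), block_apply q z)"
    have "solves T L q (fst p) (snd p) z"
      by (simp add: p_def solves_def subspace_0[OF subspace_orthogonal_comp])
    then have "p \<notin> G" using solves_unique[OF q L True] z by (auto simp: G_def)
    then show ?thesis by blast
  qed
  ultimately have "AE p in gauss \<Otimes>\<^sub>M gauss. p \<notin> G" by (rule gauss_pair_proper_subspace_null)
  then show ?thesis by (simp add: G_def)
qed

section \<open>General position\<close>

text \<open>The joint law of independent Haar distributed orthogonal matrices, described by its right
  invariance and regarded as one measure on the Euclidean space of tuples of matrices.\<close>

locale block_haar =
  fixes \<rho> :: "(real^'d^'d^'m::finite) measure"
  assumes prob: "prob_space \<rho>" and sets_\<rho>: "sets \<rho> = sets borel"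
    and orthogonal: "AE q in \<rho>. block_orthogonal q"
    and invariant: "\<And>r. block_orthogonal r \<Longrightarrow> distr \<rho> borel (\<lambda>q. block_mult q r) = \<rho>"
begin

sublocale prob_space \<rho> by (rule prob)

lemma space_\<rho>: "space \<rho> = UNIV"
  using sets_eq_imp_space_eq[OF sets_\<rho>] by simp

lemma block_mult_measurable: "(\<lambda>q. block_mult q r) \<in> borel_measurable \<rho>"
proof -
  have "(\<lambda>q. block_mult q r) \<in> borel_measurable borel"
    by (intro borel_measurable_continuous_onI continuous_block_mult continuous_intros)
  then show ?thesis using measurable_cong_sets[OF sets_\<rho> refl] by blast
qed

lemma emeasure_invariant:
  assumes "block_orthogonal r" "S \<in> sets borel"
  shows "emeasure \<rho> {q. block_mult q r \<in> S} = emeasure \<rho> S"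
proof -
  have "emeasure \<rho> S = emeasure (distr \<rho> borel (\<lambda>q. block_mult q r)) S"
    by (simp add: invariant[OF assms(1)])
  also have "\<dots> = emeasure \<rho> {q. block_mult q r \<in> S}"
    using assms(2) by (simp add: emeasure_distr block_mult_measurable space_\<rho> vimage_def)
  finally show ?thesis ..
qed

end

text \<open>The set is the projection of the closed set of pairs \<open>(x, p)\<close> such that \<open>x \<in> K\<close> is mapped to
  \<open>f p\<close>. It may fail to be closed if \<open>K\<close> is unbounded.\<close>

lemma mem_image_borel:
  fixes K :: "(real^'d^'m::finite) set" and g :: "'b::euclidean_space \<Rightarrow> real^'d^'d^'m" and f :: "'b \<Rightarrow> real^'d"
  assumes "closed K" "continuous_on UNIV g" "continuous_on UNIV f"
  shows "{p. f p \<in> block_map T (g p) ` K} \<in> sets borel"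
proof -
  have "closed {(x, p). x \<in> K \<and> f p = block_sum T (block_apply (g p) x)}"
  proof -
    have "closed ((fst -` K) \<inter> {p. f (snd p) = block_sum T (block_apply (g (snd p)) (fst p))})"
      using assms
      by (intro closed_Int closed_vimage closed_Collect_eq continuous_block_sum continuous_block_apply
          continuous_intros continuous_on_compose2[OF assms(2)] continuous_on_compose2[OF assms(3)]) auto
    also have "(fst -` K) \<inter> {p. f (snd p) = block_sum T (block_apply (g (snd p)) (fst p))} =
        {(x, p). x \<in> K \<and> f p = block_sum T (block_apply (g p) x)}" by auto
    finally show ?thesis .
  qed
  from borel_projection_closed[OF this]
  have "{y. \<exists>x. x \<in> K \<and> f y = block_sum T (block_apply (g y) x)} \<in> sets borel" by simp
  also have "{y. \<exists>x. x \<in> K \<and> f y = block_sum T (block_apply (g y) x)} =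
      {p. f p \<in> block_map T (g p) ` K}" by auto
  finally show ?thesis .
qed

lemma subspace_image_block_sum:
  assumes "subspace K"
  shows "subspace (block_map T q ` K)"
  using linear_subspace_image[OF linear_block_map assms] .

lemma subspace_eq_UNIV_iff_Basis:
  fixes S :: "'a::euclidean_space set"
  shows "subspace S \<Longrightarrow> S = UNIV \<longleftrightarrow> (\<forall>b\<in>Basis. b \<in> S)"
  by (metis UNIV_I span_Basis span_minimal subsetI top.extremum_uniqueI)

lemma image_eq_UNIV_borel:
  fixes K :: "(real^'d^'m::finite) set" and g :: "'b::euclidean_space \<Rightarrow> real^'d^'d^'m"
  assumes K: "subspace K" and "continuous_on UNIV g"
  shows "{p. block_map T (g p) ` K = UNIV} \<in> sets borel"
proof -
  have "{p. block_map T (g p) ` K = UNIV} =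
      (\<Inter>b\<in>Basis. {p. b \<in> block_map T (g p) ` K})"
    using subspace_eq_UNIV_iff_Basis[OF subspace_image_block_sum[OF K]] by auto
  also have "\<dots> \<in> sets borel"
    using assms closed_subspace[OF K]
    by (intro sets.finite_INT mem_image_borel) (auto intro: continuous_on_const)
  finally show ?thesis .
qed

lemma block_map_axis: "block_sum T (block_apply q (axis i c)) = T i *v (q $ i *v c)"
proof -
  have "block_sum T (block_apply q (axis i c)) = (\<Sum>j\<in>UNIV. if j = i then T i *v (q $ i *v c) else 0)"
    unfolding block_sum_def block_apply_nth by (intro sum.cong) (auto simp: axis_def)
  then show ?thesis by simp
qed

context block_haar begin

text \<open>If the image of \<open>cone_product V\<close> is a proper subspace, then for fixed \<open>q\<close> almost no Gaussian
  vector \<open>c\<close> put into block \<open>i0\<close> is mapped into it. By Fubini's theorem it suffices to see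
  that the probability of this event, with \<open>q\<close> random and \<open>c\<close> fixed, is the same for all
  \<open>c \<notin> V i0\<close>. This is right invariance under a reflection that fixes \<open>V i0\<close> and maps one
  complementary direction to another.\<close>

lemma AE_axis_notin_image:
  assumes T: "\<And>i. invertible (T i)" and V: "\<And>i. subspace (V i)" and b: "b \<notin> V i0"
  shows "AE q in \<rho>. block_map T q ` cone_product V = UNIV \<or>
    block_sum T (block_apply q (axis i0 b)) \<notin> block_map T q ` cone_product V"
proof -
  define K where "K = cone_product V"
  define S where "S q = block_map T q ` K" for q
  have K: "subspace K" unfolding K_def using V by (rule subspace_cone_product)
  have S: "subspace (S q)" for q unfolding S_def by (rule subspace_image_block_sum[OF K])
  define v :: "real^'d^'d^'m \<Rightarrow> real^'d \<Rightarrow> real^'d" where "v q c = T i0 *v (q $ i0 *v c)" for q c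
  have lin_v: "linear (v q)" for q
    unfolding v_def using linear_compose[OF matrix_vector_mul_linear matrix_vector_mul_linear] by (simp add: o_def)
  define N where "N = {p. v (fst p) (snd p) \<in> S (fst p) \<and> S (fst p) \<noteq> UNIV}"
  have cont_v: "continuous_on UNIV (\<lambda>p. v (fst p) (snd p))"
    unfolding v_def matrix_vector_mult_def by (intro continuous_intros)
  have N: "N \<in> sets borel"
  proof -
    have "{p. v (fst p) (snd p) \<in> S (fst p)} \<in> sets borel"
      unfolding S_def using closed_subspace[OF K] cont_v
      by (intro mem_image_borel continuous_intros)
    moreover have "{p. S (fst p) = UNIV} \<in> sets (borel :: ((real^'d^'d^'m) \<times> (real^'d)) measure)"
      unfolding S_def by (intro image_eq_UNIV_borel K continuous_intros)
    ultimately have "{p. v (fst p) (snd p) \<in> S (fst p)} - {p. S (fst p) = UNIV} \<in> sets borel"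
      by (rule sets.Diff)
    also have "{p. v (fst p) (snd p) \<in> S (fst p)} - {p. S (fst p) = UNIV} = N"
      by (auto simp: N_def)
    finally show ?thesis .
  qed
  interpret G: prob_space "gauss :: (real^'d) measure" by (rule prob_space_gauss)
  interpret P: pair_sigma_finite \<rho> "gauss :: (real^'d) measure" ..
  have sets_pair: "sets (\<rho> \<Otimes>\<^sub>M (gauss :: (real^'d) measure)) = sets borel"
    using sets_pair_measure_cong[OF sets_\<rho> sets_gauss] unfolding borel_prod .
  have N_pair: "N \<in> sets (\<rho> \<Otimes>\<^sub>M gauss)" using N unfolding sets_pair .
  have bad: "{q. (q, c) \<in> N} \<in> sets borel" for c
    using measurable_sets_borel[OF _ N, of "\<lambda>q. (q, c)"] by (simp add: vimage_def)
  \<comment> \<open>By invariance, the probability of degeneracy is the same for all directions outside \<open>V i0\<close>.\<close>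
  have same: "emeasure \<rho> {q. (q, c) \<in> N} = emeasure \<rho> {q. (q, b) \<in> N}" if c: "c \<notin> V i0" for c
  proof -
    define b' c' where "b' = b - orth_proj (V i0) b" and "c' = c - orth_proj (V i0) c"
    have mem: "b' \<in> (V i0)\<^sup>\<bottom>" "c' \<in> (V i0)\<^sup>\<bottom>"
      unfolding b'_def c'_def by (intro orth_proj_diff V)+
    have nz: "b' \<noteq> 0" "c' \<noteq> 0"
      using b c orth_proj_in[OF V, of i0 b] orth_proj_in[OF V, of i0 c] by (auto simp: b'_def c'_def)
    define t where "t = norm b' / norm c'"
    have t: "t \<noteq> 0" "norm b' = norm (t *\<^sub>R c')" using nz by (auto simp: t_def)
    have "t *\<^sub>R c' \<in> (V i0)\<^sup>\<bottom>" using mem by (intro subspace_scale subspace_orthogonal_comp)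
    then obtain R where R: "orthogonal_matrix R" "R *v b' = t *\<^sub>R c'" "\<And>x. x \<in> V i0 \<Longrightarrow> R *v x = x"
      using householder[OF subspace_orthogonal_comp mem(1) _ t(2)] by (metis orthogonal_comp_self[OF V])
    define r :: "real^'d^'d^'m" where "r = (\<chi> i. if i = i0 then R else mat 1)"
    have r: "block_orthogonal r"
      using R(1) by (simp add: block_orthogonal_def r_def orthogonal_matrix_id)
    have fix_K: "block_apply r x = x" if "x \<in> K" for x
      using that R(3) by (auto simp: vec_eq_iff r_def K_def cone_product_def)
    have S_r: "S (block_mult q r) = S q" for q
      unfolding S_def by (intro image_cong) (simp_all add: block_apply_mult fix_K)
    have in_S: "v q x \<in> S q" if "x \<in> V i0" for q x
    proof -
      have "axis i0 x \<in> K" using that V by (auto simp: K_def cone_product_def axis_def subspace_0)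
      then show ?thesis unfolding S_def v_def by (metis block_map_axis image_eqI)
    qed
    have reduce: "v q x \<in> S q \<longleftrightarrow> v q (x - p) \<in> S q" if "p \<in> V i0" for q x p
      using in_S[OF that, of q] S[of q] subspace_diff[OF S, of "v q x" q "v q p"] subspace_add[OF S, of "v q (x - p)" q "v q p"]
      by (auto simp: linear_diff[OF lin_v])
    have "v (block_mult q r) b \<in> S (block_mult q r) \<longleftrightarrow> v q c \<in> S q" for q
    proof -
      have "v (block_mult q r) b = v q (R *v b)"
        by (simp add: v_def block_mult_def r_def matrix_vector_mul_assoc)
      also have "b = orth_proj (V i0) b + b'" by (simp add: b'_def)
      then have "R *v b = orth_proj (V i0) b + t *\<^sub>R c'"
        using R(3)[OF orth_proj_in[OF V]] R(2) by (metis matrix_vector_right_distrib)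
      finally have "v (block_mult q r) b \<in> S q \<longleftrightarrow> v q (t *\<^sub>R c') \<in> S q"
        using reduce[OF orth_proj_in[OF V, of i0 b], of q "orth_proj (V i0) b + t *\<^sub>R c'"] by simp
      also have "\<dots> \<longleftrightarrow> v q c' \<in> S q"
        using t(1) subspace_scale[OF S, of "v q c'" q t] subspace_scale[OF S, of "t *\<^sub>R v q c'" q "inverse t"]
        by (auto simp: linear_cmul[OF lin_v])
      also have "\<dots> \<longleftrightarrow> v q c \<in> S q"
        using reduce[OF orth_proj_in[OF V, of i0 c], of q c] by (simp add: c'_def)
      finally show ?thesis by (simp add: S_r)
    qed
    then have "{q. (q, c) \<in> N} = {q. block_mult q r \<in> {q. (q, b) \<in> N}}"
      by (simp add: N_def S_r)
    then show ?thesis using emeasure_invariant[OF r bad] by simp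
  qed
  have null: "emeasure gauss {c. (q, c) \<in> N} = 0" if q: "block_orthogonal q" for q
  proof (cases "S q = UNIV")
    case False
    have "{c. v q c \<in> S q} \<noteq> UNIV"
    proof
      assume U: "{c. v q c \<in> S q} = UNIV"
      have "y \<in> S q" for y
      proof -
        obtain A where A: "T i0 ** A = mat 1" using T[of i0] by (auto simp: invertible_def)
        have qq: "q $ i0 ** transpose (q $ i0) = mat 1"
          using q by (simp add: block_orthogonal_def orthogonal_matrix_def)
        have "v q (transpose (q $ i0) *v (A *v y)) = y"
          by (simp add: v_def matrix_vector_mul_assoc matrix_mul_assoc[symmetric])
            (simp add: matrix_mul_assoc qq A)
        then show ?thesis using U by (metis UNIV_I mem_Collect_eq)
      qed
      then show False using False by auto
    qed
    moreover have "subspace {c. v q c \<in> S q}"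
      using linear_subspace_vimage[OF lin_v S, of q q] by (simp add: vimage_def)
    ultimately have "{c. v q c \<in> S q} \<in> null_sets gauss" by (rule gauss_proper_subspace_null[rotated])
    then show ?thesis using False by (simp add: N_def null_sets_def)
  qed (simp add: N_def)
  have "emeasure (\<rho> \<Otimes>\<^sub>M gauss) N = (\<integral>\<^sup>+q. emeasure gauss (Pair q -` N) \<partial>\<rho>)"
    by (rule G.emeasure_pair_measure_alt[OF N_pair])
  also have "\<dots> = (\<integral>\<^sup>+q. 0 \<partial>\<rho>)"
    using orthogonal by (intro nn_integral_cong_AE) (auto elim!: eventually_mono simp: vimage_def null)
  finally have "0 = emeasure (\<rho> \<Otimes>\<^sub>M gauss) N" by simp
  also have "\<dots> = (\<integral>\<^sup>+c. emeasure \<rho> ((\<lambda>q. (q, c)) -` N) \<partial>gauss)"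
    by (rule P.emeasure_pair_measure_alt2[OF N_pair])
  also have "\<dots> = (\<integral>\<^sup>+c. emeasure \<rho> {q. (q, b) \<in> N} \<partial>(gauss :: (real^'d) measure))"
  proof (rule nn_integral_cong_AE)
    have "V i0 \<in> null_sets gauss" using b by (intro gauss_proper_subspace_null V) auto
    then have "AE c in gauss. c \<notin> V i0" by (rule AE_not_in)
    then show "AE c in gauss. emeasure \<rho> ((\<lambda>q. (q, c)) -` N) = emeasure \<rho> {q. (q, b) \<in> N}"
      by eventually_elim (simp add: vimage_def same)
  qed
  also have "\<dots> = emeasure \<rho> {q. (q, b) \<in> N}"
    by (simp add: G.emeasure_space_1[simplified])
  finally have "{q. (q, b) \<in> N} \<in> null_sets \<rho>"
    using bad by (simp add: null_sets_def sets_\<rho>)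
  then have "AE q in \<rho>. (q, b) \<notin> N" by (auto dest: AE_not_in)
  then show ?thesis
    by eventually_elim (auto simp: N_def S_def K_def v_def block_map_axis)
qed

text \<open>Induction on the dimension, removing from one of the factors a line, so that the previous
  lemma applies to the smaller product.\<close>

lemma AE_dim_image:
  assumes T: "\<And>i. invertible (T i)" and V: "\<And>i. subspace (V i)"
  shows "AE q in \<rho>. min CARD('d) (dim (cone_product V)) \<le>
    dim (block_map T q ` cone_product V)"
  using V
proof (induction "dim (cone_product V)" arbitrary: V rule: less_induct)
  case less
  show ?case
  proof (cases "cone_product V \<subseteq> {0}")
    case True
    then have "dim (cone_product V) = 0" using dim_eq_0 by blast
    then show ?thesis unfolding \<open>dim _ = 0\<close> by simp
  next
    case False
    then obtain x where x: "x \<in> cone_product V" "x \<noteq> 0" by blast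
    then obtain i0 where i0: "x $ i0 \<noteq> 0" by (auto simp: vec_eq_iff)
    define b where "b = x $ i0"
    have b: "b \<in> V i0" "b \<noteq> 0" using x i0 by (auto simp: b_def cone_product_def)
    define V' where "V' = V(i0 := V i0 \<inter> (span {b})\<^sup>\<bottom>)"
    have V': "subspace (V' i)" for i
      using less.prems by (auto simp: V'_def intro!: subspace_inter subspace_orthogonal_comp)
    have bV': "b \<notin> V' i0" using b by (auto simp: V'_def mem_orthogonal_comp intro!: bexI[of _ b] span_base)
    have sub: "cone_product V' \<subseteq> cone_product V"
      by (auto simp: cone_product_def V'_def split: if_splits)
    have ax: "axis i0 b \<in> cone_product V" "axis i0 b \<notin> cone_product V'"
      using b bV' less.prems by (auto simp: cone_product_def axis_def subspace_0)
    have span_sub: "cone_product V \<subseteq> span (insert (axis i0 b) (cone_product V'))"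
    proof
      fix y assume y: "y \<in> cone_product V"
      define p where "p = orth_proj (span {b}) (y $ i0)"
      have "p \<in> span {b}" by (simp add: p_def orth_proj_in)
      then obtain t where t: "p = t *\<^sub>R b" by (auto simp: span_singleton)
      have "y $ i0 - p \<in> (span {b})\<^sup>\<bottom>" by (simp add: p_def orth_proj_diff)
      moreover have "y $ i0 - p \<in> V i0"
        using y b less.prems t by (auto simp: cone_product_def intro!: subspace_diff subspace_scale)
      ultimately have "y - t *\<^sub>R axis i0 b \<in> cone_product V'"
        using y by (auto simp: cone_product_def V'_def axis_def t)
      then have "y - t *\<^sub>R axis i0 b \<in> span (insert (axis i0 b) (cone_product V'))"
        by (intro span_base) simp
      moreover have "t *\<^sub>R axis i0 b \<in> span (insert (axis i0 b) (cone_product V'))"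
        by (intro span_scale span_base) simp
      ultimately have "(y - t *\<^sub>R axis i0 b) + t *\<^sub>R axis i0 b \<in> span (insert (axis i0 b) (cone_product V'))"
        by (rule span_add)
      then show "y \<in> span (insert (axis i0 b) (cone_product V'))" by simp
    qed
    have spV': "span (cone_product V') = cone_product V'" "span (cone_product V) = cone_product V"
      using subspace_cone_product V' less.prems by (auto simp: span_eq_iff)
    have lt: "dim (cone_product V') < dim (cone_product V)"
      using sub ax by (intro dim_psubset) (auto simp: spV')
    have le: "dim (cone_product V) \<le> dim (cone_product V') + 1"
    proof -
      have "dim (cone_product V) \<le> dim (insert (axis i0 b) (cone_product V'))"
        using dim_mono[OF span_sub] by simp
      also have "\<dots> \<le> dim (cone_product V') + 1" by (simp add: dim_insert)
      finally show ?thesis .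
    qed
    have IH: "AE q in \<rho>. min CARD('d) (dim (cone_product V')) \<le> dim (block_map T q ` cone_product V')"
      by (rule less.hyps[OF lt V'])
    have step: "AE q in \<rho>. block_map T q ` cone_product V' = UNIV \<or>
      block_sum T (block_apply q (axis i0 b)) \<notin> block_map T q ` cone_product V'"
      by (intro AE_axis_notin_image T V' bV')
    show ?thesis using IH step
    proof eventually_elim
      fix q
      let ?S = "\<lambda>V. block_map T q ` cone_product V"
      assume ih: "min CARD('d) (dim (cone_product V')) \<le> dim (?S V')"
        and st: "?S V' = UNIV \<or> block_sum T (block_apply q (axis i0 b)) \<notin> ?S V'"
      have mono: "?S V' \<subseteq> ?S V" using sub by blast
      show "min CARD('d) (dim (cone_product V)) \<le> dim (?S V)"
      proof (cases "?S V' = UNIV")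
        case True
        then have "?S V = UNIV" using mono by auto
        then show ?thesis by simp
      next
        case False
        then have no: "block_sum T (block_apply q (axis i0 b)) \<notin> ?S V'" using st by blast
        have ss: "subspace (?S V')" "subspace (?S V)"
          by (intro subspace_image_block_sum subspace_cone_product V' less.prems)+
        have "block_sum T (block_apply q (axis i0 b)) \<in> ?S V" using ax by blast
        then have "?S V' \<subset> ?S V" using no mono by blast
        then have "dim (?S V') < dim (?S V)"
          using ss by (intro dim_psubset) (simp add: span_eq_iff[THEN iffD2])
        then show ?thesis using ih le by linarith
      qed
    qed
  qed
qed

lemma AE_image_UNIV:
  assumes T: "\<And>i. invertible (T i)" and V: "\<And>i. subspace (V i)" and d: "CARD('d) \<le> dim (cone_product V)"
  shows "AE q in \<rho>. block_map T q ` cone_product V = UNIV"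
  using AE_dim_image[OF T V]
proof eventually_elim
  fix q
  let ?S = "block_map T q ` cone_product V"
  assume "min CARD('d) (dim (cone_product V)) \<le> dim ?S"
  then have "dim ?S = DIM(real^'d)" using d dim_subset_UNIV[of ?S] by simp
  then have "span ?S = UNIV" using dim_eq_full by blast
  moreover have "subspace ?S" by (intro subspace_image_block_sum subspace_cone_product V)
  then have "span ?S = ?S" by (rule span_eq_iff[THEN iffD2])
  ultimately show "?S = UNIV" by (simp only:)
qed

end

section \<open>Normalised vectors\<close>

lemma orth_proj_cone_product:
  assumes V: "\<And>i. subspace (V i)"
  shows "orth_proj (cone_product V) z = (\<chi> i. orth_proj (V i) (z $ i))"
proof (rule orth_proj_eqI)
  show "subspace (cone_product V)" using V by (rule subspace_cone_product)
  show "(\<chi> i. orth_proj (V i) (z $ i)) \<in> cone_product V"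
    using V by (simp add: cone_product_def orth_proj_in)
  have "y $ i \<bullet> (z $ i - orth_proj (V i) (z $ i)) = 0" if "y \<in> cone_product V" for y i
    using that orth_proj_diff[OF V, of "z $ i" i] by (auto simp: cone_product_def mem_orthogonal_comp)
  then show "z - (\<chi> i. orth_proj (V i) (z $ i)) \<in> (cone_product V)\<^sup>\<bottom>"
    by (simp add: mem_orthogonal_comp inner_vec_def)
qed

text \<open>Each block is split into its components in \<open>V i\<close> and in the orthogonal complement, and both
  are scaled to length one; components equal to zero stay zero.\<close>

definition normalise :: "('m \<Rightarrow> (real^'d) set) \<Rightarrow> real^'d^'m::finite \<Rightarrow> real^'d^'m" where
  "normalise V z = (\<chi> i. sgn (orth_proj (V i) (z $ i)) + sgn (z $ i - orth_proj (V i) (z $ i)))"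

text \<open>For orthogonal matrices, commuting with the projection to \<open>V i\<close> means preserving \<open>V i\<close>.\<close>

definition block_stabilises :: "('m \<Rightarrow> (real^'d) set) \<Rightarrow> real^'d^'d^'m::finite \<Rightarrow> bool" where
  "block_stabilises V r \<longleftrightarrow> block_orthogonal r \<and>
     (\<forall>i x. orth_proj (V i) (r $ i *v x) = r $ i *v orth_proj (V i) x)"

lemma orth_proj_normalise:
  assumes V: "\<And>i. subspace (V i)"
  shows "orth_proj (V i) (normalise V z $ i) = sgn (orth_proj (V i) (z $ i))"
proof (rule orth_proj_eqI[OF V])
  show "sgn (orth_proj (V i) (z $ i)) \<in> V i"
    unfolding sgn_div_norm using V by (intro subspace_scale orth_proj_in)
  have "sgn (z $ i - orth_proj (V i) (z $ i)) \<in> (V i)\<^sup>\<bottom>"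
    unfolding sgn_div_norm by (rule subspace_scale[OF subspace_orthogonal_comp]) (rule orth_proj_diff[OF V])
  then show "normalise V z $ i - sgn (orth_proj (V i) (z $ i)) \<in> (V i)\<^sup>\<bottom>"
    by (simp add: normalise_def)
qed

lemma diff_orth_proj_normalise:
  assumes V: "\<And>i. subspace (V i)"
  shows "normalise V z $ i - orth_proj (V i) (normalise V z $ i) = sgn (z $ i - orth_proj (V i) (z $ i))"
  unfolding orth_proj_normalise[where V=V, OF V] by (simp add: normalise_def)

lemma normalise_measurable:
  fixes V :: "'m::finite \<Rightarrow> (real^'d) set"
  assumes V: "\<And>i. subspace (V i)"
  shows "normalise V \<in> borel_measurable borel"
proof -
  have [measurable]: "orth_proj (V i) \<in> borel_measurable borel" for i
    by (rule orth_proj_measurable[OF V])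
  have [measurable]: "(\<lambda>x. x $ i) \<in> borel_measurable (borel :: (real^'d^'m) measure)" for i :: 'm
    by (intro borel_measurable_continuous_onI continuous_intros)
  have [measurable]: "(sgn :: real^'d \<Rightarrow> real^'d) \<in> borel_measurable borel"
    unfolding sgn_div_norm[abs_def] by measurable
  have comp: "(\<lambda>z. sgn (orth_proj (V i) (z $ i)) + sgn (z $ i - orth_proj (V i) (z $ i))) \<in> borel_measurable borel" for i
    by measurable
  have "normalise V = (\<lambda>z. \<Sum>i\<in>UNIV. axis i (sgn (orth_proj (V i) (z $ i)) + sgn (z $ i - orth_proj (V i) (z $ i))))"
    by (simp add: normalise_def fun_eq_iff vec_eq_iff axis_def)
  moreover have "(\<lambda>x. axis i x :: real^'d^'m) \<in> borel_measurable borel" for i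
    by (intro borel_measurable_linear) (simp add: linear_iff axis_def vec_eq_iff)
  ultimately show ?thesis
    using comp by (auto intro!: borel_measurable_sum measurable_compose[OF comp])
qed

context
  fixes V :: "'m::finite \<Rightarrow> (real^'d) set" and r :: "real^'d^'d^'m"
  assumes V: "\<And>i. subspace (V i)" and r: "block_stabilises V r"
begin

lemma stabilises_orthogonal: "block_orthogonal r"
  using r by (simp add: block_stabilises_def)

lemma orth_proj_block_apply:
  "orth_proj (cone_product V) (block_apply r z) = block_apply r (orth_proj (cone_product V) z)"
  using r by (simp add: orth_proj_cone_product[where V=V, OF V] block_stabilises_def vec_eq_iff)

lemma block_apply_image_cone_product: "block_apply r ` cone_product V = cone_product V"
proof
  have L: "subspace (cone_product V)" using V by (rule subspace_cone_product)
  show "block_apply r ` cone_product V \<subseteq> cone_product V"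
  proof
    fix y assume "y \<in> block_apply r ` cone_product V"
    then obtain x where x: "x \<in> cone_product V" "y = block_apply r x" by blast
    have "orth_proj (cone_product V) x = x"
      using x(1) L by (intro orth_proj_eqI) (auto simp: subspace_0[OF subspace_orthogonal_comp])
    then show "y \<in> cone_product V"
      using orth_proj_in[OF L, of y] x(2) orth_proj_block_apply[of x] by simp
  qed
  show "cone_product V \<subseteq> block_apply r ` cone_product V"
  proof
    fix y assume y: "y \<in> cone_product V"
    obtain x where x: "block_apply r x = y" using block_apply_surj[OF stabilises_orthogonal] by blast
    have "orth_proj (cone_product V) y = y"
      using y L by (intro orth_proj_eqI) (auto simp: subspace_0[OF subspace_orthogonal_comp])
    then have "y = block_apply r (orth_proj (cone_product V) x)"
      using orth_proj_block_apply[of x] x by simp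
    then show "y \<in> block_apply r ` cone_product V" using orth_proj_in[OF L] by blast
  qed
qed

lemma normalise_block_apply: "normalise V (block_apply r z) = block_apply r (normalise V z)"
proof -
  have orth: "orthogonal_transformation ((*v) (r $ i))" for i
    using stabilises_orthogonal by (simp add: block_orthogonal_def orthogonal_transformation_matrix)
  have sgn: "sgn (r $ i *v x) = r $ i *v sgn x" for i x
    using orthogonal_transformation_norm[OF orth, of i x]
    by (simp add: sgn_div_norm matrix_vector_mult_scaleR)
  have "r $ i *v x - r $ i *v y = r $ i *v (x - y)" for i x y
    by (simp add: matrix_vector_mult_diff_distrib)
  then have "normalise V (block_apply r z) $ i = block_apply r (normalise V z) $ i" for i
    using r by (simp add: normalise_def block_stabilises_def sgn matrix_vector_right_distrib)
  then show ?thesis by (simp only: vec_eq_iff[of "normalise V (block_apply r z)"] simp_thms)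
qed

end

text \<open>In each block, one reflection acts on \<open>V i\<close> and another one on its complement.\<close>

lemma block_stabilises_transitive:
  fixes V :: "'m::finite \<Rightarrow> (real^'d) set"
  assumes V: "\<And>i. subspace (V i)"
    and norms: "\<And>i. norm (orth_proj (V i) (x $ i)) = norm (orth_proj (V i) (x' $ i))"
      "\<And>i. norm (x $ i - orth_proj (V i) (x $ i)) = norm (x' $ i - orth_proj (V i) (x' $ i))"
  obtains r where "block_stabilises V r" "block_apply r x = x'"
proof -
  have "\<exists>R. orthogonal_matrix R \<and> (\<forall>y. orth_proj (V i) (R *v y) = R *v orth_proj (V i) y) \<and> R *v (x $ i) = x' $ i" for i
  proof -
    let ?p = "orth_proj (V i)"
    note in_V = orth_proj_in[OF V, of i] and in_V' = orth_proj_diff[OF V, of _ i]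
    obtain R1 where R1: "orthogonal_matrix R1" "R1 *v ?p (x $ i) = ?p (x' $ i)"
      "\<And>y. y \<in> (V i)\<^sup>\<bottom> \<Longrightarrow> R1 *v y = y" "\<And>y. y \<in> V i \<Longrightarrow> R1 *v y \<in> V i"
      using householder[OF V in_V in_V norms(1)] by blast
    obtain R2 where R2: "orthogonal_matrix R2" "R2 *v (x $ i - ?p (x $ i)) = x' $ i - ?p (x' $ i)"
      "\<And>y. y \<in> V i \<Longrightarrow> R2 *v y = y" "\<And>y. y \<in> (V i)\<^sup>\<bottom> \<Longrightarrow> R2 *v y \<in> (V i)\<^sup>\<bottom>"
      using householder[OF subspace_orthogonal_comp in_V' in_V' norms(2)] orthogonal_comp_self[OF V] by metis
    have R: "(R1 ** R2) *v y = R1 *v ?p y + R2 *v (y - ?p y)" for y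
    proof -
      have "(R1 ** R2) *v y = R1 *v (R2 *v (?p y + (y - ?p y)))"
        by (simp add: matrix_vector_mul_assoc)
      also have "\<dots> = R1 *v (R2 *v ?p y) + R1 *v (R2 *v (y - ?p y))"
        by (simp only: matrix_vector_right_distrib)
      also have "\<dots> = R1 *v ?p y + R2 *v (y - ?p y)"
        using R2(3)[OF in_V] R1(3)[OF R2(4)[OF in_V']] by simp
      finally show ?thesis .
    qed
    have p: "?p ((R1 ** R2) *v y) = R1 *v ?p y" for y
      unfolding R using R1(4)[OF in_V] R2(4)[OF in_V'] by (intro orth_proj_eqI[OF V]) auto
    have "(R1 ** R2) *v ?p y = R1 *v ?p y" for y
      using R2(3)[OF in_V, of y] by (simp add: matrix_vector_mul_assoc[symmetric])
    moreover have "(R1 ** R2) *v (x $ i) = x' $ i"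
      unfolding R R1(2) R2(2) by simp
    ultimately show ?thesis
      using R1(1) R2(1) p by (intro exI[of _ "R1 ** R2"]) (simp add: orthogonal_matrix_mul)
  qed
  then obtain f where f: "\<And>i. orthogonal_matrix (f i)" "\<And>i y. orth_proj (V i) (f i *v y) = f i *v orth_proj (V i) y"
      "\<And>i. f i *v (x $ i) = x' $ i"
    by metis
  show thesis
  proof
    show "block_stabilises V (\<chi> i. f i)"
      using f by (simp add: block_stabilises_def block_orthogonal_def)
    show "block_apply (\<chi> i. f i) x = x'" using f by (simp add: vec_eq_iff)
  qed
qed

text \<open>Vectors with components of length one, except for components that lie in a zero space and
  hence vanish. These are the values of \<open>normalise V\<close> up to null sets.\<close>

definition unit_blocks :: "('m \<Rightarrow> (real^'d) set) \<Rightarrow> (real^'d^'m::finite) set" where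
  "unit_blocks V = {x. \<forall>i. norm (orth_proj (V i) (x $ i)) = (if V i = {0} then 0 else 1) \<and>
     norm (x $ i - orth_proj (V i) (x $ i)) = (if V i = UNIV then 0 else 1)}"

lemma unit_blocks_borel:
  assumes V: "\<And>i. subspace (V i)"
  shows "unit_blocks V \<in> sets borel"
proof -
  have c: "continuous_on UNIV (\<lambda>x. orth_proj (V i) (x $ i))" for i
    by (rule continuous_on_compose2[OF continuous_on_linear[OF linear_orth_proj[OF V]]])
      (auto intro: continuous_intros)
  have "closed (unit_blocks V)"
    unfolding unit_blocks_def
    by (intro closed_Collect_all closed_Collect_conj closed_Collect_eq continuous_intros c)
  then show ?thesis by simp
qed

lemma AE_normalise_unit_blocks:
  fixes V :: "'m::finite \<Rightarrow> (real^'d) set"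
  assumes V: "\<And>i. subspace (V i)"
    and proper: "\<And>W. subspace W \<Longrightarrow> W \<noteq> UNIV \<Longrightarrow> AE \<omega> in M. f \<omega> \<notin> W"
  shows "AE \<omega> in M. normalise V (f \<omega>) \<in> unit_blocks V"
proof -
  have lin: "linear (\<lambda>z. orth_proj (V i) (z $ i))" "linear (\<lambda>z. z $ i - orth_proj (V i) (z $ i))" for i
    by (auto intro!: linearI simp: linear_add[OF linear_orth_proj[OF V]] linear_cmul[OF linear_orth_proj[OF V]] scaleR_diff_right)
  have 1: "AE \<omega> in M. V i \<noteq> {0} \<longrightarrow> orth_proj (V i) (f \<omega> $ i) \<noteq> 0" for i
  proof (cases "V i = {0}")
    case False
    then obtain x where x: "x \<in> V i" "x \<noteq> 0" using subspace_0[OF V, of i] by auto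
    have "orth_proj (V i) (axis i x $ i) = x"
      using x V by (intro orth_proj_eqI) (auto simp: axis_def subspace_0[OF subspace_orthogonal_comp])
    then have "axis i x \<notin> {z. orth_proj (V i) (z $ i) = 0}" using x(2) by simp
    then have "{z. orth_proj (V i) (z $ i) = 0} \<noteq> UNIV" by blast
    moreover have "subspace {z. orth_proj (V i) (z $ i) = 0}"
      using subspace_kernel[OF lin(1)] by (simp add: vimage_def)
    ultimately show ?thesis using proper by fastforce
  qed simp
  have 2: "AE \<omega> in M. V i \<noteq> UNIV \<longrightarrow> f \<omega> $ i - orth_proj (V i) (f \<omega> $ i) \<noteq> 0" for i
  proof (cases "V i = UNIV")
    case False
    then obtain x where x: "x \<notin> V i" by auto
    have "axis i x $ i - orth_proj (V i) (axis i x $ i) \<noteq> 0"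
      using x orth_proj_in[OF V, of i x] by (auto simp: axis_def)
    then have "axis i x \<notin> {z. z $ i - orth_proj (V i) (z $ i) = 0}" by simp
    then have "{z. z $ i - orth_proj (V i) (z $ i) = 0} \<noteq> UNIV" by blast
    moreover have "subspace {z. z $ i - orth_proj (V i) (z $ i) = 0}"
      using subspace_kernel[OF lin(2)] by (simp add: vimage_def)
    ultimately show ?thesis using proper by fastforce
  qed simp
  have "AE \<omega> in M. \<forall>i\<in>UNIV. (V i \<noteq> {0} \<longrightarrow> orth_proj (V i) (f \<omega> $ i) \<noteq> 0) \<and>
      (V i \<noteq> UNIV \<longrightarrow> f \<omega> $ i - orth_proj (V i) (f \<omega> $ i) \<noteq> 0)"
    by (intro AE_finite_allI) (use 1 2 in auto)
  then show ?thesis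
  proof eventually_elim
    fix \<omega> assume a: "\<forall>i\<in>UNIV. (V i \<noteq> {0} \<longrightarrow> orth_proj (V i) (f \<omega> $ i) \<noteq> 0) \<and>
      (V i \<noteq> UNIV \<longrightarrow> f \<omega> $ i - orth_proj (V i) (f \<omega> $ i) \<noteq> 0)"
    have p: "norm (sgn (orth_proj (V i) (f \<omega> $ i))) = (if V i = {0} then 0 else 1)" for i
    proof (cases "V i = {0}")
      case True
      then have "orth_proj (V i) (f \<omega> $ i) = 0" using orth_proj_in[OF V, of i "f \<omega> $ i"] by simp
      then show ?thesis using True by (simp only: sgn_zero norm_zero if_True simp_thms)
    qed (use a in \<open>simp add: norm_sgn\<close>)
    have n: "norm (sgn (f \<omega> $ i - orth_proj (V i) (f \<omega> $ i))) = (if V i = UNIV then 0 else 1)" for i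
    proof (cases "V i = UNIV")
      case True
      then have "f \<omega> $ i - orth_proj (V i) (f \<omega> $ i) = 0"
        using orth_proj_diff[OF V, of "f \<omega> $ i" i] by (metis orthogonal_comp_UNIV singletonD)
      then show ?thesis using True by (simp only: sgn_zero norm_zero if_True simp_thms)
    qed (use a in \<open>simp add: norm_sgn\<close>)
    show "normalise V (f \<omega>) \<in> unit_blocks V"
      unfolding unit_blocks_def mem_Collect_eq diff_orth_proj_normalise[where V=V, OF V]
      unfolding orth_proj_normalise[where V=V, OF V] using p n by blast
  qed
qed

text \<open>Each of the two laws gives the same mass to all balls of equal radius with centres in
  \<open>unit_blocks V\<close>, since the stabiliser acts on this set transitively and by isometries.\<close>

lemma normalised_law_unique:
  fixes V :: "'m::finite \<Rightarrow> (real^'d) set" and \<nu> :: "(real^'d^'m) measure"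
  assumes V: "\<And>i. subspace (V i)" and \<nu>: "prob_space \<nu>" "sets \<nu> = sets borel" "AE x in \<nu>. x \<in> unit_blocks V"
    and inv: "\<And>r x \<epsilon>. block_stabilises V r \<Longrightarrow> emeasure \<nu> (ball (block_apply r x) \<epsilon>) = emeasure \<nu> (ball x \<epsilon>)"
  shows "\<nu> = distr gauss borel (normalise V)"
proof (rule prob_measure_eqI_uniform[where X="unit_blocks V"])
  note [measurable] = normalise_measurable[where V=V, OF V]
  show "prob_space (distr gauss borel (normalise V))"
    by (intro prob_space.prob_space_distr prob_space_gauss) measurable
  show "AE x in distr gauss borel (normalise V). x \<in> unit_blocks V"
  proof (subst AE_distr_iff)
    show "AE x in gauss. normalise V x \<in> unit_blocks V"
      by (intro AE_normalise_unit_blocks V) (auto intro: AE_not_in gauss_proper_subspace_null)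
  qed (use unit_blocks_borel[where V=V, OF V] in \<open>auto simp: pred_def\<close>)
  have transfer: "emeasure \<mu> (ball x \<epsilon>) = emeasure \<mu> (ball y \<epsilon>)"
    if xy: "x \<in> unit_blocks V" "y \<in> unit_blocks V"
      and inv: "\<And>r x. block_stabilises V r \<Longrightarrow> emeasure \<mu> (ball (block_apply r x) \<epsilon>) = emeasure \<mu> (ball x \<epsilon>)"
    for x y \<epsilon> and \<mu> :: "(real^'d^'m) measure"
  proof -
    obtain r where "block_stabilises V r" "block_apply r x = y"
      using xy by (elim block_stabilises_transitive[where V=V, OF V, rotated 2]) (auto simp: unit_blocks_def)
    then show ?thesis using inv by metis
  qed
  show "emeasure \<nu> (ball x \<epsilon>) = emeasure \<nu> (ball y \<epsilon>)"
    if "x \<in> unit_blocks V" "y \<in> unit_blocks V" for x y \<epsilon>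
    using that inv by (rule transfer)
  have gauss_inv: "emeasure (distr gauss borel (normalise V)) (ball (block_apply r x) \<epsilon>) =
      emeasure (distr gauss borel (normalise V)) (ball x \<epsilon>)" if r: "block_stabilises V r" for r x \<epsilon>
  proof -
    have ot: "orthogonal_transformation (block_apply r)"
      by (rule block_orthogonal_transformation[OF stabilises_orthogonal[where V=V, OF V r]])
    have [measurable]: "block_apply r \<in> borel_measurable borel"
      by (intro borel_measurable_linear linear_block_apply)
    have "emeasure (distr gauss borel (normalise V)) (ball (block_apply r x) \<epsilon>) =
        emeasure (distr gauss borel (block_apply r)) (normalise V -` ball (block_apply r x) \<epsilon>)"
      unfolding distr_gauss_orthogonal_transformation[OF ot] by (subst emeasure_distr) auto
    also have "\<dots> = emeasure gauss (block_apply r -` (normalise V -` ball (block_apply r x) \<epsilon>))"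
      by (subst emeasure_distr) (use measurable_sets_borel[OF normalise_measurable[where V=V, OF V]] in auto)
    also have "block_apply r -` (normalise V -` ball (block_apply r x) \<epsilon>) = normalise V -` ball x \<epsilon>"
      by (auto simp: normalise_block_apply[where V=V, OF V r] dist_norm linear_diff[OF linear_block_apply, symmetric]
          orthogonal_transformation_norm[OF ot])
    also have "emeasure gauss (normalise V -` ball x \<epsilon>) = emeasure (distr gauss borel (normalise V)) (ball x \<epsilon>)"
      by (subst emeasure_distr) auto
    finally show ?thesis .
  qed
  show "emeasure (distr gauss borel (normalise V)) (ball x \<epsilon>) = emeasure (distr gauss borel (normalise V)) (ball y \<epsilon>)"
    if "x \<in> unit_blocks V" "y \<in> unit_blocks V" for x y \<epsilon>
    using that gauss_inv by (rule transfer)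
qed (use \<nu> in auto)

section \<open>The law of the solution\<close>

lemma closed_solves:
  assumes L: "subspace L"
  shows "closed {p. solves T L (fst (snd p)) (fst (snd (snd p))) (snd (snd (snd p))) (fst p)}"
proof -
  have c: "continuous_on UNIV (\<lambda>x. orth_proj L (fst x))"
    by (rule continuous_on_compose2[OF continuous_on_linear[OF linear_orth_proj[OF L]]])
      (auto intro: continuous_intros)
  have "closed ((\<lambda>p. block_apply (fst (snd p)) (fst p) - snd (snd (snd p))) -` ((block_sum T -` {0})\<^sup>\<bottom>))"
    by (rule closed_vimage[OF closed_subspace[OF subspace_orthogonal_comp]])
      (intro continuous_intros continuous_block_apply)
  moreover have "closed {p. block_sum T (block_apply (fst (snd p)) (orth_proj L (fst p))) = fst (snd (snd p))}"
    by (intro closed_Collect_eq continuous_block_sum continuous_block_apply continuous_intros c)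
  ultimately have "closed ({p. block_sum T (block_apply (fst (snd p)) (orth_proj L (fst p))) = fst (snd (snd p))} \<inter>
      (\<lambda>p. block_apply (fst (snd p)) (fst p) - snd (snd (snd p))) -` ((block_sum T -` {0})\<^sup>\<bottom>))"
    by (rule closed_Int[rotated])
  then show ?thesis by (simp add: solves_def Collect_conj_eq vimage_def)
qed

lemma solves_in_borel:
  assumes L: "subspace L" and K: "closed K"
  shows "{\<omega>. \<exists>z\<in>K. solves_at T L \<omega> z} \<in> sets borel"
proof -
  have "closed (fst -` K \<inter> {p. solves T L (fst (snd p)) (fst (snd (snd p))) (snd (snd (snd p))) (fst p)})"
    by (intro closed_Int closed_vimage K closed_solves L continuous_intros)
  from borel_projection_closed[OF this] show ?thesis by (simp add: Bex_def)
qed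

lemma closed_block_orthogonal: "closed {q :: real^'d^'d^'m::finite. block_orthogonal q}"
proof -
  have "closed {q :: real^'d^'d^'m. \<forall>i. transpose (q $ i) ** q $ i = mat 1 \<and> q $ i ** transpose (q $ i) = mat 1}"
    unfolding transpose_def matrix_matrix_mult_def
    by (intro closed_Collect_all closed_Collect_conj closed_Collect_eq continuous_intros)
  then show ?thesis by (simp add: block_orthogonal_def orthogonal_matrix_def)
qed

definition nondegenerate where
  "nondegenerate T L q \<longleftrightarrow> block_orthogonal q \<and> block_map T q ` L = UNIV"

text \<open>The value \<open>0\<close> at degenerate arguments makes the function equivariant everywhere, not only
  almost everywhere.\<close>

definition solution where
  "solution T L \<omega> = (if nondegenerate T L (fst \<omega>)
     then THE z. solves_at T L \<omega> z else 0)"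

lemma solves_iff_solution:
  assumes "subspace L" "nondegenerate T L (fst \<omega>)"
  shows "solves_at T L \<omega> z \<longleftrightarrow> z = solution T L \<omega>"
proof -
  have q: "block_orthogonal (fst \<omega>)" "block_map T (fst \<omega>) ` L = UNIV"
    using assms(2) by (auto simp: nondegenerate_def)
  have "\<exists>!z. solves_at T L \<omega> z"
    using solves_exists[OF q(1) assms(1) q(2)] solves_unique[OF q(1) assms(1) q(2)] by blast
  from theI'[OF this] this show ?thesis using assms(2) by (auto simp: solution_def)
qed

lemma nondegenerate_borel:
  fixes T :: "'m::finite \<Rightarrow> real^'d^'d"
  assumes L: "subspace L"
  shows "{\<omega> :: (real^'d^'d^'m) \<times> 'b::euclidean_space. nondegenerate T L (fst \<omega>)} \<in> sets borel"
proof -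
  have "{\<omega> :: (real^'d^'d^'m) \<times> 'b. block_orthogonal (fst \<omega>)} \<in> sets borel"
    using borel_closed[OF closed_vimage[OF closed_block_orthogonal continuous_on_fst[OF continuous_on_id]]]
    unfolding vimage_def mem_Collect_eq .
  moreover have "{\<omega> :: (real^'d^'d^'m) \<times> 'b. block_map T (fst \<omega>) ` L = UNIV} \<in> sets borel"
    by (intro image_eq_UNIV_borel L continuous_intros)
  ultimately show ?thesis unfolding nondegenerate_def by (simp add: Collect_conj_eq sets.Int)
qed

text \<open>The preimage of a compact set is, on the nondegenerate part, the projection of a closed set.\<close>

lemma solution_measurable:
  fixes T :: "'m::finite \<Rightarrow> real^'d^'d"
  assumes L: "subspace L"
  shows "solution T L \<in> borel_measurable borel"
proof (rule borel_measurableI)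
  fix U :: "(real^'d^'m) set" assume "open U"
  then obtain C :: "nat \<Rightarrow> (real^'d^'m) set" where C: "\<And>n. compact (C n)" "\<Union>(range C) = U"
    using open_Union_compact_subsets[of U] by metis
  let ?G = "{\<omega>. nondegenerate T L (fst \<omega>)}"
  have "solution T L -` U =
      (?G \<inter> (\<Union>n. {\<omega>. \<exists>z\<in>C n. solves_at T L \<omega> z})) \<union>
      ((- ?G) \<inter> (if 0 \<in> U then UNIV else {}))"
  proof (intro set_eqI)
    fix \<omega>
    show "\<omega> \<in> solution T L -` U \<longleftrightarrow> \<omega> \<in> (?G \<inter> (\<Union>n. {\<omega>. \<exists>z\<in>C n. solves_at T L \<omega> z})) \<union>
      ((- ?G) \<inter> (if 0 \<in> U then UNIV else {}))"
    proof (cases "nondegenerate T L (fst \<omega>)")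
      case True
      then show ?thesis using C(2) by (auto simp: solves_iff_solution[OF L True])
    next
      case False
      then show ?thesis by (simp add: solution_def)
    qed
  qed
  also have "\<dots> \<in> sets borel"
    using C(1) by (intro sets.Un sets.Int sets.countable_UN solves_in_borel L nondegenerate_borel)
      (auto intro: compact_imp_closed solves_in_borel L nondegenerate_borel borel_comp)
  finally show "solution T L -` U \<inter> space borel \<in> sets borel" by simp
qed

lemma solution_equivariant:
  assumes V: "\<And>i. subspace (V i)" and r: "block_stabilises V r"
  shows "solution T (cone_product V) (q, p) =
    block_apply r (solution T (cone_product V) (block_mult q r, p))"
proof -
  let ?L = "cone_product V"
  have L: "subspace ?L" using V by (rule subspace_cone_product)
  note ro = stabilises_orthogonal[where V=V, OF V r]
  have oq: "block_orthogonal (block_mult q r) \<longleftrightarrow> block_orthogonal q"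
  proof -
    have "orthogonal_matrix (q $ i ** r $ i) \<longleftrightarrow> orthogonal_matrix (q $ i)" for i
    proof
      assume o: "orthogonal_matrix (q $ i ** r $ i)"
      have ri: "orthogonal_matrix (r $ i)" using ro by (simp add: block_orthogonal_def)
      then have "orthogonal_matrix ((q $ i ** r $ i) ** transpose (r $ i))"
        using o by (simp add: orthogonal_matrix_mul orthogonal_matrix_transpose)
      also have "(q $ i ** r $ i) ** transpose (r $ i) = q $ i"
        using ri by (simp add: matrix_mul_assoc[symmetric] orthogonal_matrix_def)
      finally show "orthogonal_matrix (q $ i)" .
    next
      assume "orthogonal_matrix (q $ i)"
      then show "orthogonal_matrix (q $ i ** r $ i)"
        using ro by (simp add: block_orthogonal_def orthogonal_matrix_mul)
    qed
    then show ?thesis by (simp add: block_orthogonal_def block_mult_def)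
  qed
  have im: "block_map T (block_mult q r) ` ?L = block_map T q ` ?L"
  proof -
    have "block_map T (block_mult q r) ` ?L =
        block_map T q ` (block_apply r ` ?L)"
      by (simp add: image_image block_apply_mult)
    then show ?thesis by (simp add: block_apply_image_cone_product[where V=V, OF V r])
  qed
  have nd: "nondegenerate T ?L (block_mult q r) \<longleftrightarrow> nondegenerate T ?L q"
    unfolding nondegenerate_def oq im ..
  show ?thesis
  proof (cases "nondegenerate T ?L q")
    case True
    define z where "z = solution T ?L (block_mult q r, p)"
    have "solves T ?L (block_mult q r) (fst p) (snd p) z"
      using solves_iff_solution[OF L, of T "(block_mult q r, p)" z] True nd by (simp add: z_def)
    then have "solves T ?L q (fst p) (snd p) (block_apply r z)"
      by (simp add: solves_def block_apply_mult orth_proj_block_apply[where V=V, OF V r])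
    then show ?thesis
      using solves_iff_solution[OF L, of T "(q, p)" "block_apply r z"] True by (simp add: z_def)
  next
    case False
    then show ?thesis using nd by (simp add: solution_def linear_0[OF linear_block_apply])
  qed
qed

context block_haar begin

definition \<Gamma> :: "((real^'d) \<times> (real^'d^'m)) measure" where
  "\<Gamma> = gauss \<Otimes>\<^sub>M gauss"

lemma prob_space_\<Gamma>: "prob_space \<Gamma>"
  unfolding \<Gamma>_def by (intro prob_space_pair prob_space_gauss)

lemma sets_\<Gamma>: "sets \<Gamma> = sets borel"
proof -
  have "sets \<Gamma> = sets ((borel :: (real^'d) measure) \<Otimes>\<^sub>M (borel :: (real^'d^'m) measure))"
    unfolding \<Gamma>_def by (rule sets_pair_measure_cong) simp_all
  then show ?thesis unfolding borel_prod .
qed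

lemma sets_\<rho>\<Gamma>: "sets (\<rho> \<Otimes>\<^sub>M \<Gamma>) = sets borel"
  using sets_pair_measure_cong[OF sets_\<rho> sets_\<Gamma>] unfolding borel_prod .

lemma space_\<rho>\<Gamma>: "space (\<rho> \<Otimes>\<^sub>M \<Gamma>) = UNIV"
  using sets_eq_imp_space_eq[OF sets_\<rho>\<Gamma>] by simp

lemma emeasure_\<rho>\<Gamma>_invariant:
  assumes r: "block_orthogonal r" and S: "S \<in> sets borel"
  shows "emeasure (\<rho> \<Otimes>\<^sub>M \<Gamma>) {\<omega>. (block_mult (fst \<omega>) r, snd \<omega>) \<in> S} = emeasure (\<rho> \<Otimes>\<^sub>M \<Gamma>) S"
proof -
  interpret G: prob_space \<Gamma> by (rule prob_space_\<Gamma>)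
  interpret P: pair_sigma_finite \<rho> \<Gamma> ..
  have cont: "continuous_on UNIV (\<lambda>\<omega>. (block_mult (fst \<omega>) r, snd \<omega>))"
    by (intro continuous_intros continuous_block_mult)
  have S': "{\<omega>. (block_mult (fst \<omega>) r, snd \<omega>) \<in> S} \<in> sets borel"
    using measurable_sets_borel[OF borel_measurable_continuous_onI[OF cont] S] by (simp add: vimage_def)
  have slice: "{q. (q, p) \<in> S} \<in> sets borel" for p
  proof -
    have "(\<lambda>q. (q, p)) \<in> borel_measurable borel"
      by (intro borel_measurable_continuous_onI continuous_intros)
    from measurable_sets_borel[OF this S] show ?thesis by (simp add: vimage_def)
  qed
  have "emeasure (\<rho> \<Otimes>\<^sub>M \<Gamma>) {\<omega>. (block_mult (fst \<omega>) r, snd \<omega>) \<in> S} =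
      (\<integral>\<^sup>+p. emeasure \<rho> ((\<lambda>q. (q, p)) -` {\<omega>. (block_mult (fst \<omega>) r, snd \<omega>) \<in> S}) \<partial>\<Gamma>)"
    by (rule P.emeasure_pair_measure_alt2) (use S' sets_\<rho>\<Gamma> in blast)
  also have "\<dots> = (\<integral>\<^sup>+p. emeasure \<rho> ((\<lambda>q. (q, p)) -` S) \<partial>\<Gamma>)"
    using emeasure_invariant[OF r slice] by (simp add: vimage_def)
  also have "\<dots> = emeasure (\<rho> \<Otimes>\<^sub>M \<Gamma>) S"
    by (rule P.emeasure_pair_measure_alt2[symmetric]) (use S sets_\<rho>\<Gamma> in blast)
  finally show ?thesis .
qed

lemma AE_\<rho>\<Gamma>:
  assumes "{\<omega>. P \<omega>} \<in> sets borel" and "AE q in \<rho>. AE p in \<Gamma>. P (q, p)"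
  shows "AE \<omega> in \<rho> \<Otimes>\<^sub>M \<Gamma>. P \<omega>"
proof -
  interpret G: prob_space \<Gamma> by (rule prob_space_\<Gamma>)
  interpret P: pair_sigma_finite \<rho> \<Gamma> ..
  show ?thesis
    by (rule P.AE_pair_measure) (use assms sets_\<rho>\<Gamma> space_\<rho>\<Gamma> in auto)
qed

text \<open>The law of the solution is invariant under the stabiliser of \<open>V\<close>, so after normalisation it
  agrees with the law of a normalised Gaussian vector, and the set \<open>S\<close> cannot distinguish a
  vector from its normalisation.\<close>

lemma emeasure_solves:
  assumes V: "\<And>i. subspace (V i)"
    and onto: "AE q in \<rho>. block_map T q ` cone_product V = UNIV"
    and S: "closed S" "\<And>z. normalise V z \<in> S \<longleftrightarrow> z \<in> S"
  shows "emeasure (\<rho> \<Otimes>\<^sub>M \<Gamma>) {\<omega>. \<exists>z\<in>S. solves_at T (cone_product V) \<omega> z} =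
    emeasure gauss S"
proof -
  interpret G: prob_space \<Gamma> by (rule prob_space_\<Gamma>)
  interpret P: pair_prob_space \<rho> \<Gamma> ..
  let ?L = "cone_product V"
  have L: "subspace ?L" using V by (rule subspace_cone_product)
  have meas_cong: "f \<in> borel_measurable (\<rho> \<Otimes>\<^sub>M \<Gamma>) \<longleftrightarrow> f \<in> borel_measurable borel"
    for f :: "_ \<Rightarrow> real^'d^'m"
    using measurable_cong_sets[OF sets_\<rho>\<Gamma> refl] by blast
  have nondeg_q: "AE q in \<rho>. nondegenerate T ?L q"
    using onto orthogonal by eventually_elim (simp add: nondegenerate_def)
  have nondeg: "AE \<omega> in \<rho> \<Otimes>\<^sub>M \<Gamma>. nondegenerate T ?L (fst \<omega>)"
    using nondeg_q by (intro AE_\<rho>\<Gamma> nondegenerate_borel L) (auto elim: eventually_mono)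
  note sol_m = solution_measurable[OF L, of T] and norm_m = normalise_measurable[where V=V, OF V]
  define f :: "(real^'d^'d^'m) \<times> (real^'d) \<times> (real^'d^'m) \<Rightarrow> real^'d^'m"
    where "f \<omega> = normalise V (solution T ?L \<omega>)" for \<omega>
  have f_m: "f \<in> borel_measurable borel"
    unfolding f_def by (rule measurable_compose[OF sol_m norm_m])
  then have f_m': "f \<in> borel_measurable (\<rho> \<Otimes>\<^sub>M \<Gamma>)" by (simp add: meas_cong)
  define \<nu> where "\<nu> = distr (\<rho> \<Otimes>\<^sub>M \<Gamma>) borel f"
  have \<nu>: "emeasure \<nu> B = emeasure (\<rho> \<Otimes>\<^sub>M \<Gamma>) {\<omega>. f \<omega> \<in> B}" if "B \<in> sets borel" for B
    unfolding \<nu>_def using f_m' that by (simp add: emeasure_distr space_\<rho>\<Gamma> vimage_def)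
  have \<nu>_eq: "\<nu> = distr gauss borel (normalise V)"
  proof (rule normalised_law_unique[where V=V, OF V])
    show "prob_space \<nu>" unfolding \<nu>_def by (rule P.prob_space_distr[OF f_m'])
    show "sets \<nu> = sets borel" by (simp add: \<nu>_def)
    have "AE \<omega> in \<rho> \<Otimes>\<^sub>M \<Gamma>. f \<omega> \<in> unit_blocks V"
    proof (rule AE_\<rho>\<Gamma>)
      show "{\<omega>. f \<omega> \<in> unit_blocks V} \<in> sets borel"
        using measurable_sets_borel[OF f_m unit_blocks_borel[where V=V, OF V]] by (simp add: vimage_def)
      show "AE q in \<rho>. AE p in \<Gamma>. f (q, p) \<in> unit_blocks V"
        using nondeg_q
      proof eventually_elim
        fix q assume q: "nondegenerate T ?L q"
        have "AE p in \<Gamma>. solution T ?L (q, p) \<notin> W" if W: "subspace W" "W \<noteq> UNIV" for W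
        proof -
          have "AE p in \<Gamma>. \<not> (\<exists>z\<in>W. solves T ?L q (fst p) (snd p) z)"
            unfolding \<Gamma>_def using q W by (intro solves_null L) (auto simp: nondegenerate_def)
          then show ?thesis
            by eventually_elim (use solves_iff_solution[OF L, of T "(q, _)"] q in auto)
        qed
        then show "AE p in \<Gamma>. f (q, p) \<in> unit_blocks V"
          unfolding f_def by (intro AE_normalise_unit_blocks V)
      qed
    qed
    then show "AE x in \<nu>. x \<in> unit_blocks V"
      unfolding \<nu>_def using f_m' unit_blocks_borel[where V=V, OF V]
      by (subst AE_distr_iff) (auto simp: pred_def)
    show "emeasure \<nu> (ball (block_apply r x) \<epsilon>) = emeasure \<nu> (ball x \<epsilon>)"
      if r: "block_stabilises V r" for r x \<epsilon>
    proof -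
      have ot: "orthogonal_transformation (block_apply r)"
        by (rule block_orthogonal_transformation[OF stabilises_orthogonal[where V=V, OF V r]])
      have fr: "f (q, p) = block_apply r (f (block_mult q r, p))" for q p
        unfolding f_def solution_equivariant[where V=V, OF V r, of T q p]
        by (rule normalise_block_apply[where V=V, OF V r])
      have B: "{\<omega>. f \<omega> \<in> ball x \<epsilon>} \<in> sets borel"
        using measurable_sets_borel[OF f_m, of "ball x \<epsilon>"] by (simp add: vimage_def)
      have "f \<omega> \<in> ball (block_apply r x) \<epsilon> \<longleftrightarrow> f (block_mult (fst \<omega>) r, snd \<omega>) \<in> ball x \<epsilon>" for \<omega>
        using fr[of "fst \<omega>" "snd \<omega>"]
        by (simp add: dist_norm linear_diff[OF linear_block_apply, symmetric] orthogonal_transformation_norm[OF ot])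
      then have "emeasure \<nu> (ball (block_apply r x) \<epsilon>) =
          emeasure (\<rho> \<Otimes>\<^sub>M \<Gamma>) {\<omega>. (block_mult (fst \<omega>) r, snd \<omega>) \<in> {\<omega>. f \<omega> \<in> ball x \<epsilon>}}"
        by (simp add: \<nu>)
      also have "\<dots> = emeasure \<nu> (ball x \<epsilon>)"
        using emeasure_\<rho>\<Gamma>_invariant[OF stabilises_orthogonal[where V=V, OF V r] B] by (simp add: \<nu>)
      finally show ?thesis .
    qed
  qed
  have Sb: "S \<in> sets borel" using S(1) by simp
  have "emeasure (\<rho> \<Otimes>\<^sub>M \<Gamma>) {\<omega>. \<exists>z\<in>S. solves_at T ?L \<omega> z} =
      emeasure (\<rho> \<Otimes>\<^sub>M \<Gamma>) {\<omega>. f \<omega> \<in> S}"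
  proof (rule emeasure_eq_AE)
    show "AE \<omega> in \<rho> \<Otimes>\<^sub>M \<Gamma>. (\<omega> \<in> {\<omega>. \<exists>z\<in>S. solves_at T ?L \<omega> z}) \<longleftrightarrow> (\<omega> \<in> {\<omega>. f \<omega> \<in> S})"
      using nondeg
    proof eventually_elim
      fix \<omega> :: "(real^'d^'d^'m) \<times> (real^'d) \<times> (real^'d^'m)" assume "nondegenerate T ?L (fst \<omega>)"
      then show "(\<omega> \<in> {\<omega>. \<exists>z\<in>S. solves_at T ?L \<omega> z}) \<longleftrightarrow> (\<omega> \<in> {\<omega>. f \<omega> \<in> S})"
        by (simp add: solves_iff_solution[OF L] f_def S(2))
    qed
    show "{\<omega>. \<exists>z\<in>S. solves_at T ?L \<omega> z} \<in> sets (\<rho> \<Otimes>\<^sub>M \<Gamma>)"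
      unfolding sets_\<rho>\<Gamma> by (rule solves_in_borel[OF L S(1)])
    show "{\<omega>. f \<omega> \<in> S} \<in> sets (\<rho> \<Otimes>\<^sub>M \<Gamma>)"
      unfolding sets_\<rho>\<Gamma> using measurable_sets_borel[OF f_m Sb] by (simp add: vimage_def)
  qed
  also have "\<dots> = emeasure \<nu> S" by (rule \<nu>[OF Sb, symmetric])
  also have "\<dots> = emeasure gauss (normalise V -` S)"
    unfolding \<nu>_eq using norm_m Sb by (subst emeasure_distr) auto
  also have "normalise V -` S = S" using S(2) by auto
  finally show ?thesis .
qed

end

section \<open>The expected Gaussian measure of a random linear image of a product of cones\<close>

lemma inner_blocks: "(x :: real^'d^'m) \<bullet> z = (\<Sum>i\<in>UNIV. x $ i \<bullet> z $ i)"
  by (rule inner_vec_def)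

lemma polar_cone_product:
  fixes C :: "'m::finite \<Rightarrow> (real^'d) set"
  assumes "\<And>i. 0 \<in> C i"
  shows "polar (cone_product C) = cone_product (\<lambda>i. polar (C i))"
proof
  show "cone_product (\<lambda>i. polar (C i)) \<subseteq> polar (cone_product C)"
    unfolding polar_def cone_product_def mem_Collect_eq subset_iff inner_blocks by (blast intro: sum_nonpos)
  show "polar (cone_product C) \<subseteq> cone_product (\<lambda>i. polar (C i))"
  proof
    fix z assume z: "z \<in> polar (cone_product C)"
    have "x \<bullet> z $ i \<le> 0" if "x \<in> C i" for i x
    proof -
      have "axis i x \<in> cone_product C" using that assms by (simp add: cone_product_def axis_def)
      then have "axis i x \<bullet> z \<le> 0" using z by (intro polar_inner_le)
      then show ?thesis by (simp add: inner_axis')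
    qed
    then show "z \<in> cone_product (\<lambda>i. polar (C i))" by (simp add: cone_product_def polar_def)
  qed
qed

lemma mem_biconic_cone_product:
  assumes "\<And>i. subspace (V i)"
  shows "z \<in> biconic (cone_product V) (cone_product C) (cone_product D) \<longleftrightarrow> (\<forall>i. z $ i \<in> biconic (V i) (C i) (D i))"
  unfolding biconic_def mem_Collect_eq orth_proj_cone_product[where V=V, OF assms]
  by (auto simp: cone_product_def)

lemma sgn_mem_convex_cone:
  fixes K :: "'a::real_normed_vector set"
  assumes "convex_cone K"
  shows "sgn x \<in> K \<longleftrightarrow> x \<in> K"
proof
  assume "sgn x \<in> K"
  then have "norm x *\<^sub>R sgn x \<in> K" using assms by (intro convex_cone_scaleR) auto
  then show "x \<in> K" using convex_cone_contains_0[OF assms] by (cases "x = 0") (simp_all add: sgn_div_norm)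
next
  assume "x \<in> K"
  then show "sgn x \<in> K" unfolding sgn_div_norm using assms by (intro convex_cone_scaleR) auto
qed

lemma normalise_mem_biconic:
  assumes V: "\<And>i. subspace (V i)" and C: "\<And>i. convex_cone (C i)" and D: "\<And>i. convex_cone (D i)"
  shows "normalise V z \<in> biconic (cone_product V) (cone_product C) (cone_product D) \<longleftrightarrow>
    z \<in> biconic (cone_product V) (cone_product C) (cone_product D)"
  unfolding mem_biconic_cone_product[where V=V, OF V]
  unfolding biconic_def mem_Collect_eq diff_orth_proj_normalise[where V=V, OF V]
  unfolding orth_proj_normalise[where V=V, OF V]
  using sgn_mem_convex_cone[OF C] sgn_mem_convex_cone[OF D] by blast

lemma closed_biconic:
  assumes "subspace L" "closed C" "closed D"
  shows "closed (biconic L C D)"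
proof -
  have c: "continuous_on UNIV (orth_proj L)"
    using assms(1) by (intro continuous_on_linear linear_orth_proj)
  have "closed (orth_proj L -` C \<inter> (\<lambda>z. z - orth_proj L z) -` D)"
    using assms by (intro closed_Int closed_vimage c continuous_intros)
  then show ?thesis by (simp add: biconic_def vimage_def Collect_conj_eq)
qed

lemma cone_product_eq_polar:
  fixes A :: "'m::finite \<Rightarrow> (real^'d) set"
  shows "cone_product (\<lambda>i. polar (A i)) = polar (\<Union>i. axis i ` A i)"
  by (auto simp: cone_product_def polar_def inner_axis')

lemma polyhedral_cone_product:
  fixes C :: "'m::finite \<Rightarrow> (real^'d) set"
  assumes "\<And>i. polyhedral_cone (C i)"
  shows "polyhedral_cone (cone_product C)"
proof -
  from assms obtain A where A: "\<And>i. finite (A i)" "\<And>i. C i = polar (A i)"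
    unfolding polyhedral_cone_iff_polar by metis
  then have "C = (\<lambda>i. polar (A i))" by auto
  then have "cone_product C = polar (\<Union>i. axis i ` A i)" by (simp only: cone_product_eq_polar)
  moreover have "finite (\<Union>i. axis i ` A i)" using A(1) by simp
  ultimately show ?thesis unfolding polyhedral_cone_iff_polar by blast
qed

context block_haar begin

text \<open>For almost every \<open>q\<close> and almost every right hand side \<open>(y, w)\<close>, the point \<open>y\<close> lies in the
  image of the cone iff the system of exactly one \<open>L\<close> has a solution in
  \<open>biconic L K (polar K)\<close>. Existence is the optimality of the closest point. For uniqueness,
  two solutions have the same projection, which lies in both subspaces; if these differ,
  then it lies in a proper subspace of one of them, a null event.\<close>

theorem nn_integral_gauss_image:
  assumes T: "\<And>i. invertible (T i)" and C: "\<And>i. polyhedral_cone (C i)"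
    and LL: "finite LL" "\<And>L. L \<in> LL \<Longrightarrow> \<exists>V. (\<forall>i. subspace (V i)) \<and> L = cone_product V"
    and comp: "\<And>x n. x \<in> cone_product C \<Longrightarrow> n \<in> polar (cone_product C) \<Longrightarrow> x \<bullet> n = 0 \<Longrightarrow>
      \<exists>L\<in>LL. x \<in> L \<and> n \<in> L\<^sup>\<bottom>"
  shows "(\<integral>\<^sup>+q. emeasure gauss (block_map T q ` cone_product C) \<partial>\<rho>) =
    (\<Sum>L\<in>{L\<in>LL. CARD('d) \<le> dim L}. emeasure gauss (biconic L (cone_product C) (polar (cone_product C))))"
proof -
  interpret G: prob_space \<Gamma> by (rule prob_space_\<Gamma>)
  interpret G2: prob_space "gauss :: (real^'d^'m) measure" by (rule prob_space_gauss)
  define K where "K = cone_product C"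
  define P where "P = {L\<in>LL. CARD('d) \<le> dim L}"
  have finP: "finite P" using LL(1) by (simp add: P_def)
  have K: "polyhedral_cone K" unfolding K_def by (rule polyhedral_cone_product[OF C])
  note cc = polyhedral_cone_convex_cone[OF C]
  have polK: "polar K = cone_product (\<lambda>i. polar (C i))"
    unfolding K_def by (intro polar_cone_product convex_cone_contains_0 cc)
  have sub: "subspace L" if "L \<in> LL" for L
    using LL(2)[OF that] subspace_cone_product by blast
  have closed_S: "closed (biconic L K (polar K))" if "L \<in> LL" for L
    using that by (intro closed_biconic sub polyhedral_cone_closed K closed_polar)
  define Z where "Z L = {\<omega>. \<exists>z\<in>biconic L K (polar K). solves_at T L \<omega> z}" for L
  have Z_borel: "Z L \<in> sets borel" if "L \<in> LL" for L
    unfolding Z_def using that by (intro solves_in_borel sub closed_S)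
  have Z_pair: "Z L \<in> sets (\<rho> \<Otimes>\<^sub>M \<Gamma>)" if "L \<in> LL" for L
    unfolding sets_\<rho>\<Gamma> using that by (rule Z_borel)
  have slice: "Pair q -` Z L \<in> sets \<Gamma>" if "L \<in> LL" for q L
    using sets_Pair1[OF Z_pair[OF that]] .
  have onto: "AE q in \<rho>. block_map T q ` L = UNIV" if "L \<in> P" for L
  proof -
    have "L \<in> LL" using that by (simp add: P_def)
    then obtain V where V: "\<And>i. subspace (V i)" "L = cone_product V" using LL(2)[of L] by blast
    then show ?thesis using AE_image_UNIV[where T=T and V=V, OF T V(1)] that by (simp add: P_def)
  qed
  have Z_measure: "emeasure (\<rho> \<Otimes>\<^sub>M \<Gamma>) (Z L) = emeasure gauss (biconic L K (polar K))" if "L \<in> P" for L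
  proof -
    have "L \<in> LL" using that by (simp add: P_def)
    then obtain V where V: "\<And>i. subspace (V i)" "L = cone_product V" using LL(2)[of L] by blast
    have norm: "normalise V z \<in> biconic L K (polar K) \<longleftrightarrow> z \<in> biconic L K (polar K)" for z
      unfolding polK unfolding K_def V(2)
      by (rule normalise_mem_biconic[OF V(1)]) (use cc convex_cone_polar in auto)
    show ?thesis
      unfolding Z_def using onto[OF that] closed_S[OF \<open>L \<in> LL\<close>] norm unfolding V(2)
      by (intro emeasure_solves V(1))
  qed
  have "(\<integral>\<^sup>+q. emeasure gauss (block_map T q ` K) \<partial>\<rho>) =
      (\<integral>\<^sup>+q. (\<Sum>L\<in>P. emeasure \<Gamma> (Pair q -` Z L)) \<partial>\<rho>)"
  proof (rule nn_integral_cong_AE)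
    have "AE q in \<rho>. \<forall>L\<in>P. block_map T q ` L = UNIV"
      using finP onto by (intro AE_finite_allI)
    then show "AE q in \<rho>. emeasure gauss (block_map T q ` K) =
        (\<Sum>L\<in>P. emeasure \<Gamma> (Pair q -` Z L))"
      using orthogonal
    proof eventually_elim
      fix q :: "real^'d^'d^'m"
      assume gen: "\<forall>L\<in>P. block_map T q ` L = UNIV" and q: "block_orthogonal q"
      define I where "I = block_map T q ` K"
      have "polyhedral_cone I"
        unfolding I_def using linear_block_map K by (rule polyhedral_cone_linear_image)
      then have I: "I \<in> sets gauss" using borel_closed[OF polyhedral_cone_closed] by simp
      \<comment> \<open>Subspaces of too small dimension contribute nothing, and neither do solutions that project
        into the intersection with another subspace.\<close>
      have small: "AE p in \<Gamma>. \<forall>L\<in>LL - P. \<not> (\<exists>z\<in>UNIV. solves T L q (fst p) (snd p) z)"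
      proof (intro AE_finite_allI)
        fix L assume L: "L \<in> LL - P"
        have "dim (block_map T q ` L) \<le> dim L"
          by (rule dim_image_le[OF linear_block_map])
        also have "\<dots> < CARD('d)" using L by (auto simp: P_def)
        finally have "block_map T q ` L \<noteq> UNIV" by auto
        then show "AE p in \<Gamma>. \<not> (\<exists>z\<in>UNIV. solves T L q (fst p) (snd p) z)"
          unfolding \<Gamma>_def using L by (intro solves_null[OF q]) (auto intro: sub)
      qed (use LL(1) in auto)
      have meet: "AE p in \<Gamma>. \<forall>L\<in>P. \<forall>L'\<in>P. \<not> L \<subseteq> L' \<longrightarrow>
          \<not> (\<exists>z\<in>{z. orth_proj L z \<in> L'}. solves T L q (fst p) (snd p) z)"
      proof (intro AE_finite_allI finP)
        fix L L' assume L: "L \<in> P" "L' \<in> P"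
        show "AE p in \<Gamma>. \<not> L \<subseteq> L' \<longrightarrow> \<not> (\<exists>z\<in>{z. orth_proj L z \<in> L'}. solves T L q (fst p) (snd p) z)"
        proof (cases "L \<subseteq> L'")
          case False
          have s: "subspace L" "subspace L'" using L by (auto simp: P_def intro: sub)
          from False obtain x where x: "x \<in> L" "x \<notin> L'" by blast
          have "orth_proj L x = x"
            using s x by (intro orth_proj_eqI) (auto simp: subspace_0[OF subspace_orthogonal_comp])
          then have "x \<notin> {z. orth_proj L z \<in> L'}" using x by simp
          then have "{z. orth_proj L z \<in> L'} \<noteq> UNIV" by blast
          moreover have "subspace {z. orth_proj L z \<in> L'}"
            using linear_subspace_vimage[OF linear_orth_proj s(2)] s(1) by (simp add: vimage_def)
          ultimately have "AE p in \<Gamma>. \<not> (\<exists>z\<in>{z. orth_proj L z \<in> L'}. solves T L q (fst p) (snd p) z)"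
            unfolding \<Gamma>_def using s by (intro solves_null[OF q]) auto
          then show ?thesis by eventually_elim simp
        qed simp
      qed
      have "AE p in \<Gamma>. indicator (I \<times> UNIV) p = (\<Sum>L\<in>P. indicator (Pair q -` Z L) p :: ennreal)"
        using small meet
      proof eventually_elim
        fix p
        assume small: "\<forall>L\<in>LL - P. \<not> (\<exists>z\<in>UNIV. solves T L q (fst p) (snd p) z)"
          and meet: "\<forall>L\<in>P. \<forall>L'\<in>P. \<not> L \<subseteq> L' \<longrightarrow>
            \<not> (\<exists>z\<in>{z. orth_proj L z \<in> L'}. solves T L q (fst p) (snd p) z)"
        show "indicator (I \<times> UNIV) p = (\<Sum>L\<in>P. indicator (Pair q -` Z L) p :: ennreal)"
        proof (cases "fst p \<in> I")
          case True
          then have "fst p \<in> block_map T q ` K" by (simp add: I_def)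
          then obtain L z where L: "L \<in> LL" and z: "z \<in> biconic L K (polar K)" "solves T L q (fst p) (snd p) z"
            using solves_biconic_exists[OF q K _ sub] comp unfolding K_def by metis
          have "L \<in> P" using small L z by auto
          have uniq: "L' = L" if L': "L' \<in> P" "Pair q p \<in> Z L'" for L'
          proof -
            obtain z' where z': "z' \<in> biconic L' K (polar K)" "solves T L' q (fst p) (snd p) z'"
              using L'(2) by (auto simp: Z_def)
            have sL': "subspace L'" using L' by (simp add: P_def sub)
            have eq: "orth_proj L z = orth_proj L' z'"
              by (rule solves_monotone[OF q sub[OF L] sL' z z'])
            have "orth_proj L z \<in> L'" using eq orth_proj_in[OF sL'] by simp
            then have "L \<subseteq> L'" using meet \<open>L \<in> P\<close> L' z(2) by blast
            moreover have "orth_proj L' z' \<in> L" using eq[symmetric] orth_proj_in[OF sub[OF L]] by simp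
            then have "L' \<subseteq> L" using meet \<open>L \<in> P\<close> L' z'(2) by blast
            ultimately show ?thesis by blast
          qed
          have zL: "Pair q p \<in> Z L" using z by (auto simp: Z_def)
          have "indicator (Pair q -` Z L') p = (if L' = L then 1 else 0 :: ennreal)" if L': "L' \<in> P" for L'
          proof (cases "L' = L")
            case True
            then show ?thesis using zL by simp
          next
            case False
            then have "Pair q p \<notin> Z L'" using uniq[OF L'] by blast
            then show ?thesis using False by simp
          qed
          then have "(\<Sum>L'\<in>P. indicator (Pair q -` Z L') p :: ennreal) = (\<Sum>L'\<in>P. if L' = L then 1 else 0)"
            by (intro sum.cong refl)
          also have "\<dots> = 1" using \<open>L \<in> P\<close> finP by simp
          finally show ?thesis using True by (simp add: indicator_def mem_Times_iff)
        next
          case False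
          have "Pair q p \<notin> Z L" for L
          proof
            assume "Pair q p \<in> Z L"
            then obtain z where "orth_proj L z \<in> K" "block_sum T (block_apply q (orth_proj L z)) = fst p"
              by (auto simp: Z_def solves_def biconic_def)
            then have "fst p \<in> I" unfolding I_def by (metis image_eqI)
            then show False using False by blast
          qed
          then show ?thesis using False by (simp add: indicator_def mem_Times_iff)
        qed
      qed
      then have "(\<integral>\<^sup>+p. indicator (I \<times> UNIV) p \<partial>\<Gamma>) = (\<integral>\<^sup>+p. (\<Sum>L\<in>P. indicator (Pair q -` Z L) p) \<partial>\<Gamma>)"
        by (rule nn_integral_cong_AE)
      also have "\<dots> = (\<Sum>L\<in>P. emeasure \<Gamma> (Pair q -` Z L))"
        using slice by (subst nn_integral_sum) (auto simp: P_def)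
      also have "(\<integral>\<^sup>+p. indicator (I \<times> UNIV) p \<partial>\<Gamma>) = emeasure \<Gamma> (I \<times> UNIV)"
        unfolding \<Gamma>_def using I by (intro nn_integral_indicator pair_measureI) auto
      also have "\<dots> = emeasure gauss I"
        unfolding \<Gamma>_def using I G2.emeasure_pair_measure_Times[of I gauss UNIV] G2.emeasure_space_1 by simp
      finally show "emeasure gauss (block_map T q ` K) =
          (\<Sum>L\<in>P. emeasure \<Gamma> (Pair q -` Z L))" by (simp add: I_def)
    qed
  qed
  also have "\<dots> = (\<Sum>L\<in>P. \<integral>\<^sup>+q. emeasure \<Gamma> (Pair q -` Z L) \<partial>\<rho>)"
    using Z_pair by (intro nn_integral_sum) (auto simp: P_def intro: G.measurable_emeasure_Pair)
  also have "\<dots> = (\<Sum>L\<in>P. emeasure (\<rho> \<Otimes>\<^sub>M \<Gamma>) (Z L))"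
    using Z_pair by (intro sum.cong refl G.emeasure_pair_measure_alt[symmetric]) (auto simp: P_def)
  also have "\<dots> = (\<Sum>L\<in>P. emeasure gauss (biconic L K (polar K)))"
    using Z_measure by (intro sum.cong) auto
  finally show ?thesis by (simp add: K_def P_def)
qed

end

section \<open>Faces of products and extremal intrinsic volumes\<close>

lemma span_cone_product:
  fixes G :: "'m::finite \<Rightarrow> (real^'d) set"
  assumes "\<And>i. 0 \<in> G i"
  shows "span (cone_product G) = cone_product (\<lambda>i. span (G i))"
proof
  show "span (cone_product G) \<subseteq> cone_product (\<lambda>i. span (G i))"
    by (intro span_minimal subspace_cone_product subspace_span) (auto simp: cone_product_def span_base)
  show "cone_product (\<lambda>i. span (G i)) \<subseteq> span (cone_product G)"
  proof
    fix x assume x: "x \<in> cone_product (\<lambda>i. span (G i))"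
    have lin: "linear (axis i :: real^'d \<Rightarrow> real^'d^'m)" for i
      by (rule linearI) (simp_all add: axis_def vec_eq_iff)
    have "axis i (x $ i) \<in> span (cone_product G)" for i
    proof -
      have "axis i ` G i \<subseteq> cone_product G" using assms by (auto simp: cone_product_def axis_def)
      then have "axis i ` span (G i) \<subseteq> span (cone_product G)"
        using linear_span_image[OF lin] span_mono by metis
      then show ?thesis using x by (auto simp: cone_product_def)
    qed
    then have "(\<Sum>i\<in>UNIV. axis i (x $ i)) \<in> span (cone_product G)" by (intro span_sum)
    moreover have "(\<Sum>i\<in>UNIV. axis i (x $ i)) = x"
      by (simp add: vec_eq_iff axis_def if_distrib[of "\<lambda>v. v $ _"] cong: if_cong)
    ultimately show "x \<in> span (cone_product G)" by simp
  qed
qed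

text \<open>A vector that is in the polar of the product has each component in the polar of the
  corresponding factor, so the inner product vanishes only if all its summands do.\<close>

lemma face_span_cone_product:
  fixes C :: "'m::finite \<Rightarrow> (real^'d) set"
  assumes C: "\<And>i. 0 \<in> C i" and F: "cone_face (cone_product C) F"
  obtains V where "\<And>i. subspace (V i)" "span F = cone_product V"
proof -
  obtain z where z: "\<forall>x\<in>cone_product C. x \<bullet> z \<le> 0" "F = {x\<in>cone_product C. x \<bullet> z = 0}"
    using F by (auto simp: cone_face_def)
  define G where "G i = {x\<in>C i. x \<bullet> z $ i = 0}" for i
  have le: "x \<bullet> z $ i \<le> 0" if "x \<in> C i" for x i
  proof -
    have "axis i x \<in> cone_product C" using that C by (simp add: cone_product_def axis_def)
    then have "axis i x \<bullet> z \<le> 0" using z(1) by blast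
    then show ?thesis by (simp add: inner_axis')
  qed
  have "x \<in> F \<longleftrightarrow> x \<in> cone_product G" for x
  proof -
    have "x \<bullet> z = 0 \<longleftrightarrow> (\<forall>i. x $ i \<bullet> z $ i = 0)" if "\<forall>i. x $ i \<in> C i"
    proof -
      have "x \<bullet> z = 0 \<longleftrightarrow> (\<Sum>i\<in>UNIV. - (x $ i \<bullet> z $ i)) = 0"
        unfolding inner_blocks[of x z] by (simp add: sum_negf)
      also have "\<dots> \<longleftrightarrow> (\<forall>i\<in>UNIV. - (x $ i \<bullet> z $ i) = 0)"
        using that le by (intro sum_nonneg_eq_0_iff) auto
      finally show ?thesis by simp
    qed
    then show ?thesis by (auto simp: z(2) cone_product_def G_def)
  qed
  then have "F = cone_product G" by blast
  then have "span F = cone_product (\<lambda>i. span (G i))"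
    using C by (simp add: span_cone_product G_def)
  then show thesis by (intro that[of "\<lambda>i. span (G i)"]) auto
qed

lemma conic_intrinsic_volume_eq:
  fixes C :: "'a::euclidean_space set"
  assumes "closed C"
  shows "conic_intrinsic_volume k C = (\<Sum>L\<in>face_spans k C. measure gauss (biconic L C (polar C)))"
  unfolding conic_intrinsic_volume_def using assms
  by (intro sum.cong refl gaussian_on_mult) (auto simp: face_spans_def closed_polar)

text \<open>The only subspace that can contribute is the whole space, and it does so iff \<open>C\<close> spans it.\<close>

lemma conic_intrinsic_volume_top:
  fixes C :: "'a::euclidean_space set"
  assumes "closed C"
  shows "conic_intrinsic_volume DIM('a) C = measure gauss C"
proof -
  have full: "L = UNIV \<and> L \<subseteq> span C" if L: "L \<in> face_spans DIM('a) C" for L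
  proof -
    obtain F where F: "dim L = DIM('a)" "cone_face C F" "L = span F" using L by (auto simp: face_spans_def)
    have "F \<subseteq> C" using F(2) by (auto simp: cone_face_def)
    then have "L \<subseteq> span C" using F(3) by (simp add: span_mono)
    moreover have "span L = UNIV" using F(1) dim_eq_full by blast
    then have "L = UNIV" unfolding F(3) span_span .
    ultimately show ?thesis by blast
  qed
  show ?thesis
  proof (cases "span C = UNIV")
    case True
    have "cone_face C C" unfolding cone_face_def by (rule exI[of _ 0]) simp
    then have "UNIV \<in> face_spans DIM('a) C"
      using True by (auto simp: face_spans_def intro!: exI[of _ C])
    then have "face_spans DIM('a) C = {UNIV}" using full by blast
    moreover have "biconic UNIV C (polar C) = C"
    proof -
      have "orth_proj UNIV z = z" for z :: 'a by (intro orth_proj_eqI) auto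
      then show ?thesis by (simp add: biconic_def zero_in_polar)
    qed
    ultimately show ?thesis by (simp add: conic_intrinsic_volume_eq[OF assms])
  next
    case False
    then have "face_spans DIM('a) C = {}" using full by blast
    moreover have "measure gauss C = 0"
    proof -
      have "span C \<in> null_sets gauss" using False by (intro gauss_proper_subspace_null) auto
      then have "C \<in> null_sets gauss"
        by (rule null_sets_subset) (simp_all add: span_superset closed_polar assms)
      then show ?thesis by (simp add: null_sets_def measure_def)
    qed
    ultimately show ?thesis by (simp add: conic_intrinsic_volume_def)
  qed
qed

text \<open>If \<open>polar C\<close> spans the space, the sum of a basis contained in it is negative on \<open>C - {0}\<close>,
  so \<open>{0}\<close> is a face; otherwise both sides vanish.\<close>

lemma conic_intrinsic_volume_0:
  fixes C :: "'a::euclidean_space set"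
  assumes "closed C" "0 \<in> C"
  shows "conic_intrinsic_volume 0 C = measure gauss (polar C)"
proof -
  have sub: "face_spans 0 C \<subseteq> {{0}}"
  proof
    fix L assume "L \<in> face_spans 0 C"
    then have "L \<subseteq> {0}" "0 \<in> L" by (auto simp: face_spans_def dim_eq_0 span_zero)
    then show "L \<in> {{0}}" by blast
  qed
  have bi: "biconic {0} C (polar C) = polar C"
  proof -
    have "orth_proj {0} z = 0" for z :: 'a by (intro orth_proj_eqI) auto
    then show ?thesis using assms(2) by (simp add: biconic_def)
  qed
  show ?thesis
  proof (cases "{0} \<in> face_spans 0 C")
    case True
    then have "face_spans 0 C = {{0}}" using sub by blast
    then show ?thesis by (simp add: conic_intrinsic_volume_eq[OF assms(1)] bi)
  next
    case False
    have "span (polar C) \<noteq> UNIV"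
    proof
      assume full: "span (polar C) = UNIV"
      obtain B where B: "B \<subseteq> polar C" "independent B" "polar C \<subseteq> span B"
        using maximal_independent_subset[of "polar C"] by blast
      have finB: "finite B" using B(2) by (rule independent_imp_finite)
      have spanB: "span B = UNIV" using B(3) full span_minimal[OF B(3) subspace_span] by blast
      define F where "F = {x\<in>C. x \<bullet> sum id B = 0}"
      have face: "cone_face C F"
        unfolding cone_face_def F_def
        using B(1) by (intro exI[of _ "sum id B"]) (auto simp: inner_sum_right polar_def intro!: sum_nonpos)
      have "x = 0" if x: "x \<in> F" for x
      proof -
        have xC: "x \<in> C" using x by (simp add: F_def)
        have "(\<Sum>b\<in>B. - (x \<bullet> b)) = 0"
          using x by (simp add: F_def inner_sum_right sum_negf)
        then have "\<forall>b\<in>B. - (x \<bullet> b) = 0"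
          by (subst (asm) sum_nonneg_eq_0_iff[OF finB]) (use B(1) xC in \<open>auto simp: polar_def\<close>)
        then have "x \<in> B\<^sup>\<bottom>" by (simp add: mem_orthogonal_comp inner_commute)
        then have "x \<in> (span B)\<^sup>\<bottom>" by (simp add: orthogonal_comp_span)
        then show "x = 0" using spanB by simp
      qed
      then have "F = {0}" using assms(2) by (auto simp: F_def)
      then have "{0} \<in> face_spans 0 C" using face by (auto simp: face_spans_def intro!: exI[of _ "{0}"])
      then show False using False by blast
    qed
    then have "span (polar C) \<in> null_sets gauss" by (intro gauss_proper_subspace_null) auto
    then have "polar C \<in> null_sets gauss"
      by (rule null_sets_subset) (simp_all add: span_superset closed_polar assms)
    then have "measure gauss (polar C) = 0" by (simp add: null_sets_def measure_def)
    moreover have "face_spans 0 C = {}" using sub False by blast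
    ultimately show ?thesis by (simp add: conic_intrinsic_volume_def)
  qed
qed

lemma Minkowski_sum_eq_image:
  fixes C :: "'m::finite \<Rightarrow> (real^'d) set"
  shows "(\<Sum>i\<in>UNIV. (\<lambda>x. T i *v (f i *v x)) ` C i) =
    block_map T (\<chi> i. f i) ` cone_product C" (is "?S = ?I")
proof
  show "?S \<subseteq> ?I"
  proof
    fix y assume "y \<in> ?S"
    then obtain s where s: "y = sum s UNIV" "\<forall>i. s i \<in> (\<lambda>x. T i *v (f i *v x)) ` C i"
      by (auto simp: set_sum_alt)
    then have "\<forall>i. \<exists>x. x \<in> C i \<and> s i = T i *v (f i *v x)" by blast
    then obtain x where x: "\<And>i. x i \<in> C i" "\<And>i. s i = T i *v (f i *v x i)" by metis
    have "y = block_sum T (block_apply (\<chi> i. f i) (\<chi> i. x i))"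
      using s(1) x(2) by (simp add: block_sum_def)
    then show "y \<in> ?I" using x(1) by (auto simp: cone_product_def)
  qed
  show "?I \<subseteq> ?S"
    by (auto simp: set_sum_alt block_sum_def cone_product_def)
qed

text \<open>The polar of the right hand side is the intersection of the polars of its summands, which is
  \<open>K\<close>. As the right hand side is polyhedral, it is in turn the polar of \<open>K\<close>.\<close>

lemma polar_Inter_images:
  fixes C :: "'m::finite \<Rightarrow> (real^'d) set"
  assumes C: "\<And>i. polyhedral_cone (C i)" and inv: "\<And>i. B i ** T i = mat 1" "\<And>i. T i ** B i = mat 1"
    and f: "\<And>i. orthogonal_matrix (f i)"
  defines "K \<equiv> \<Inter>i. (\<lambda>x. T i *v (f i *v x)) ` C i"
  shows "polar K = block_map (\<lambda>i. transpose (B i)) (\<chi> i. f i) `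
      cone_product (\<lambda>i. polar (C i))"
    and "closed K" and "0 \<in> K"
proof -
  define T' where "T' i = transpose (B i)" for i
  define J where "J = block_map T' (\<chi> i. f i) ` cone_product (\<lambda>i. polar (C i))"
  have J: "polyhedral_cone J"
    unfolding J_def
    by (intro polyhedral_cone_linear_image linear_block_map polyhedral_cone_product polyhedral_cone_polar C)
  have fo: "transpose (f i) ** f i = mat 1" "f i ** transpose (f i) = mat 1" for i
    using f[of i] by (auto simp: orthogonal_matrix_def)
  define g where "g i y = transpose (f i) *v (B i *v y)" for i y
  have gT: "g i (T i *v (f i *v x)) = x" for i x
  proof -
    have "B i *v (T i *v (f i *v x)) = f i *v x"
      by (simp add: matrix_vector_mul_assoc matrix_mul_assoc inv)
    then show ?thesis by (simp add: g_def matrix_vector_mul_assoc fo)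
  qed
  have Tg: "T i *v (f i *v g i y) = y" for i y
  proof -
    have "f i *v g i y = B i *v y"
      by (simp add: g_def matrix_vector_mul_assoc matrix_mul_assoc fo)
    then show ?thesis by (simp add: matrix_vector_mul_assoc inv)
  qed
  have adj: "(T' i *v (f i *v p)) \<bullet> y = p \<bullet> g i y" for i p y
    unfolding g_def T'_def
    by (metis dot_lmul_matrix inner_commute transpose_matrix_vector transpose_transpose)
  have K_iff: "y \<in> K \<longleftrightarrow> (\<forall>i. g i y \<in> C i)" for y
    unfolding K_def using gT Tg by (auto simp: image_iff) metis+
  have "y \<in> polar J \<longleftrightarrow> (\<forall>i. g i y \<in> C i)" for y
  proof
    assume y: "y \<in> polar J"
    show "\<forall>i. g i y \<in> C i"
    proof
      fix i
      have "p \<bullet> g i y \<le> 0" if p: "p \<in> polar (C i)" for p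
      proof -
        have "axis i p \<in> cone_product (\<lambda>i. polar (C i))"
          using p by (auto simp: cone_product_def axis_def zero_in_polar)
        then have "block_sum T' (block_apply (\<chi> i. f i) (axis i p)) \<in> J" unfolding J_def by blast
        then have "(T' i *v (f i *v p)) \<bullet> y \<le> 0"
          using polar_inner_le[OF y] by (simp add: block_map_axis)
        then show ?thesis by (simp add: adj)
      qed
      then have "g i y \<in> polar (polar (C i))" by (auto simp: polar_def)
      then show "g i y \<in> C i" by (simp add: polyhedral_cone_polar_polar[OF C])
    qed
  next
    assume y: "\<forall>i. g i y \<in> C i"
    have "j \<bullet> y \<le> 0" if j: "j \<in> J" for j
    proof -
      obtain p where p: "\<And>i. p $ i \<in> polar (C i)" "j = block_sum T' (block_apply (\<chi> i. f i) p)"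
        using j by (auto simp: J_def cone_product_def)
      have "j \<bullet> y = (\<Sum>i\<in>UNIV. p $ i \<bullet> g i y)"
        by (simp add: p(2) block_sum_def inner_sum_left adj)
      also have "\<dots> \<le> 0"
      proof (rule sum_nonpos)
        show "p $ i \<bullet> g i y \<le> 0" for i
          using polar_inner_le[OF p(1)[of i], of "g i y"] y by (simp add: inner_commute)
      qed
      finally show ?thesis .
    qed
    then show "y \<in> polar J" by (simp add: polar_def)
  qed
  then have KJ: "K = polar J" using K_iff by blast
  show "polar K = block_map (\<lambda>i. transpose (B i)) (\<chi> i. f i) `
      cone_product (\<lambda>i. polar (C i))"
    using polyhedral_cone_polar_polar[OF J] unfolding KJ J_def T'_def .
  show "closed K" "0 \<in> K" unfolding KJ by (rule closed_polar, rule zero_in_polar)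
qed

section \<open>Independent Haar matrices\<close>

lemma orthogonal_borel_id: "(\<lambda>x. x) \<in> orthogonal_borel \<rightarrow>\<^sub>M borel"
  unfolding orthogonal_borel_def by (intro measurable_restrict_space1) simp

lemma space_orthogonal_borel: "space orthogonal_borel = {Q. orthogonal_matrix Q}"
  by (simp add: orthogonal_borel_def space_restrict_space)

lemma measurable_orthogonal_borelI:
  "f \<in> borel_measurable M \<Longrightarrow> (\<And>x. x \<in> space M \<Longrightarrow> orthogonal_matrix (f x)) \<Longrightarrow> f \<in> M \<rightarrow>\<^sub>M orthogonal_borel"
  unfolding orthogonal_borel_def by (intro measurable_restrict_space2) auto

lemma measurable_matrix_mult_orthogonal:
  "(\<lambda>p. fst p ** snd p) \<in> orthogonal_borel \<Otimes>\<^sub>M orthogonal_borel \<rightarrow>\<^sub>M (orthogonal_borel :: (real^'d^'d) measure)"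
proof (rule measurable_orthogonal_borelI)
  have "continuous_on UNIV (\<lambda>p :: (real^'d^'d) \<times> (real^'d^'d). fst p ** snd p)"
    unfolding matrix_matrix_mult_def by (intro continuous_intros)
  then have "(\<lambda>p :: (real^'d^'d) \<times> (real^'d^'d). fst p ** snd p) \<in> borel \<Otimes>\<^sub>M borel \<rightarrow>\<^sub>M borel"
    unfolding borel_prod by (rule borel_measurable_continuous_onI)
  moreover have "(\<lambda>p. (fst p, snd p)) \<in> orthogonal_borel \<Otimes>\<^sub>M orthogonal_borel \<rightarrow>\<^sub>M
      (borel :: (real^'d^'d) measure) \<Otimes>\<^sub>M (borel :: (real^'d^'d) measure)"
    by (intro measurable_Pair measurable_compose[OF measurable_fst orthogonal_borel_id]
        measurable_compose[OF measurable_snd orthogonal_borel_id])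
  ultimately show "(\<lambda>p. fst p ** snd p) \<in> orthogonal_borel \<Otimes>\<^sub>M orthogonal_borel \<rightarrow>\<^sub>M (borel :: (real^'d^'d) measure)"
    using measurable_compose by fastforce
qed (auto simp: space_pair_measure space_orthogonal_borel orthogonal_matrix_mul)

lemma measurable_transpose_orthogonal: "transpose \<in> orthogonal_borel \<rightarrow>\<^sub>M (orthogonal_borel :: (real^'d^'d) measure)"
proof (rule measurable_orthogonal_borelI)
  have "continuous_on UNIV (transpose :: real^'d^'d \<Rightarrow> real^'d^'d)"
    unfolding transpose_def by (intro continuous_intros)
  then show "transpose \<in> orthogonal_borel \<rightarrow>\<^sub>M (borel :: (real^'d^'d) measure)"
    using measurable_compose[OF orthogonal_borel_id borel_measurable_continuous_onI] by blast
qed (simp add: space_orthogonal_borel orthogonal_matrix_transpose)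

text \<open>Fubini's theorem for \<open>p ** q\<close> with \<open>q\<close> distributed according to \<open>\<mu>\<close> and \<open>p\<close> according to the
  image of \<open>\<mu>\<close> under inversion shows that \<open>\<mu>\<close> is invariant under inversion. Inversion
  exchanges left and right translations.\<close>

lemma orthogonal_haar_right_invariant:
  fixes \<mu> :: "(real^'d^'d) measure"
  assumes \<mu>: "is_orthogonal_haar \<mu>" and R: "orthogonal_matrix R"
  shows "distr \<mu> orthogonal_borel (\<lambda>Q. Q ** R) = \<mu>"
proof -
  interpret prob_space \<mu> using \<mu> by (simp add: is_orthogonal_haar_def)
  let ?O = "orthogonal_borel :: (real^'d^'d) measure"
  have sets[measurable_cong]: "sets \<mu> = sets ?O" using \<mu> by (simp add: is_orthogonal_haar_def)
  have space: "space \<mu> = {Q. orthogonal_matrix Q}"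
    using sets_eq_imp_space_eq[OF sets] by (simp add: space_orthogonal_borel)
  have cong: "measurable \<mu> N = measurable ?O N" for N :: "'x measure" by (rule measurable_cong_sets[OF sets refl])
  have mult_l: "(\<lambda>Q. P ** Q) \<in> ?O \<rightarrow>\<^sub>M ?O" if "orthogonal_matrix P" for P
  proof -
    have "(\<lambda>Q. (P, Q)) \<in> ?O \<rightarrow>\<^sub>M ?O \<Otimes>\<^sub>M ?O" using that by (intro measurable_Pair1') (simp add: space_orthogonal_borel)
    from measurable_compose[OF this measurable_matrix_mult_orthogonal] show ?thesis by simp
  qed
  have mult_r: "(\<lambda>Q. Q ** P) \<in> ?O \<rightarrow>\<^sub>M ?O" if "orthogonal_matrix P" for P
  proof -
    have "(\<lambda>Q. (Q, P)) \<in> ?O \<rightarrow>\<^sub>M ?O \<Otimes>\<^sub>M ?O" using that by (intro measurable_Pair2') (simp add: space_orthogonal_borel)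
    from measurable_compose[OF this measurable_matrix_mult_orthogonal] show ?thesis by simp
  qed
  have left: "emeasure \<mu> {Q\<in>space \<mu>. P ** Q \<in> S} = emeasure \<mu> S" if P: "orthogonal_matrix P" and S: "S \<in> sets ?O" for P S
  proof -
    have "emeasure \<mu> S = emeasure (distr \<mu> ?O (\<lambda>Q. P ** Q)) S"
      using \<mu> P by (simp add: is_orthogonal_haar_def)
    also have "\<dots> = emeasure \<mu> ((\<lambda>Q. P ** Q) -` S \<inter> space \<mu>)"
      using mult_l[OF P] S by (intro emeasure_distr) (simp_all add: cong)
    finally show ?thesis by (simp add: vimage_def Int_def conj_commute)
  qed
  define \<nu> where "\<nu> = distr \<mu> ?O transpose"
  have tr: "transpose \<in> \<mu> \<rightarrow>\<^sub>M ?O" by (simp add: cong measurable_transpose_orthogonal)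
  interpret N: prob_space \<nu> unfolding \<nu>_def by (rule prob_space_distr[OF tr])
  interpret P: pair_sigma_finite \<nu> \<mu> ..
  have sets_\<nu>[measurable_cong]: "sets \<nu> = sets ?O" by (simp add: \<nu>_def)
  have space_\<nu>: "space \<nu> = {Q. orthogonal_matrix Q}" by (simp add: \<nu>_def space_orthogonal_borel)
  have \<nu>: "emeasure \<nu> S = emeasure \<mu> {Q\<in>space \<mu>. transpose Q \<in> S}" if "S \<in> sets ?O" for S
    unfolding \<nu>_def using tr that by (simp add: emeasure_distr vimage_def Int_def conj_commute)
  have inverse_inv: "emeasure \<mu> S = emeasure \<nu> S" if S: "S \<in> sets ?O" for S
  proof -
    let ?X = "{p\<in>space (\<nu> \<Otimes>\<^sub>M \<mu>). fst p ** snd p \<in> S}"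
    have sp: "sets (\<nu> \<Otimes>\<^sub>M \<mu>) = sets (?O \<Otimes>\<^sub>M ?O)" by (intro sets_pair_measure_cong sets sets_\<nu>)
    have X: "?X \<in> sets (\<nu> \<Otimes>\<^sub>M \<mu>)"
      using measurable_sets[OF measurable_matrix_mult_orthogonal S]
      unfolding sp sets_eq_imp_space_eq[OF sp] by (simp add: vimage_def Int_def conj_commute)
    have "emeasure (\<nu> \<Otimes>\<^sub>M \<mu>) ?X = (\<integral>\<^sup>+p. emeasure \<mu> (Pair p -` ?X) \<partial>\<nu>)"
      by (rule emeasure_pair_measure_alt[OF X])
    also have "\<dots> = (\<integral>\<^sup>+p. emeasure \<mu> S \<partial>\<nu>)"
    proof (rule nn_integral_cong)
      fix p assume p: "p \<in> space \<nu>"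
      then have "Pair p -` ?X = {Q\<in>space \<mu>. p ** Q \<in> S}" by (auto simp: space_pair_measure)
      then show "emeasure \<mu> (Pair p -` ?X) = emeasure \<mu> S" using left[OF _ S] p by (simp add: space_\<nu>)
    qed
    finally have 1: "emeasure (\<nu> \<Otimes>\<^sub>M \<mu>) ?X = emeasure \<mu> S" by (simp add: N.emeasure_space_1)
    have "emeasure (\<nu> \<Otimes>\<^sub>M \<mu>) ?X = (\<integral>\<^sup>+q. emeasure \<nu> ((\<lambda>p. (p, q)) -` ?X) \<partial>\<mu>)"
      by (rule P.emeasure_pair_measure_alt2[OF X])
    also have "\<dots> = (\<integral>\<^sup>+q. emeasure \<nu> S \<partial>\<mu>)"
    proof (rule nn_integral_cong)
      fix q assume q: "q \<in> space \<mu>"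
      then have qo: "orthogonal_matrix q" by (simp add: space)
      have e: "(\<lambda>p. (p, q)) -` ?X = {p\<in>space ?O. p ** q \<in> S}"
        using q by (auto simp: space_pair_measure space_\<nu> space_orthogonal_borel)
      have m: "{p\<in>space ?O. p ** q \<in> S} \<in> sets ?O"
        using measurable_sets[OF mult_r[OF qo] S] by (simp add: vimage_def Int_def conj_commute)
      have m': "{p\<in>space ?O. transpose p \<in> S} \<in> sets ?O"
        using measurable_sets[OF measurable_transpose_orthogonal S] by (simp add: vimage_def Int_def conj_commute)
      have "emeasure \<nu> ((\<lambda>p. (p, q)) -` ?X) = emeasure \<mu> {p\<in>space \<mu>. transpose p \<in> {p\<in>space ?O. p ** q \<in> S}}"
        unfolding e by (rule \<nu>[OF m])
      also have "{p\<in>space \<mu>. transpose p \<in> {p\<in>space ?O. p ** q \<in> S}} =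
          {p\<in>space \<mu>. transpose q ** p \<in> {p\<in>space ?O. transpose p \<in> S}}"
        using qo by (auto simp: space space_orthogonal_borel matrix_transpose_mul orthogonal_matrix_mul orthogonal_matrix_transpose)
      also have "emeasure \<mu> \<dots> = emeasure \<mu> {p\<in>space ?O. transpose p \<in> S}"
        using qo by (intro left m') (simp add: orthogonal_matrix_transpose)
      also have "\<dots> = emeasure \<nu> S" by (simp add: \<nu>[OF S] space space_orthogonal_borel)
      finally show "emeasure \<nu> ((\<lambda>p. (p, q)) -` ?X) = emeasure \<nu> S" .
    qed
    finally have 2: "emeasure (\<nu> \<Otimes>\<^sub>M \<mu>) ?X = emeasure \<nu> S" by (simp add: emeasure_space_1)
    show ?thesis using 1 2 by simp
  qed
  show ?thesis
  proof (rule measure_eqI)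
    show "sets (distr \<mu> ?O (\<lambda>Q. Q ** R)) = sets \<mu>" by (simp add: sets)
    fix S assume "S \<in> sets (distr \<mu> ?O (\<lambda>Q. Q ** R))"
    then have S: "S \<in> sets ?O" by simp
    have m: "{p\<in>space ?O. p ** R \<in> S} \<in> sets ?O"
      using measurable_sets[OF mult_r[OF R] S] by (simp add: vimage_def Int_def conj_commute)
    have m': "{p\<in>space ?O. transpose p \<in> S} \<in> sets ?O"
      using measurable_sets[OF measurable_transpose_orthogonal S] by (simp add: vimage_def Int_def conj_commute)
    have "emeasure (distr \<mu> ?O (\<lambda>Q. Q ** R)) S = emeasure \<mu> {p\<in>space ?O. p ** R \<in> S}"
      using mult_r[OF R] S by (simp add: emeasure_distr cong vimage_def Int_def conj_commute space space_orthogonal_borel)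
    also have "\<dots> = emeasure \<mu> {p\<in>space \<mu>. transpose p \<in> {p\<in>space ?O. p ** R \<in> S}}"
      using inverse_inv[OF m] \<nu>[OF m] by simp
    also have "{p\<in>space \<mu>. transpose p \<in> {p\<in>space ?O. p ** R \<in> S}} =
        {p\<in>space \<mu>. transpose R ** p \<in> {p\<in>space ?O. transpose p \<in> S}}"
      using R by (auto simp: space space_orthogonal_borel matrix_transpose_mul orthogonal_matrix_mul orthogonal_matrix_transpose)
    also have "emeasure \<mu> \<dots> = emeasure \<mu> {p\<in>space ?O. transpose p \<in> S}"
      using R by (intro left m') (simp add: orthogonal_matrix_transpose)
    also have "\<dots> = emeasure \<mu> S" using inverse_inv[OF S] \<nu>[OF S] by (simp add: space space_orthogonal_borel)
    finally show "emeasure (distr \<mu> ?O (\<lambda>Q. Q ** R)) S = emeasure \<mu> S" .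
  qed
qed

text \<open>Right multiplication by a fixed tuple preserves independence and, by the right invariance of
  Haar measure, the law of every entry.\<close>

lemma block_haar_independent:
  fixes Q :: "'m::finite \<Rightarrow> 'w \<Rightarrow> real^'d^'d"
  assumes M: "prob_space M"
    and indep: "prob_space.indep_vars M (\<lambda>_. orthogonal_borel) Q UNIV"
    and haar: "\<And>i. is_orthogonal_haar (distr M orthogonal_borel (Q i))"
  shows "(\<lambda>\<omega>. \<chi> i. Q i \<omega>) \<in> borel_measurable M" and "block_haar (distr M borel (\<lambda>\<omega>. \<chi> i. Q i \<omega>))"
proof -
  interpret prob_space M by fact
  let ?O = "orthogonal_borel :: (real^'d^'d) measure"
  let ?P = "\<Pi>\<^sub>M i\<in>(UNIV :: 'm set). ?O"
  have Q: "Q i \<in> M \<rightarrow>\<^sub>M ?O" for i using indep by (auto simp: indep_vars_def)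
  have Qo: "orthogonal_matrix (Q i \<omega>)" if "\<omega> \<in> space M" for i \<omega>
    using measurable_space[OF Q that] by (simp add: space_orthogonal_borel)
  define J :: "('m \<Rightarrow> real^'d^'d) \<Rightarrow> real^'d^'d^'m" where "J f = (\<chi> i. f i)" for f
  have J: "J \<in> borel_measurable ?P"
  proof -
    have "(\<lambda>f. axis i (f i) :: real^'d^'d^'m) \<in> borel_measurable ?P" for i
    proof -
      have "(axis i :: real^'d^'d \<Rightarrow> real^'d^'d^'m) \<in> borel_measurable borel"
        by (intro borel_measurable_linear linearI) (simp_all add: axis_def vec_eq_iff)
      then show ?thesis
        by (rule measurable_compose[OF measurable_compose[OF measurable_component_singleton[of i] orthogonal_borel_id], rotated]) simp
    qed
    then have "(\<lambda>f. \<Sum>i\<in>UNIV. axis i (f i) :: real^'d^'d^'m) \<in> borel_measurable ?P" by (intro borel_measurable_sum)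
    also have "(\<lambda>f. \<Sum>i\<in>UNIV. axis i (f i) :: real^'d^'d^'m) = J"
      by (simp add: J_def fun_eq_iff vec_eq_iff axis_def if_distrib[of "\<lambda>v. v $ _"] cong: if_cong)
    finally show ?thesis .
  qed
  have tuple: "(\<lambda>\<omega>. \<lambda>i\<in>UNIV. X i \<omega>) \<in> M \<rightarrow>\<^sub>M ?P" if "\<And>i. X i \<in> M \<rightarrow>\<^sub>M ?O" for X :: "'m \<Rightarrow> 'w \<Rightarrow> real^'d^'d"
    using that by (intro measurable_restrict)
  have law: "distr M borel (\<lambda>\<omega>. \<chi> i. X i \<omega>) = distr (\<Pi>\<^sub>M i\<in>UNIV. distr M ?O (X i)) borel J"
    if X: "indep_vars (\<lambda>_. ?O) X UNIV" for X :: "'m \<Rightarrow> 'w \<Rightarrow> real^'d^'d"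
  proof -
    have Xm: "X i \<in> M \<rightarrow>\<^sub>M ?O" for i using X by (auto simp: indep_vars_def)
    have "distr M borel (\<lambda>\<omega>. \<chi> i. X i \<omega>) = distr M borel (J \<circ> (\<lambda>\<omega>. \<lambda>i\<in>UNIV. X i \<omega>))"
      by (simp add: J_def o_def)
    also have "\<dots> = distr (distr M ?P (\<lambda>\<omega>. \<lambda>i\<in>UNIV. X i \<omega>)) borel J"
      by (rule distr_distr[OF J tuple[OF Xm], symmetric])
    also have "distr M ?P (\<lambda>\<omega>. \<lambda>i\<in>UNIV. X i \<omega>) = (\<Pi>\<^sub>M i\<in>UNIV. distr M ?O (X i))"
      using X indep_vars_iff_distr_eq_PiM[where I=UNIV and M'="\<lambda>_. ?O" and X=X] Xm by simp
    finally show ?thesis .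
  qed
  show q: "(\<lambda>\<omega>. \<chi> i. Q i \<omega>) \<in> borel_measurable M"
    using measurable_compose[OF tuple[OF Q] J] by (simp add: J_def)
  let ?\<rho> = "distr M borel (\<lambda>\<omega>. \<chi> i. Q i \<omega>)"
  show "block_haar ?\<rho>"
  proof (rule block_haar.intro)
    show "prob_space ?\<rho>" by (rule prob_space_distr[OF q])
    show "sets ?\<rho> = sets borel" by simp
    show "AE q in ?\<rho>. block_orthogonal q"
    proof (subst AE_distr_iff[OF q])
      show "{q \<in> space borel. block_orthogonal q} \<in> sets borel"
        using borel_closed[OF closed_block_orthogonal] by simp
      show "AE \<omega> in M. block_orthogonal (\<chi> i. Q i \<omega>)"
        by (intro AE_I2) (simp add: block_orthogonal_def Qo)
    qed
    fix r :: "real^'d^'d^'m" assume r: "block_orthogonal r"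
    have ro: "orthogonal_matrix (r $ i)" for i using r by (simp add: block_orthogonal_def)
    have mr: "(\<lambda>Q. Q ** r $ i) \<in> ?O \<rightarrow>\<^sub>M ?O" for i
    proof -
      have "(\<lambda>Q. (Q, r $ i)) \<in> ?O \<rightarrow>\<^sub>M ?O \<Otimes>\<^sub>M ?O" using ro by (intro measurable_Pair2') (simp add: space_orthogonal_borel)
      from measurable_compose[OF this measurable_matrix_mult_orthogonal] show ?thesis by simp
    qed
    define X where "X i \<omega> = Q i \<omega> ** r $ i" for i \<omega>
    have X: "indep_vars (\<lambda>_. ?O) X UNIV"
      unfolding X_def using indep_vars_compose2[OF indep, of "\<lambda>i Q. Q ** r $ i"] mr by simp
    have XQ: "distr M ?O (X i) = distr M ?O (Q i)" for i
    proof -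
      have "distr M ?O (X i) = distr (distr M ?O (Q i)) ?O (\<lambda>Q. Q ** r $ i)"
        by (subst distr_distr[OF mr Q]) (simp add: X_def[abs_def] o_def)
      also have "\<dots> = distr M ?O (Q i)" by (rule orthogonal_haar_right_invariant[OF haar ro])
      finally show ?thesis .
    qed
    have bm: "(\<lambda>q. block_mult q r) \<in> borel_measurable borel"
      by (intro borel_measurable_continuous_onI continuous_block_mult continuous_intros)
    have "distr ?\<rho> borel (\<lambda>q. block_mult q r) = distr M borel (\<lambda>\<omega>. \<chi> i. X i \<omega>)"
      by (subst distr_distr[OF bm q]) (simp add: o_def block_mult_def X_def)
    also have "\<dots> = ?\<rho>" unfolding law[OF X] law[OF indep] XQ ..
    finally show "distr ?\<rho> borel (\<lambda>q. block_mult q r) = ?\<rho>" .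
  qed
qed

section \<open>The two expectations\<close>

lemma dim_orthogonal_comp:
  fixes L :: "'a::euclidean_space set"
  assumes "subspace L"
  shows "dim (L\<^sup>\<bottom>) = DIM('a) - dim L"
  using dim_subspace_orthogonal_to_vectors[OF assms subspace_UNIV] by (simp add: orthogonal_comp_def)

lemma biconic_orthogonal_comp:
  assumes "subspace L"
  shows "biconic (L\<^sup>\<bottom>) D C = biconic L C D"
  using assms by (auto simp: biconic_def orth_proj_orthogonal_comp)

lemma sum_conic_intrinsic_volumes:
  fixes K :: "'a::euclidean_space set"
  assumes K: "polyhedral_cone K"
  shows "(\<Sum>j=a..b. conic_intrinsic_volume j K) =
    (\<Sum>L\<in>{L\<in>{span F | F. cone_face K F}. a \<le> dim L \<and> dim L \<le> b}. measure gauss (biconic L K (polar K)))"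
    (is "_ = sum ?g ?P")
proof -
  have fin: "finite ?P" using finite_face_spans[OF K] by (rule rev_finite_subset) auto
  have "(\<Sum>j=a..b. conic_intrinsic_volume j K) = (\<Sum>j=a..b. sum ?g {L\<in>?P. dim L = j})"
  proof (rule sum.cong[OF refl])
    fix j assume "j \<in> {a..b}"
    then have "face_spans j K = {L\<in>?P. dim L = j}" by (auto simp: face_spans_def)
    then show "conic_intrinsic_volume j K = sum ?g {L\<in>?P. dim L = j}"
      by (simp only: conic_intrinsic_volume_eq[OF polyhedral_cone_closed[OF K]])
  qed
  also have "\<dots> = sum ?g ?P" by (rule sum.group[OF fin]) auto
  finally show ?thesis .
qed

lemma gauss_image_measurable:
  fixes K :: "(real^'d^'m::finite) set"
  assumes "closed K"
  shows "(\<lambda>q. measure gauss (block_map T q ` K)) \<in> borel_measurable borel"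
proof -
  interpret G: prob_space "gauss :: (real^'d) measure" by (rule prob_space_gauss)
  have "{p :: (real^'d^'d^'m) \<times> (real^'d). snd p \<in> block_map T (fst p) ` K} \<in> sets borel"
    by (intro mem_image_borel assms continuous_intros)
  moreover have "sets ((borel :: (real^'d^'d^'m) measure) \<Otimes>\<^sub>M (gauss :: (real^'d) measure)) = sets borel"
    unfolding borel_prod[symmetric] by (intro sets_pair_measure_cong) simp_all
  ultimately have "{p. snd p \<in> block_map T (fst p) ` K} \<in>
      sets ((borel :: (real^'d^'d^'m) measure) \<Otimes>\<^sub>M (gauss :: (real^'d) measure))" by blast
  from G.measurable_emeasure_Pair[OF this]
  have "(\<lambda>q. emeasure gauss (block_map T q ` K)) \<in> borel_measurable borel"
    by (simp add: vimage_def)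
  then show ?thesis unfolding measure_def by measurable
qed

context block_haar begin

text \<open>The general form of the expectation formula, in which any finite family \<open>LL\<close> of product
  subspaces may take the place of the face spans if every pair of orthogonal vectors of the
  cone and its polar lies in \<open>L\<close> and \<open>L\<^sup>\<bottom>\<close> for some member \<open>L\<close>. This serves both for a cone
  and for its polar.\<close>

lemma integral_gauss_image:
  assumes T: "\<And>i. invertible (T i)" and C: "\<And>i. polyhedral_cone (C i)"
    and LL: "finite LL" "\<And>L. L \<in> LL \<Longrightarrow> \<exists>V. (\<forall>i. subspace (V i)) \<and> L = cone_product V"
    and comp: "\<And>x n. x \<in> cone_product C \<Longrightarrow> n \<in> polar (cone_product C) \<Longrightarrow> x \<bullet> n = 0 \<Longrightarrow>
      \<exists>L\<in>LL. x \<in> L \<and> n \<in> L\<^sup>\<bottom>"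
  shows "(\<integral>q. measure gauss (block_map T q ` cone_product C) \<partial>\<rho>) =
    (\<Sum>L\<in>{L\<in>LL. CARD('d) \<le> dim L}. measure gauss (biconic L (cone_product C) (polar (cone_product C))))"
proof -
  interpret G: prob_space "gauss :: (real^'d) measure" by (rule prob_space_gauss)
  interpret E: prob_space "gauss :: (real^'d^'m) measure" by (rule prob_space_gauss)
  let ?f = "\<lambda>q. measure gauss (block_map T q ` cone_product C)"
  have "closed (cone_product C)" using C by (intro polyhedral_cone_closed polyhedral_cone_product)
  then have "?f \<in> borel_measurable borel" by (rule gauss_image_measurable)
  then have f: "?f \<in> borel_measurable \<rho>" using measurable_cong_sets[OF sets_\<rho> refl] by blast
  have "(\<integral>q. ?f q \<partial>\<rho>) = enn2real (\<integral>\<^sup>+q. ennreal (?f q) \<partial>\<rho>)"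
    by (rule integral_eq_nn_integral[OF f]) simp
  also have "(\<integral>\<^sup>+q. ennreal (?f q) \<partial>\<rho>) = (\<Sum>L\<in>{L\<in>LL. CARD('d) \<le> dim L}.
      ennreal (measure gauss (biconic L (cone_product C) (polar (cone_product C)))))"
    using nn_integral_gauss_image[OF T C LL comp]
    by (simp only: G.emeasure_eq_measure E.emeasure_eq_measure)
  finally show ?thesis by (simp add: sum_nonneg)
qed

lemma integral_gauss_image_intrinsic_volumes:
  assumes T: "\<And>i. invertible (T i)" and C: "\<And>i. polyhedral_cone (C i)" and m: "CARD('m) = n + 1"
  shows "(\<integral>q. measure gauss (block_map T q ` cone_product C) \<partial>\<rho>) =
    (\<Sum>j=0..n * CARD('d). conic_intrinsic_volume (CARD('d) + j) (cone_product C))"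
proof -
  let ?K = "cone_product C"
  have K: "polyhedral_cone ?K" using C by (rule polyhedral_cone_product)
  have 0: "0 \<in> C i" for i using polyhedral_cone_convex_cone[OF C] by (rule convex_cone_contains_0)
  let ?LL = "{span F | F. cone_face ?K F}"
  have "(\<integral>q. measure gauss (block_map T q ` ?K) \<partial>\<rho>) =
      (\<Sum>L\<in>{L\<in>?LL. CARD('d) \<le> dim L}. measure gauss (biconic L ?K (polar ?K)))"
  proof (rule integral_gauss_image[OF T C])
    show "finite ?LL" by (rule finite_face_spans[OF K])
    show "\<exists>V. (\<forall>i. subspace (V i)) \<and> L = cone_product V" if L: "L \<in> ?LL" for L
    proof -
      obtain F where F: "cone_face ?K F" "L = span F" using L by blast
      obtain V where "\<And>i. subspace (V i)" "span F = cone_product V"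
        using face_span_cone_product[where C=C, OF 0 F(1)] by blast
      then show ?thesis using F(2) by blast
    qed
    show "\<exists>L\<in>?LL. x \<in> L \<and> n \<in> L\<^sup>\<bottom>" if xn: "x \<in> ?K" "n \<in> polar ?K" "x \<bullet> n = 0" for x n
    proof -
      obtain F where F: "cone_face ?K F" "x \<in> F" "n \<in> (span F)\<^sup>\<bottom>"
        by (rule polyhedral_cone_complementary_face[OF K xn])
      then have "x \<in> span F" by (simp add: span_base)
      then show ?thesis using F by blast
    qed
  qed
  also have "{L\<in>?LL. CARD('d) \<le> dim L} = {L\<in>?LL. CARD('d) \<le> dim L \<and> dim L \<le> CARD('d) + n * CARD('d)}"
  proof -
    have "dim L \<le> CARD('d) + n * CARD('d)" for L :: "(real^'d^'m) set"
      using dim_subset_UNIV[of L] m by simp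
    then show ?thesis by blast
  qed
  also have "(\<Sum>L\<in>\<dots>. measure gauss (biconic L ?K (polar ?K))) =
      (\<Sum>j=CARD('d)..CARD('d) + n * CARD('d). conic_intrinsic_volume j ?K)"
    by (rule sum_conic_intrinsic_volumes[OF K, symmetric])
  also have "\<dots> = (\<Sum>j=0..n * CARD('d). conic_intrinsic_volume (CARD('d) + j) ?K)"
    using sum.shift_bounds_cl_nat_ivl[of "\<lambda>j. conic_intrinsic_volume j ?K" 0 "CARD('d)" "n * CARD('d)"]
    by (simp add: add.commute)
  finally show ?thesis .
qed

text \<open>The family \<open>L\<^sup>\<bottom>\<close>, with \<open>L\<close> ranging over the face spans of \<open>cone_product C\<close>, satisfies the
  hypothesis of \<open>integral_gauss_image\<close> for the polar cone, and \<open>biconic (L\<^sup>\<bottom>)\<close> with the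
  cones exchanged is \<open>biconic L\<close>.\<close>

lemma integral_gauss_image_polar_intrinsic_volumes:
  assumes T: "\<And>i. invertible (T i)" and C: "\<And>i. polyhedral_cone (C i)" and m: "CARD('m) = n + 1"
  shows "(\<integral>q. measure gauss (block_map T q ` cone_product (\<lambda>i. polar (C i))) \<partial>\<rho>) =
    (\<Sum>j=0..n * CARD('d). conic_intrinsic_volume j (cone_product C))"
proof -
  let ?K = "cone_product C"
  have K: "polyhedral_cone ?K" using C by (rule polyhedral_cone_product)
  have 0: "0 \<in> C i" for i using polyhedral_cone_convex_cone[OF C] by (rule convex_cone_contains_0)
  have polK: "polar ?K = cone_product (\<lambda>i. polar (C i))" using 0 by (rule polar_cone_product)
  note pp = polyhedral_cone_polar_polar[OF K]
  let ?LL = "{span F | F. cone_face ?K F}"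
  have sub: "subspace L" if "L \<in> ?LL" for L using that by auto
  have "(\<integral>q. measure gauss (block_map T q ` cone_product (\<lambda>i. polar (C i))) \<partial>\<rho>) =
      (\<Sum>M\<in>{M\<in>orthogonal_comp ` ?LL. CARD('d) \<le> dim M}. measure gauss (biconic M (polar ?K) (polar (polar ?K))))"
    unfolding polK
  proof (rule integral_gauss_image[OF T polyhedral_cone_polar[OF C]])
    show "finite (orthogonal_comp ` ?LL)" using finite_face_spans[OF K] by (rule finite_imageI)
    show "\<exists>V. (\<forall>i. subspace (V i)) \<and> M = cone_product V" if M: "M \<in> orthogonal_comp ` ?LL" for M
    proof -
      obtain F where F: "cone_face ?K F" "M = (span F)\<^sup>\<bottom>" using M by blast
      obtain V where V: "\<And>i. subspace (V i)" "span F = cone_product V"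
        using face_span_cone_product[where C=C, OF 0 F(1)] by blast
      have "M = polar (cone_product V)"
        unfolding F(2) V(2)[symmetric] by (rule polar_subspace[OF subspace_span, symmetric])
      also have "\<dots> = cone_product (\<lambda>i. polar (V i))" using V(1) by (intro polar_cone_product subspace_0)
      finally show ?thesis
        using V(1) by (intro exI[of _ "\<lambda>i. polar (V i)"]) (simp add: polar_subspace subspace_orthogonal_comp)
    qed
    show "\<exists>M\<in>orthogonal_comp ` ?LL. x \<in> M \<and> n \<in> M\<^sup>\<bottom>"
      if "x \<in> cone_product (\<lambda>i. polar (C i))" "n \<in> polar (cone_product (\<lambda>i. polar (C i)))" "x \<bullet> n = 0" for x n
    proof -
      have "n \<in> ?K" "x \<in> polar ?K" "n \<bullet> x = 0"
        using that pp by (simp_all add: polK inner_commute)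
      then obtain F where F: "cone_face ?K F" "n \<in> F" "x \<in> (span F)\<^sup>\<bottom>"
        by (rule polyhedral_cone_complementary_face[OF K])
      then have "n \<in> (span F)\<^sup>\<bottom>\<^sup>\<bottom>" by (simp add: orthogonal_comp_self span_base)
      then show ?thesis using F by blast
    qed
  qed
  also have "\<dots> = (\<Sum>L\<in>{L\<in>?LL. 0 \<le> dim L \<and> dim L \<le> n * CARD('d)}. measure gauss (biconic L ?K (polar ?K)))"
  proof (rule sum.reindex_bij_witness[of _ orthogonal_comp orthogonal_comp])
    have dim: "CARD('d) \<le> dim (L\<^sup>\<bottom>) \<longleftrightarrow> dim L \<le> n * CARD('d)" if "L \<in> ?LL" for L
      using dim_orthogonal_comp[OF sub[OF that]] dim_subset_UNIV[of L] m by auto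
    fix M assume M: "M \<in> {M\<in>orthogonal_comp ` ?LL. CARD('d) \<le> dim M}"
    then obtain L where L: "L \<in> ?LL" "M = L\<^sup>\<bottom>" "CARD('d) \<le> dim (L\<^sup>\<bottom>)" by blast
    have LL: "M\<^sup>\<bottom> = L" using L(2) by (simp add: orthogonal_comp_self[OF sub[OF L(1)]])
    show "M\<^sup>\<bottom>\<^sup>\<bottom> = M" using LL L(2) by simp
    show "M\<^sup>\<bottom> \<in> {L\<in>?LL. 0 \<le> dim L \<and> dim L \<le> n * CARD('d)}" using LL L(1,3) dim[OF L(1)] by simp
    show "measure gauss (biconic (M\<^sup>\<bottom>) ?K (polar ?K)) = measure gauss (biconic M (polar ?K) (polar (polar ?K)))"
      unfolding LL unfolding L(2) pp biconic_orthogonal_comp[OF sub[OF L(1)]] ..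
  next
    have dim: "CARD('d) \<le> dim (L\<^sup>\<bottom>) \<longleftrightarrow> dim L \<le> n * CARD('d)" if "L \<in> ?LL" for L
      using dim_orthogonal_comp[OF sub[OF that]] dim_subset_UNIV[of L] m by auto
    fix L assume L: "L \<in> {L\<in>?LL. 0 \<le> dim L \<and> dim L \<le> n * CARD('d)}"
    then have L': "L \<in> ?LL" by blast
    show "L\<^sup>\<bottom>\<^sup>\<bottom> = L" by (rule orthogonal_comp_self[OF sub[OF L']])
    show "L\<^sup>\<bottom> \<in> {M\<in>orthogonal_comp ` ?LL. CARD('d) \<le> dim M}" using L dim[OF L'] by blast
  qed
  also have "\<dots> = (\<Sum>j=0..n * CARD('d). conic_intrinsic_volume j ?K)"
    by (rule sum_conic_intrinsic_volumes[OF K, symmetric])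
  finally show ?thesis .
qed

end

theorem corollary1p4:
  fixes n :: nat
    and C :: "'m::finite \<Rightarrow> (real^'d) set"
    and T :: "'m \<Rightarrow> real^'d^'d"
    and M :: "'w measure"
    and Q :: "'m \<Rightarrow> 'w \<Rightarrow> real^'d^'d"
  assumes "CARD('m) = n + 1"
    and "\<And>i. polyhedral_cone (C i)"
    and "\<And>i. invertible (T i)"
    and "prob_space M"
    and "prob_space.indep_vars M (\<lambda>_. orthogonal_borel) Q UNIV"
    and "\<And>i. is_orthogonal_haar (distr M orthogonal_borel (Q i))"
  shows "integrable M (\<lambda>\<omega>. conic_intrinsic_volume 0 (\<Inter>i. (\<lambda>x. T i *v (Q i \<omega> *v x)) ` C i))
    \<and> prob_space.expectation M
        (\<lambda>\<omega>. conic_intrinsic_volume 0 (\<Inter>i. (\<lambda>x. T i *v (Q i \<omega> *v x)) ` C i))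
      = (\<Sum>j=0..n * CARD('d). conic_intrinsic_volume j (cone_product C))
    \<and> integrable M
        (\<lambda>\<omega>. conic_intrinsic_volume CARD('d) (\<Sum>i\<in>UNIV. (\<lambda>x. T i *v (Q i \<omega> *v x)) ` C i))
    \<and> prob_space.expectation M
        (\<lambda>\<omega>. conic_intrinsic_volume CARD('d) (\<Sum>i\<in>UNIV. (\<lambda>x. T i *v (Q i \<omega> *v x)) ` C i))
      = (\<Sum>j=0..n * CARD('d). conic_intrinsic_volume (CARD('d) + j) (cone_product C))"
proof -
  interpret prob_space M by fact
  note C = assms(2) and T = assms(3)
  define q where "q \<omega> = (\<chi> i. Q i \<omega>)" for \<omega>
  have q: "q \<in> borel_measurable M" and haar: "block_haar (distr M borel q)"
    using block_haar_independent[OF assms(4-6)] by (simp_all add: q_def[abs_def])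
  interpret H: block_haar "distr M borel q" by (rule haar)
  interpret G: prob_space "gauss :: (real^'d) measure" by (rule prob_space_gauss)
  have Qo: "orthogonal_matrix (Q i \<omega>)" if "\<omega> \<in> space M" for i \<omega>
    using assms(5) measurable_space[of "Q i" M orthogonal_borel \<omega>] that
    by (auto simp: indep_vars_def space_orthogonal_borel)
  have image: "integrable M (\<lambda>\<omega>. measure gauss (block_map S (q \<omega>) ` K)) \<and>
      expectation (\<lambda>\<omega>. measure gauss (block_map S (q \<omega>) ` K)) =
        (\<integral>q. measure gauss (block_map S q ` K) \<partial>distr M borel q)"
    if "closed K" for S :: "'m \<Rightarrow> real^'d^'d" and K
  proof
    note f = gauss_image_measurable[OF that, of S]
    show "integrable M (\<lambda>\<omega>. measure gauss (block_map S (q \<omega>) ` K))"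
      by (rule integrable_const_bound[of _ 1]) (use measurable_compose[OF q f] in auto)
    show "expectation (\<lambda>\<omega>. measure gauss (block_map S (q \<omega>) ` K)) =
        (\<integral>q. measure gauss (block_map S q ` K) \<partial>distr M borel q)"
      by (rule integral_distr[OF q f, symmetric])
  qed
  have "\<forall>i. \<exists>B. B ** T i = mat 1 \<and> T i ** B = mat 1" using T by (auto simp: invertible_def)
  then obtain B where B: "\<And>i. B i ** T i = mat 1" "\<And>i. T i ** B i = mat 1" by metis
  define T' where "T' i = transpose (B i)" for i
  have T': "invertible (T' i)" for i
    using B[of i] by (auto simp: T'_def invertible_def matrix_transpose_mul[symmetric] intro!: exI[of _ "transpose (T i)"])
  let ?K = "cone_product C" and ?K' = "cone_product (\<lambda>i. polar (C i))"
  have K: "closed ?K" "closed ?K'"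
    using C by (auto intro!: polyhedral_cone_closed polyhedral_cone_product polyhedral_cone_polar)
  have v0: "conic_intrinsic_volume 0 (\<Inter>i. (\<lambda>x. T i *v (Q i \<omega> *v x)) ` C i) =
      measure gauss (block_map T' (q \<omega>) ` ?K')" if "\<omega> \<in> space M" for \<omega>
    using polar_Inter_images[where f="\<lambda>i. Q i \<omega>" and B=B and T=T and C=C, OF C B Qo[OF that]]
    by (simp add: conic_intrinsic_volume_0 q_def T'_def[abs_def])
  have vd: "conic_intrinsic_volume CARD('d) (\<Sum>i\<in>UNIV. (\<lambda>x. T i *v (Q i \<omega> *v x)) ` C i) =
      measure gauss (block_map T (q \<omega>) ` ?K)" for \<omega>
  proof -
    have "polyhedral_cone (block_map T (q \<omega>) ` ?K)"
      by (intro polyhedral_cone_linear_image linear_block_map polyhedral_cone_product C)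
    then have "closed (block_map T (q \<omega>) ` ?K)" by (rule polyhedral_cone_closed)
    from conic_intrinsic_volume_top[OF this] show ?thesis
      unfolding Minkowski_sum_eq_image q_def by simp
  qed
  show ?thesis
  proof (intro conjI)
    show "integrable M (\<lambda>\<omega>. conic_intrinsic_volume 0 (\<Inter>i. (\<lambda>x. T i *v (Q i \<omega> *v x)) ` C i))"
      using image[OF K(2), of T'] by (subst Bochner_Integration.integrable_cong[OF refl v0]) auto
    show "expectation (\<lambda>\<omega>. conic_intrinsic_volume 0 (\<Inter>i. (\<lambda>x. T i *v (Q i \<omega> *v x)) ` C i)) =
        (\<Sum>j=0..n * CARD('d). conic_intrinsic_volume j ?K)"
      using image[OF K(2), of T'] H.integral_gauss_image_polar_intrinsic_volumes[OF T' C assms(1)]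
      by (subst Bochner_Integration.integral_cong[OF refl v0]) auto
    show "integrable M (\<lambda>\<omega>. conic_intrinsic_volume CARD('d) (\<Sum>i\<in>UNIV. (\<lambda>x. T i *v (Q i \<omega> *v x)) ` C i))"
      unfolding vd using image[OF K(1), of T] by blast
    show "expectation (\<lambda>\<omega>. conic_intrinsic_volume CARD('d) (\<Sum>i\<in>UNIV. (\<lambda>x. T i *v (Q i \<omega> *v x)) ` C i)) =
        (\<Sum>j=0..n * CARD('d). conic_intrinsic_volume (CARD('d) + j) ?K)"
      unfolding vd using image[OF K(1), of T] H.integral_gauss_image_intrinsic_volumes[OF T C assms(1)] by simp
  qed
qed

end
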